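(* Let $Y_i=h_0(X_i)+\epsilon_i$, $E[\epsilon_i|X_i]=0$, and let $\widehat h$, $\widetilde h$, $h_{0,K}$, $\widetilde B_w$, $\zeta_{K,n}$, $\lambda_{K,n}$ be as defined in the context. Suppose: (1) $\{X_i\}_{i=-\infty}^\infty$ is strictly stationary. (2) With $\mathcal F_{i-1}=\sigma(X_i,\epsilon_{i-1},X_{i-1},\ldots)$, $\{\epsilon_i,\mathcal F_{i-1}\}_{i=1}^n$ is a strictly stationary martingale difference sequence and $E[\epsilon_i^2|\mathcal F_{i-1}]$ is uniformly bounded for all $i\ge1$, almost surely. (3) $\lambda_{\min}(E[b_w^K(X_i)b_w^K(X_i)'])>0$ for each $K$ and $n$. (4) Either $\{X_i\}_{i=1}^n$ is i.i.d. and $\zeta_{K,n}\lambda_{K,n}\sqrt{(\log K)/n}=o(1)$, or $\|(\widetilde B_w'\widetilde B_w/n)-I_K\|=o_p(1)$. Then $$\|\widehat h-\widetilde h\|_{L^2(X)}=O_p\big(\sqrt{K/n}\big)\quad\text{and}\quad\|\widetilde h-h_0\|_{L^2(X)}=O_p\big(\|h_0-h_{0,K}\|_{L^2(X)}\big).$$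
   Context: Asymptotics are as $n\to\infty$ with $K=K(n)\to\infty$. $\|\cdot\|$ is the Euclidean norm of a vector or the spectral norm of a matrix; $^-$ is the Moore–Penrose inverse; $\lambda_{\min}$ is the smallest eigenvalue. $\|f\|_{L^2(X)}=(\int f^2\,dP_X)^{1/2}$, where $P_X$ is the marginal law of $X_i$ (for estimators, the integral is over $x$ with the sample held fixed). $X_i$ takes values in $\mathcal X\subseteq\mathbb R^d$; $\mathcal D_n\subseteq\mathcal X$ is compact, convex, with nonempty interior and $\mathcal D_n\subseteq\mathcal D_{n+1}$; $w_n(x)=1$ if $x\in\mathcal D_n$ and $0$ otherwise. For sieve basis functions $b_{K1},\ldots,b_{KK}$ put $b_w^K(x)=(b_{K1}(x)w_n(x),\ldots,b_{KK}(x)w_n(x))'$, $B_{K,w}$ the linear span of its entries, $B_w=(b_w^K(X_1),\ldots,b_w^K(X_n))'$, $Y=(Y_1,\ldots,Y_n)'$, $H_0=(h_0(X_1),\ldots,h_0(X_n))'$. The series LS estimator is $\widehat h(x)=b_w^K(x)'(B_w'B_w)^-B_w'Y$; $\widetilde h(x)=b_w^K(x)'(B_w'B_w)^-B_w'H_0$; $h_{0,K}$ is the $L^2(X)$ orthogonal projection of $h_0$ onto $B_{K,w}$. $\zeta_{K,n}=\sup_x\|b_w^K(x)\|$, $\lambda_{K,n}=[\lambda_{\min}(E[b_w^K(X_i)b_w^K(X_i)'])]^{-1/2}$, $\widetilde b_w^K(x)=E[b_w^K(X_i)b_w^K(X_i)']^{-1/2}b_w^K(x)$, $\widetilde B_w=(\widetilde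 b_w^K(X_1),\ldots,\widetilde b_w^K(X_n))'$. *)

theory Defs
  imports
    "HOL-Probability.Probability"
    "Jordan_Normal_Form.Char_Poly"
begin

text \<open>
  Since the sieve dimension \<open>K = K(n)\<close> grows with the sample size, vectors and matrices are the
  dynamically sized ones of \<^theory>\<open>Jordan_Normal_Form.Matrix\<close>, whose indices start at 0.
\<close>

hide_const (open) Finite_Cartesian_Product.vec Finite_Cartesian_Product.mat

unbundle no vec_syntax
unbundle no inner_syntax

subsection \<open>Vectors and matrices\<close>

definition eucl_norm :: "real Matrix.vec \<Rightarrow> real" where
  "eucl_norm v = sqrt (v \<bullet> v)"

definition spectral_norm :: "real Matrix.mat \<Rightarrow> real" where
  "spectral_norm A =
     (SUP v\<in>{v \<in> carrier_vec (dim_col A). eucl_norm v \<le> 1}. eucl_norm (A *\<^sub>v v))"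

text \<open>Meaningful for symmetric matrices of positive dimension, the only case in which it is used.\<close>

definition lambda_min :: "real Matrix.mat \<Rightarrow> real" where
  "lambda_min A = Min {k. eigenvalue A k}"

definition is_moore_penrose :: "real Matrix.mat \<Rightarrow> real Matrix.mat \<Rightarrow> bool" where
  "is_moore_penrose A B \<longleftrightarrow>
     B \<in> carrier_mat (dim_col A) (dim_row A) \<and>
     A * B * A = A \<and> B * A * B = B \<and>
     transpose_mat (A * B) = A * B \<and> transpose_mat (B * A) = B * A"

definition moore_penrose :: "real Matrix.mat \<Rightarrow> real Matrix.mat" where
  "moore_penrose A = (THE B. is_moore_penrose A B)"

text \<open>For positive definite \<open>A\<close> exactly one matrix satisfies the predicate below.\<close>

definition is_inv_sqrt :: "real Matrix.mat \<Rightarrow> real Matrix.mat \<Rightarrow> bool" where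
  "is_inv_sqrt A R \<longleftrightarrow>
     R \<in> carrier_mat (dim_row A) (dim_row A) \<and> transpose_mat R = R \<and>
     (\<forall>v \<in> carrier_vec (dim_row A). v \<noteq> 0\<^sub>v (dim_row A) \<longrightarrow> 0 < v \<bullet> (R *\<^sub>v v)) \<and>
     inverts_mat (R * R) A \<and> inverts_mat A (R * R)"

definition inv_sqrt_mat :: "real Matrix.mat \<Rightarrow> real Matrix.mat" where
  "inv_sqrt_mat A = (SOME R. is_inv_sqrt A R)"

subsection \<open>Stochastic order symbols\<close>

text \<open>
  Probabilities are taken as outer probabilities. By \<open>outer_measure_of_eq\<close> this is the usual
  probability on measurable events, whereas \<open>measure M A\<close> would silently be 0 on
  a non-measurable set.
\<close>

definition bigO_p :: "'w measure \<Rightarrow> (nat \<Rightarrow> 'w \<Rightarrow> real) \<Rightarrow> (nat \<Rightarrow> real) \<Rightarrow> bool" where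
  "bigO_p M Z a \<longleftrightarrow>
     (\<forall>\<eta>>0. \<exists>C>0. \<forall>\<^sub>F n in sequentially.
        outer_measure_of M {\<omega> \<in> space M. \<bar>Z n \<omega>\<bar> > C * a n} < ennreal \<eta>)"

definition smallo_p :: "'w measure \<Rightarrow> (nat \<Rightarrow> 'w \<Rightarrow> real) \<Rightarrow> (nat \<Rightarrow> real) \<Rightarrow> bool" where
  "smallo_p M Z a \<longleftrightarrow>
     (\<forall>\<delta>>0. (\<lambda>n. outer_measure_of M {\<omega> \<in> space M. \<bar>Z n \<omega>\<bar> > \<delta> * a n}) \<longlonglongrightarrow> 0)"

subsection \<open>Stochastic processes\<close>

definition strictly_stationary ::
  "'w measure \<Rightarrow> 'b measure \<Rightarrow> int set \<Rightarrow> (int \<Rightarrow> 'w \<Rightarrow> 'b) \<Rightarrow> bool" where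
  "strictly_stationary M N I Z \<longleftrightarrow>
     (\<forall>i\<in>I. Z i \<in> measurable M N) \<and>
     (\<forall>J k. finite J \<and> J \<subseteq> I \<and> (\<lambda>j. j + k) ` J \<subseteq> I \<longrightarrow>
        distr M (Pi\<^sub>M J (\<lambda>_. N)) (\<lambda>\<omega>. \<lambda>j\<in>J. Z (j + k) \<omega>) =
        distr M (Pi\<^sub>M J (\<lambda>_. N)) (\<lambda>\<omega>. \<lambda>j\<in>J. Z j \<omega>))"

definition iid_vars ::
  "'w measure \<Rightarrow> 'b measure \<Rightarrow> int set \<Rightarrow> (int \<Rightarrow> 'w \<Rightarrow> 'b) \<Rightarrow> bool" where
  "iid_vars M N I Z \<longleftrightarrow>
     prob_space.indep_vars M (\<lambda>_. N) Z I \<and>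
     (\<forall>i\<in>I. \<forall>j\<in>I. distr M N (Z i) = distr M N (Z j))"

text \<open>\<open>past_algebra M N X e i\<close> is \<open>\<sigma>(X\<^sub>i\<^sub>+\<^sub>1, e\<^sub>i, X\<^sub>i, e\<^sub>i\<^sub>-\<^sub>1, X\<^sub>i\<^sub>-\<^sub>1, \<dots>)\<close>.\<close>

definition past_algebra ::
  "'w measure \<Rightarrow> 'a measure \<Rightarrow> (int \<Rightarrow> 'w \<Rightarrow> 'a) \<Rightarrow> (int \<Rightarrow> 'w \<Rightarrow> real) \<Rightarrow> int \<Rightarrow> 'w measure"
where
  "past_algebra M N X e i = sigma (space M)
     ({X j -` A \<inter> space M | j A. j \<le> i + 1 \<and> A \<in> sets N} \<union>
      {e j -` A \<inter> space M | j A. j \<le> i \<and> A \<in> sets borel})"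

definition martingale_difference ::
  "'w measure \<Rightarrow> (int \<Rightarrow> 'w measure) \<Rightarrow> int set \<Rightarrow> (int \<Rightarrow> 'w \<Rightarrow> real) \<Rightarrow> bool" where
  "martingale_difference M F I e \<longleftrightarrow>
     (\<forall>i. subalgebra M (F i)) \<and> (\<forall>i j. i \<le> j \<longrightarrow> sets (F i) \<subseteq> sets (F j)) \<and>
     (\<forall>i\<in>I. e i \<in> borel_measurable (F i) \<and> integrable M (e i) \<and>
        (AE \<omega> in M. real_cond_exp M (F (i - 1)) (e i) \<omega> = 0))"

subsection \<open>Series least squares\<close>

definition sieve_vec ::
  "(nat \<Rightarrow> nat \<Rightarrow> 'a \<Rightarrow> real) \<Rightarrow> (nat \<Rightarrow> 'a set) \<Rightarrow> nat \<Rightarrow> nat \<Rightarrow> 'a \<Rightarrow> real Matrix.vec" where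
  "sieve_vec b D K n x = Matrix.vec K (\<lambda>k. b K (Suc k) x * indicator (D n) x)"

definition sieve_space ::
  "(nat \<Rightarrow> nat \<Rightarrow> 'a \<Rightarrow> real) \<Rightarrow> (nat \<Rightarrow> 'a set) \<Rightarrow> nat \<Rightarrow> nat \<Rightarrow> ('a \<Rightarrow> real) set" where
  "sieve_space b D K n = {\<lambda>x. c \<bullet> sieve_vec b D K n x | c. c \<in> carrier_vec K}"

text \<open>Row \<open>i\<close> (counted from 0) belongs to observation number \<open>i + 1\<close>.\<close>

definition design_mat ::
  "nat \<Rightarrow> nat \<Rightarrow> ('a \<Rightarrow> real Matrix.vec) \<Rightarrow> (int \<Rightarrow> 'a) \<Rightarrow> real Matrix.mat" where
  "design_mat K n f xs = Matrix.mat n K (\<lambda>(i, k). f (xs (int i + 1)) $ k)"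

text \<open>
  \<open>series_ls K n f xs ys x\<close> is \<open>f(x)' (B'B)\<^sup>- B' (ys\<^sub>1, \<dots>, ys\<^sub>n)'\<close> with the design matrix \<open>B\<close> of \<open>f\<close>;
  the responses \<open>Y\<^sub>i\<close> give the series estimator, the values \<open>h\<^sub>0(X\<^sub>i)\<close> its noiseless version.
\<close>

definition series_ls ::
  "nat \<Rightarrow> nat \<Rightarrow> ('a \<Rightarrow> real Matrix.vec) \<Rightarrow> (int \<Rightarrow> 'a) \<Rightarrow> (int \<Rightarrow> real) \<Rightarrow> 'a \<Rightarrow> real" where
  "series_ls K n f xs ys x =
     (let B = design_mat K n f xs in
      f x \<bullet> ((moore_penrose (transpose_mat B * B) * transpose_mat B)
               *\<^sub>v Matrix.vec n (\<lambda>i. ys (int i + 1))))"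

text \<open>
  Non-integrable entries would be 0 by convention, so a positive smallest eigenvalue, forcing
  positive diagonal entries, entails that all second moments exist. The index 1 of \<open>X\<close> is
  immaterial under stationarity.
\<close>

definition gram_mat ::
  "'w measure \<Rightarrow> (int \<Rightarrow> 'w \<Rightarrow> 'a) \<Rightarrow> (nat \<Rightarrow> nat \<Rightarrow> 'a \<Rightarrow> real) \<Rightarrow> (nat \<Rightarrow> 'a set) \<Rightarrow>
   nat \<Rightarrow> nat \<Rightarrow> real Matrix.mat" where
  "gram_mat M X b D K n = Matrix.mat K K
     (\<lambda>(j, k). \<integral>\<omega>. sieve_vec b D K n (X 1 \<omega>) $ j * sieve_vec b D K n (X 1 \<omega>) $ k \<partial>M)"

definition sieve_vec_orth ::
  "'w measure \<Rightarrow> (int \<Rightarrow> 'w \<Rightarrow> 'a) \<Rightarrow> (nat \<Rightarrow> nat \<Rightarrow> 'a \<Rightarrow> real) \<Rightarrow> (nat \<Rightarrow> 'a set) \<Rightarrow>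
   nat \<Rightarrow> nat \<Rightarrow> 'a \<Rightarrow> real Matrix.vec" where
  "sieve_vec_orth M X b D K n x = inv_sqrt_mat (gram_mat M X b D K n) *\<^sub>v sieve_vec b D K n x"

text \<open>Valued in \<^typ>\<open>ennreal\<close>, as the basis functions need not be bounded.\<close>

definition zeta_Kn ::
  "'a set \<Rightarrow> (nat \<Rightarrow> nat \<Rightarrow> 'a \<Rightarrow> real) \<Rightarrow> (nat \<Rightarrow> 'a set) \<Rightarrow> nat \<Rightarrow> nat \<Rightarrow> ennreal" where
  "zeta_Kn S b D K n = (SUP x\<in>S. ennreal (eucl_norm (sieve_vec b D K n x)))"

definition lambda_Kn ::
  "'w measure \<Rightarrow> (int \<Rightarrow> 'w \<Rightarrow> 'a) \<Rightarrow> (nat \<Rightarrow> nat \<Rightarrow> 'a \<Rightarrow> real) \<Rightarrow> (nat \<Rightarrow> 'a set) \<Rightarrow>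
   nat \<Rightarrow> nat \<Rightarrow> real" where
  "lambda_Kn M X b D K n = lambda_min (gram_mat M X b D K n) powr (- 1 / 2)"

text \<open>Used only for square integrable functions; otherwise the integral would be 0 by convention.\<close>

definition L2_norm :: "'a measure \<Rightarrow> ('a \<Rightarrow> real) \<Rightarrow> real" where
  "L2_norm P f = sqrt (\<integral>x. (f x)\<^sup>2 \<partial>P)"

text \<open>\<open>g\<close> is (a version of) the orthogonal projection of \<open>h\<close> onto the linear space \<open>V\<close>.\<close>

definition is_L2_projection ::
  "'a measure \<Rightarrow> ('a \<Rightarrow> real) set \<Rightarrow> ('a \<Rightarrow> real) \<Rightarrow> ('a \<Rightarrow> real) \<Rightarrow> bool" where
  "is_L2_projection P V h g \<longleftrightarrow>
     g \<in> V \<and> (\<forall>v\<in>V. (\<integral>x. (h x - g x) * v x \<partial>P) = 0)"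

end

theory Submission
  imports Defs
begin

text \<open>
  Write \<open>f\<close> for the sieve vector, \<open>G\<close> for its Gram matrix and \<open>g = G\<^sup>-\<^sup>1\<^sup>/\<^sup>2 f\<close> for its whitened version, so that
  \<open>E[g g'] = I\<close> and every sieve function \<open>c'f\<close> is \<open>w'g\<close> with \<open>L\<^sup>2\<close> norm \<open>|w|\<close>. Both claims are deterministic
  on the event that the empirical norm dominates the population norm on the sieve space up to a constant,
  \<open>|w|\<^sup>2/32 \<le> n\<^sup>-\<^sup>1 \<Sum>\<^sub>i (w'g(X\<^sub>i))\<^sup>2\<close> for all \<open>w\<close>. There the normal equations are solvable and

    \<^item> the difference of the two estimators is \<open>w'g\<close> with \<open>n |w| \<le> 32 |\<Sum>\<^sub>i \<epsilon>\<^sub>i g(X\<^sub>i)|\<close>; by the martingale property and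
      the bounded conditional variance, the right-hand side has second moment of order \<open>n K\<close>;

    \<^item> the noiseless estimator minus the projection of \<open>h\<^sub>0\<close> is \<open>w'g\<close> with
      \<open>n |w|\<^sup>2 \<le> 32 \<Sum>\<^sub>i (h\<^sub>0 - h\<^sub>0\<^sub>K)(X\<^sub>i)\<^sup>2\<close>, because least squares is a contraction in the empirical norm; by
      stationarity the right-hand side has mean \<open>32 n \<parallel>h\<^sub>0 - h\<^sub>0\<^sub>K\<parallel>\<^sup>2\<close>.

  Markov's inequality then gives the two rates (\<open>series_ls_noise_rate\<close> and \<open>series_ls_approximation_rate\<close>).

  If the empirical Gram matrix converges to the identity, the event above visibly has probability
  tending to 1 (\<open>spectral_norm_near_identity\<close>). For independent data one needs a lower tail bound for the smallest
  eigenvalue of \<open>\<Sum>\<^sub>i v\<^sub>i v\<^sub>i'\<close> with independent, bounded, isotropic \<open>v\<^sub>i = g(X\<^sub>i)\<close>. Matrix exponential inequalities are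
  avoided by using \<open>tr P\<^sub>t\<^sup>p\<close> as a potential, where \<open>P\<^sub>t = (c I + \<Sum>\<^sub>s\<^sub><\<^sub>t v\<^sub>s v\<^sub>s')\<^sup>-\<^sup>1\<close>. By the Sherman-Morrison formula, adding one
  more vector lowers \<open>tr P\<^sup>p\<close> by at least \<open>(p/2) v'P\<^sup>p\<^sup>+\<^sup>1v\<close> as soon as \<open>p v'Pv \<le> 1/2\<close>
  (\<open>trace_pow_rank_one_decrease\<close>), which holds when \<open>c \<ge> 2 p sup |v|\<^sup>2\<close>. By independence and isotropy the expected
  decrease is \<open>(p/2) E tr P\<^sup>p\<^sup>+\<^sup>1\<close>, and iterating yields \<open>E tr P\<^sub>n\<^sup>p \<le> K (c + n/2)\<^sup>-\<^sup>p\<close>. An eigenvalue of the sum below \<open>x - c\<close>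
  would force \<open>tr P\<^sub>n\<^sup>p > x\<^sup>-\<^sup>p\<close>, so Markov's inequality bounds its probability by \<open>K (x/(c + n/2))\<^sup>p\<close>. The choice
  \<open>p\<close> of order \<open>log K\<close> makes this at most \<open>1/K\<close>, and the condition on \<open>c\<close> becomes the assumed
  \<open>\<zeta>\<^sup>2 \<lambda>\<^sup>2 log K = o(n)\<close> (\<open>resolvent_tail\<close>, \<open>iid_lower_isometry\<close>).
\<close>

section \<open>Spectral decomposition of real symmetric matrices\<close>

lemma scalar_prod_eq_sum:
  "w \<in> carrier_vec n \<Longrightarrow> v \<bullet> w = (\<Sum>i<n. v $ i * w $ i)"
  by (simp add: scalar_prod_def atLeast0LessThan)

lemma scalar_prod_self_nonneg: "0 \<le> (v :: real Matrix.vec) \<bullet> v"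
  by (simp add: scalar_prod_def sum_nonneg)

lemma scalar_prod_self_eq_0:
  fixes v :: "real Matrix.vec"
  assumes "v \<in> carrier_vec n" "v \<bullet> v = 0"
  shows "v = 0\<^sub>v n"
proof (rule eq_vecI)
  fix i assume "i < dim_vec (0\<^sub>v n :: real Matrix.vec)"
  with assms show "v $ i = 0\<^sub>v n $ i"
    by (auto simp: scalar_prod_def sum_nonneg_eq_0_iff)
qed (use assms in auto)

text \<open>
  The matrix with rows \<open>u\<^sub>i\<close>, padded by zero rows to a square one, is singular; a kernel vector does it.
\<close>

lemma orthogonal_vec_exists:
  fixes u :: "nat \<Rightarrow> real Matrix.vec"
  assumes "k < n" "\<And>i. i < k \<Longrightarrow> u i \<in> carrier_vec n"
  obtains v where "v \<in> carrier_vec n" "v \<noteq> 0\<^sub>v n" "\<And>i. i < k \<Longrightarrow> u i \<bullet> v = 0"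
proof -
  define A where "A = Matrix.mat n n (\<lambda>(i, j). if i < k then u i $ j else 0)"
  have A: "A \<in> carrier_mat n n" by (simp add: A_def)
  have "transpose_mat A *\<^sub>v unit_vec n k = 0\<^sub>v n"
    using assms(1) by (intro eq_vecI) (auto simp: A_def scalar_prod_right_unit)
  moreover have "unit_vec n k \<noteq> (0\<^sub>v n :: real Matrix.vec)"
  proof
    assume "unit_vec n k = (0\<^sub>v n :: real Matrix.vec)"
    then have "(unit_vec n k :: real Matrix.vec) $ k = 0" using assms(1) by simp
    then show False using assms(1) by simp
  qed
  ultimately have "Determinant.det (transpose_mat A) = 0"
    using A by (intro iffD2[OF det_0_iff_vec_prod_zero[of _ n]] exI[of _ "unit_vec n k"]) auto
  then have "Determinant.det A = 0" using A by (simp add: det_transpose)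
  then obtain v where v: "v \<in> carrier_vec n" "v \<noteq> 0\<^sub>v n" "A *\<^sub>v v = 0\<^sub>v n"
    using det_0_iff_vec_prod_zero[OF A] by auto
  have "u i \<bullet> v = 0" if i: "i < k" for i
  proof -
    have "Matrix.row A i = u i"
      using i assms(1) carrier_vecD[OF assms(2)[OF i]] by (intro eq_vecI) (auto simp: A_def)
    then have "u i \<bullet> v = (A *\<^sub>v v) $ i" using i assms A by simp
    also have "\<dots> = 0" using v i assms by simp
    finally show ?thesis .
  qed
  with v show ?thesis using that by blast
qed

text \<open>
  Vectors whose dimension is not a type carry no topology, so compactness is taken from the space
  \<open>nat \<Rightarrow> real\<close> with the product topology: the unit sphere sits in a product of compact intervals.
\<close>

lemma rayleigh_maximizer_exists:
  fixes A :: "real Matrix.mat" and u :: "nat \<Rightarrow> real Matrix.vec"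
  assumes A: "A \<in> carrier_mat n n" and k: "k < n"
    and u: "\<And>i. i < k \<Longrightarrow> u i \<in> carrier_vec n"
  defines "C \<equiv> {v \<in> carrier_vec n. v \<bullet> v = 1 \<and> (\<forall>i<k. u i \<bullet> v = 0)}"
  obtains v where "v \<in> C" "\<And>w. w \<in> C \<Longrightarrow> w \<bullet> (A *\<^sub>v w) \<le> v \<bullet> (A *\<^sub>v v)"
proof -
  define T where "T = PiE UNIV (\<lambda>i. if i < n then {-1..1} else {0::real})"
  have "compactin (product_topology (\<lambda>i. euclidean) UNIV) T"
    unfolding T_def by (subst compactin_PiE) auto
  then have T: "compact T"
    by (simp add: euclidean_product_topology)
  define Z where "Z = {f. (\<Sum>i<n. f i * f i) = 1} \<inter>
    (\<Inter>i\<in>{..<k}. {f. (\<Sum>j<n. u i $ j * f j) = 0}) \<inter> T"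
  have cont: "continuous_on UNIV (\<lambda>f :: nat \<Rightarrow> real. f i)" for i
    by (rule continuous_on_product_coordinates)
  have "closed {f :: nat \<Rightarrow> real. (\<Sum>i<n. f i * f i) = 1}"
    by (intro closed_Collect_eq continuous_intros cont)
  moreover have "closed {f :: nat \<Rightarrow> real. (\<Sum>j<n. u i $ j * f j) = 0}" for i
    by (intro closed_Collect_eq continuous_intros cont)
  ultimately have Z: "compact Z"
    unfolding Z_def by (intro closed_Int_compact closed_Int closed_INT T) auto
  have Z_iff: "Matrix.vec n f \<in> C" if "f \<in> Z" for f
  proof -
    have "u i \<bullet> Matrix.vec n f = 0" if "i < k" for i
      using \<open>f \<in> Z\<close> that by (auto simp: Z_def scalar_prod_eq_sum[of _ n])
    then show ?thesis
      using \<open>f \<in> Z\<close> by (auto simp: Z_def C_def scalar_prod_eq_sum[of _ n])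
  qed
  have C_Z: "(\<lambda>i. if i < n then v $ i else 0) \<in> Z" if v: "v \<in> C" for v
  proof -
    have 1: "(\<Sum>i<n. v $ i * v $ i) = 1"
      using v by (auto simp: C_def scalar_prod_eq_sum[of _ n])
    have "v $ i \<in> {-1..1}" if "i < n" for i
    proof -
      have "v $ i * v $ i \<le> (\<Sum>i<n. v $ i * v $ i)"
        using that by (intro member_le_sum) auto
      then have "(v $ i)\<^sup>2 \<le> 1" using 1 by (simp add: power2_eq_square)
      then show ?thesis by (simp add: abs_square_le_1 abs_le_iff)
    qed
    then have "(\<lambda>i. if i < n then v $ i else 0) \<in> T" by (auto simp: T_def)
    moreover have "(\<Sum>j<n. u i $ j * (if j < n then v $ j else 0)) = 0" if "i < k" for i
    proof -
      have "u i \<bullet> v = (\<Sum>j<n. u i $ j * v $ j)"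
        using v by (auto simp: C_def scalar_prod_eq_sum[of _ n])
      then show ?thesis using v that by (simp add: C_def)
    qed
    ultimately show ?thesis using 1 by (auto simp: Z_def)
  qed
  have vec_id: "Matrix.vec n (\<lambda>i. if i < n then v $ i else 0) = v" if "v \<in> C" for v
    using that by (intro eq_vecI) (auto simp: C_def)
  obtain w where w: "w \<in> carrier_vec n" "w \<noteq> 0\<^sub>v n" "\<And>i. i < k \<Longrightarrow> u i \<bullet> w = 0"
    using orthogonal_vec_exists[OF k, of u] u by blast
  have "0 < w \<bullet> w"
    using scalar_prod_self_nonneg[of w] scalar_prod_self_eq_0[OF w(1)] w(2) by fastforce
  then have "(1 / sqrt (w \<bullet> w)) \<cdot>\<^sub>v w \<in> C"
    using w u by (auto simp: C_def)
  then have "Z \<noteq> {}" using C_Z by blast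
  moreover have "continuous_on Z (\<lambda>f. \<Sum>i<n. f i * (\<Sum>j<n. A $$ (i, j) * f j))"
    by (intro continuous_intros continuous_on_subset[OF cont]) auto
  ultimately obtain f where f: "f \<in> Z" and
    max: "\<And>g. g \<in> Z \<Longrightarrow> (\<Sum>i<n. g i * (\<Sum>j<n. A $$ (i, j) * g j))
                          \<le> (\<Sum>i<n. f i * (\<Sum>j<n. A $$ (i, j) * f j))"
    using continuous_attains_sup[OF Z] by blast
  have form: "Matrix.vec n g \<bullet> (A *\<^sub>v Matrix.vec n g)
      = (\<Sum>i<n. g i * (\<Sum>j<n. A $$ (i, j) * g j))" for g
  proof -
    have "(A *\<^sub>v Matrix.vec n g) $ i = (\<Sum>j<n. A $$ (i, j) * g j)" if "i < n" for i
      using A that by (auto simp: scalar_prod_eq_sum[of _ n])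
    moreover have "A *\<^sub>v Matrix.vec n g \<in> carrier_vec n" using A by simp
    ultimately show ?thesis by (simp add: scalar_prod_eq_sum[of _ n])
  qed
  show ?thesis
  proof (rule that)
    show "Matrix.vec n f \<in> C" using Z_iff[OF f] .
    fix w assume w: "w \<in> C"
    show "w \<bullet> (A *\<^sub>v w) \<le> Matrix.vec n f \<bullet> (A *\<^sub>v Matrix.vec n f)"
      using max[OF C_Z[OF w]] unfolding form[symmetric] vec_id[OF w] .
  qed
qed

lemma symmetric_mat_scalar_prod:
  fixes A :: "real Matrix.mat"
  assumes "A \<in> carrier_mat n n" "transpose_mat A = A" "v \<in> carrier_vec n" "w \<in> carrier_vec n"
  shows "v \<bullet> (A *\<^sub>v w) = (A *\<^sub>v v) \<bullet> w"
  using transpose_vec_mult_scalar[OF assms(1,4,3)] assms(2) by simp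

text \<open>
  With \<open>l\<close> the maximum, the residual \<open>g = Av - lv\<close> is orthogonal to \<open>v\<close> and to the earlier eigenvectors. If it were
  nonzero, moving from \<open>v\<close> a little in direction \<open>g\<close> would raise the Rayleigh quotient to first order.
\<close>

lemma constrained_rayleigh_maximizer_eigenvector:
  fixes A :: "real Matrix.mat" and u :: "nat \<Rightarrow> real Matrix.vec"
  assumes A: "A \<in> carrier_mat n n" and sym: "transpose_mat A = A"
    and u: "\<And>i. i < k \<Longrightarrow> u i \<in> carrier_vec n" and Au: "\<And>i. i < k \<Longrightarrow> A *\<^sub>v u i = d i \<cdot>\<^sub>v u i"
    and v: "v \<in> carrier_vec n" "v \<bullet> v = 1" "\<And>i. i < k \<Longrightarrow> u i \<bullet> v = 0"
    and max: "\<And>w. w \<in> carrier_vec n \<Longrightarrow> w \<bullet> w = 1 \<Longrightarrow> (\<And>i. i < k \<Longrightarrow> u i \<bullet> w = 0) \<Longrightarrow>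
                 w \<bullet> (A *\<^sub>v w) \<le> v \<bullet> (A *\<^sub>v v)"
  shows "A *\<^sub>v v = (v \<bullet> (A *\<^sub>v v)) \<cdot>\<^sub>v v"
proof -
  define l where "l = v \<bullet> (A *\<^sub>v v)"
  define g where "g = A *\<^sub>v v - l \<cdot>\<^sub>v v"
  have Av: "A *\<^sub>v v \<in> carrier_vec n" using A v by simp
  have g: "g \<in> carrier_vec n" using Av v by (simp add: g_def)
  have Ag: "A *\<^sub>v g \<in> carrier_vec n" using A g by simp
  have ug: "u i \<bullet> g = 0" if "i < k" for i
  proof -
    have "u i \<bullet> (A *\<^sub>v v) = (A *\<^sub>v u i) \<bullet> v"
      using symmetric_mat_scalar_prod[OF A sym u[OF that] v(1)] .
    also have "\<dots> = 0" using Au[OF that] v u[OF that] that by simp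
    finally show ?thesis
      using v u[OF that] Av that by (simp add: g_def scalar_prod_minus_distrib[of _ n])
  qed
  have gv: "v \<bullet> g = 0"
    using v Av A by (simp add: g_def scalar_prod_minus_distrib[of _ n] l_def)
  have Av_eq: "A *\<^sub>v v = g + l \<cdot>\<^sub>v v"
    using A Av v by (auto simp: g_def intro!: eq_vecI)
  define \<gamma> where "\<gamma> = g \<bullet> g"
  define \<delta> where "\<delta> = g \<bullet> (A *\<^sub>v g)"
  have gAv: "g \<bullet> (A *\<^sub>v v) = \<gamma>"
    using g v gv comm_scalar_prod[OF g v(1)]
    by (simp add: Av_eq scalar_prod_add_distrib[of _ n] \<gamma>_def)
  have vAg: "v \<bullet> (A *\<^sub>v g) = \<gamma>"
    using symmetric_mat_scalar_prod[OF A sym v(1) g] gAv comm_scalar_prod[OF g Av] by simp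
  \<comment> \<open>The Rayleigh quotient at \<open>v + t g\<close>, normalised to the unit sphere, is at most its maximum \<open>l\<close>.\<close>
  have le: "2 * t * \<gamma> \<le> t\<^sup>2 * (l * \<gamma> - \<delta>)" for t
  proof -
    define w where "w = v + t \<cdot>\<^sub>v g"
    have w: "w \<in> carrier_vec n" using v g by (simp add: w_def)
    have ww: "w \<bullet> w = 1 + t\<^sup>2 * \<gamma>"
      using v g gv comm_scalar_prod[OF g v(1)]
      by (simp add: w_def scalar_prod_add_distrib[of _ n] add_scalar_prod_distrib[of _ n]
          \<gamma>_def power2_eq_square)
    have \<gamma>0: "0 \<le> \<gamma>" unfolding \<gamma>_def by (rule scalar_prod_self_nonneg)
    have Aw: "A *\<^sub>v w = A *\<^sub>v v + t \<cdot>\<^sub>v (A *\<^sub>v g)"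
      using A v g by (simp add: w_def mult_add_distrib_mat_vec[of _ n n] mult_mat_vec[of _ n n])
    have wAw: "w \<bullet> (A *\<^sub>v w) = l + 2 * t * \<gamma> + t\<^sup>2 * \<delta>"
      using v g Av Ag unfolding Aw
      by (simp add: w_def scalar_prod_add_distrib[of _ n] add_scalar_prod_distrib[of _ n]
          gAv vAg \<delta>_def power2_eq_square l_def[symmetric] algebra_simps)
    define s where "s = 1 / sqrt (w \<bullet> w)"
    have pos: "0 < w \<bullet> w" unfolding ww using \<gamma>0 by (simp add: add_pos_nonneg)
    have s2: "s * s = 1 / (w \<bullet> w)" using pos by (simp add: s_def)
    have "(s \<cdot>\<^sub>v w) \<bullet> (s \<cdot>\<^sub>v w) = s * s * (w \<bullet> w)" using w by simp
    then have 1: "(s \<cdot>\<^sub>v w) \<bullet> (s \<cdot>\<^sub>v w) = 1" using pos s2 by simp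
    have "u i \<bullet> (s \<cdot>\<^sub>v w) = 0" if "i < k" for i
      using that u[OF that] v(3)[OF that] ug[OF that] v g w
      by (simp add: w_def scalar_prod_add_distrib[of _ n])
    then have "(s \<cdot>\<^sub>v w) \<bullet> (A *\<^sub>v (s \<cdot>\<^sub>v w)) \<le> l"
      unfolding l_def using w 1 by (intro max) auto
    also have "(s \<cdot>\<^sub>v w) \<bullet> (A *\<^sub>v (s \<cdot>\<^sub>v w)) = s * s * (w \<bullet> (A *\<^sub>v w))"
      using A w by (simp add: mult_mat_vec[of _ n n])
    finally have "w \<bullet> (A *\<^sub>v w) \<le> l * (w \<bullet> w)"
      using pos by (simp add: s2 field_simps)
    then show ?thesis unfolding ww wAw by (simp add: algebra_simps)
  qed
  have "\<gamma> = 0"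
  proof (rule ccontr)
    assume "\<gamma> \<noteq> 0"
    then have \<gamma>: "0 < \<gamma>" using scalar_prod_self_nonneg[of g] by (simp add: \<gamma>_def)
    define t where "t = \<gamma> / (\<bar>l * \<gamma> - \<delta>\<bar> + 1)"
    have t: "0 < t" using \<gamma> by (simp add: t_def add_nonneg_pos)
    have "2 * t * \<gamma> \<le> t * (t * (l * \<gamma> - \<delta>))" using le[of t] by (simp add: power2_eq_square mult_ac)
    then have "2 * \<gamma> \<le> t * (l * \<gamma> - \<delta>)" using t
      by (metis mult.assoc mult.left_commute mult_le_cancel_left_pos)
    also have "\<dots> \<le> t * (\<bar>l * \<gamma> - \<delta>\<bar> + 1)" using t by (intro mult_left_mono) auto
    also have "\<dots> = \<gamma>" by (simp add: t_def)
    finally show False using \<gamma> by simp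
  qed
  then have "g = 0\<^sub>v n" using scalar_prod_self_eq_0[OF g] by (simp add: \<gamma>_def)
  then show ?thesis using Av_eq v by (simp add: l_def)
qed

definition orthonormal_eigenbasis ::
  "nat \<Rightarrow> real Matrix.mat \<Rightarrow> (nat \<Rightarrow> real Matrix.vec) \<Rightarrow> (nat \<Rightarrow> real) \<Rightarrow> bool" where
  "orthonormal_eigenbasis n A u d \<longleftrightarrow>
     (\<forall>i<n. u i \<in> carrier_vec n \<and> A *\<^sub>v u i = d i \<cdot>\<^sub>v u i) \<and>
     (\<forall>i<n. \<forall>j<n. u i \<bullet> u j = (if i = j then 1 else 0))"

theorem symmetric_mat_orthonormal_eigenbasis:
  fixes A :: "real Matrix.mat"
  assumes A: "A \<in> carrier_mat n n" and sym: "transpose_mat A = A"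
  obtains u d where "orthonormal_eigenbasis n A u d"
proof -
  have "\<exists>u d. (\<forall>i<k. u i \<in> carrier_vec n \<and> A *\<^sub>v u i = d i \<cdot>\<^sub>v u i) \<and>
     (\<forall>i<k. \<forall>j<k. u i \<bullet> u j = (if i = j then 1 else 0))" if "k \<le> n" for k
    using that
  proof (induction k)
    case (Suc k)
    then obtain u d where ud: "\<And>i. i < k \<Longrightarrow> u i \<in> carrier_vec n"
        "\<And>i. i < k \<Longrightarrow> A *\<^sub>v u i = d i \<cdot>\<^sub>v u i"
        "\<And>i j. i < k \<Longrightarrow> j < k \<Longrightarrow> u i \<bullet> u j = (if i = j then 1 else 0)"
      by (metis Suc_leD)
    obtain v where v: "v \<in> carrier_vec n" "v \<bullet> v = 1" "\<And>i. i < k \<Longrightarrow> u i \<bullet> v = 0"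
      and max: "\<And>w. w \<in> carrier_vec n \<Longrightarrow> w \<bullet> w = 1 \<Longrightarrow> (\<And>i. i < k \<Longrightarrow> u i \<bullet> w = 0) \<Longrightarrow>
                 w \<bullet> (A *\<^sub>v w) \<le> v \<bullet> (A *\<^sub>v v)"
    proof -
      show ?thesis
        by (rule rayleigh_maximizer_exists[OF A, of k u]) (use Suc.prems ud(1) that in auto)
    qed
    have Av: "A *\<^sub>v v = (v \<bullet> (A *\<^sub>v v)) \<cdot>\<^sub>v v"
      by (rule constrained_rayleigh_maximizer_eigenvector[OF A sym ud(1,2) v max])
    have vu: "v \<bullet> u i = 0" if "i < k" for i
      using comm_scalar_prod[OF v(1) ud(1)[OF that]] v(3)[OF that] by simp
    show ?case
      by (rule exI[of _ "u(k := v)"], rule exI[of _ "d(k := v \<bullet> (A *\<^sub>v v))"])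
        (use ud v Av vu in \<open>auto simp: less_Suc_eq\<close>)
  qed simp
  then show ?thesis using that unfolding orthonormal_eigenbasis_def by blast
qed

text \<open>
  The rows \<open>u\<^sub>i\<close> form a matrix \<open>U\<close> with \<open>U U' = I\<close>, hence also \<open>U' U = I\<close>.
\<close>

lemma orthonormal_basis_parseval:
  assumes "orthonormal_eigenbasis n A u d" "v \<in> carrier_vec n" "w \<in> carrier_vec n"
  shows "v \<bullet> w = (\<Sum>i<n. (u i \<bullet> v) * (u i \<bullet> w))"
proof -
  define U where "U = Matrix.mat n n (\<lambda>(i, j). u i $ j)"
  have U: "U \<in> carrier_mat n n" by (simp add: U_def)
  have row: "Matrix.row U i = u i" if "i < n" for i
    using assms(1) that by (intro eq_vecI) (auto simp: U_def orthonormal_eigenbasis_def)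
  have "U * transpose_mat U = 1\<^sub>m n"
    using U assms(1) by (intro eq_matI) (auto simp: row orthonormal_eigenbasis_def)
  then have UU: "transpose_mat U * U = 1\<^sub>m n"
    using U by (intro mat_mult_left_right_inverse[of U n]) auto
  have Uv: "(U *\<^sub>v x) $ i = u i \<bullet> x" if "i < n" for x i
    using U that by (simp add: row)
  have "v \<bullet> w = v \<bullet> ((transpose_mat U * U) *\<^sub>v w)" using UU assms by simp
  also have "\<dots> = v \<bullet> (transpose_mat U *\<^sub>v (U *\<^sub>v w))"
    using U assms by (subst assoc_mult_mat_vec[of _ n n _ n]) auto
  also have "\<dots> = (U *\<^sub>v v) \<bullet> (U *\<^sub>v w)"
    using transpose_vec_mult_scalar[of "transpose_mat U" n n "U *\<^sub>v w" v] U assms by simp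
  also have "\<dots> = (\<Sum>i<n. (u i \<bullet> v) * (u i \<bullet> w))"
    using U assms by (subst scalar_prod_eq_sum[of _ n]) (auto simp del: index_mult_mat_vec simp: Uv)
  finally show ?thesis .
qed

lemma orthonormal_basis_vec_eqI:
  assumes "orthonormal_eigenbasis n A u d" "v \<in> carrier_vec n" "w \<in> carrier_vec n"
    and "\<And>i. i < n \<Longrightarrow> u i \<bullet> v = u i \<bullet> w"
  shows "v = w"
proof -
  have u: "u i \<in> carrier_vec n" if "i < n" for i
    using assms(1) that by (simp add: orthonormal_eigenbasis_def)
  have "u i \<bullet> (v - w) = 0" if "i < n" for i
    using assms u[OF that] that by (simp add: scalar_prod_minus_distrib[of _ n])
  then have "(v - w) \<bullet> (v - w) = 0"
    using orthonormal_basis_parseval[OF assms(1), of "v - w" "v - w"] assms(2,3) by simp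
  then have "v - w = 0\<^sub>v n"
    using assms by (intro scalar_prod_self_eq_0) auto
  then have "(v - w) $ i = 0" if "i < n" for i using that by simp
  then show ?thesis using assms(2,3) by (intro eq_vecI) auto
qed

lemma orthonormal_eigenbasis_mult:
  assumes "orthonormal_eigenbasis n A u d" "A \<in> carrier_mat n n" "transpose_mat A = A"
    "i < n" "w \<in> carrier_vec n"
  shows "u i \<bullet> (A *\<^sub>v w) = d i * (u i \<bullet> w)"
  using assms symmetric_mat_scalar_prod[of A n "u i" w] by (auto simp: orthonormal_eigenbasis_def)

lemma mat_eqI_mult_vec:
  fixes A B :: "real Matrix.mat"
  assumes "A \<in> carrier_mat n n" "B \<in> carrier_mat n n"
    and "\<And>w. w \<in> carrier_vec n \<Longrightarrow> A *\<^sub>v w = B *\<^sub>v w"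
  shows "A = B"
proof (rule eq_matI)
  fix i j assume "i < dim_row B" "j < dim_col B"
  then have ij: "i < n" "j < n" using assms by auto
  have "(A *\<^sub>v unit_vec n j) $ i = (B *\<^sub>v unit_vec n j) $ i" using assms(3) by simp
  then show "A $$ (i, j) = B $$ (i, j)" using ij assms(1,2) by simp
qed (use assms in auto)

lemma eigenvalues_orthonormal_eigenbasis:
  fixes A :: "real Matrix.mat"
  assumes ev: "orthonormal_eigenbasis n A u d" and A: "A \<in> carrier_mat n n" "transpose_mat A = A"
  shows "{k. eigenvalue A k} = d ` {..<n}"
proof (intro equalityI subsetI)
  fix k assume "k \<in> {k. eigenvalue A k}"
  then obtain v where v: "v \<in> carrier_vec n" "v \<noteq> 0\<^sub>v n" "A *\<^sub>v v = k \<cdot>\<^sub>v v"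
    using A by (auto simp: eigenvalue_def eigenvector_def)
  have u: "u i \<in> carrier_vec n" if "i < n" for i
    using ev that by (simp add: orthonormal_eigenbasis_def)
  obtain i where i: "i < n" "u i \<bullet> v \<noteq> 0"
    using orthonormal_basis_vec_eqI[OF ev v(1), of "0\<^sub>v n"] v u by fastforce
  have "d i * (u i \<bullet> v) = k * (u i \<bullet> v)"
    using orthonormal_eigenbasis_mult[OF ev A i(1) v(1)] v u[OF i(1)] by auto
  then have "d i = k" using i(2) by simp
  with i show "k \<in> d ` {..<n}" by auto
next
  fix k assume "k \<in> d ` {..<n}"
  then obtain i where i: "i < n" "k = d i" by auto
  have "u i \<noteq> 0\<^sub>v n"
  proof
    assume "u i = 0\<^sub>v n"
    then have "u i \<bullet> u i = 0" by simp
    then show False using ev i by (simp add: orthonormal_eigenbasis_def)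
  qed
  then show "k \<in> {k. eigenvalue A k}"
    using ev i A by (auto simp: eigenvalue_def eigenvector_def orthonormal_eigenbasis_def)
qed

lemma lambda_min_orthonormal_eigenbasis:
  fixes A :: "real Matrix.mat"
  assumes "orthonormal_eigenbasis n A u d" "A \<in> carrier_mat n n" "transpose_mat A = A" "i < n"
  shows "lambda_min A \<le> d i"
  using eigenvalues_orthonormal_eigenbasis[OF assms(1-3)] assms(4)
  by (auto simp: lambda_min_def)

text \<open>
  Functional calculus: the matrix with eigenvectors \<open>u\<^sub>i\<close> and eigenvalues \<open>g i\<close>.
\<close>

definition spectral_mat ::
  "nat \<Rightarrow> (nat \<Rightarrow> real Matrix.vec) \<Rightarrow> (nat \<Rightarrow> real) \<Rightarrow> real Matrix.mat" where
  "spectral_mat n u g = Matrix.mat n n (\<lambda>(a, b). \<Sum>i<n. g i * u i $ a * u i $ b)"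

lemma spectral_mat_carrier [simp]: "spectral_mat n u g \<in> carrier_mat n n"
  by (simp add: spectral_mat_def)

lemma transpose_spectral_mat [simp]: "transpose_mat (spectral_mat n u g) = spectral_mat n u g"
  by (intro eq_matI) (auto simp: spectral_mat_def mult_ac)

lemma spectral_mat_mult_carrier [simp]:
  "w \<in> carrier_vec n \<Longrightarrow> spectral_mat n u g *\<^sub>v w \<in> carrier_vec n"
  by (rule mult_mat_vec_carrier[of _ n n]) auto

lemma spectral_mat_mult:
  assumes ev: "orthonormal_eigenbasis n A u d" and i: "i < n" and w: "w \<in> carrier_vec n"
  shows "u i \<bullet> (spectral_mat n u g *\<^sub>v w) = g i * (u i \<bullet> w)"
proof -
  have u: "u i \<in> carrier_vec n" if "i < n" for i
    using ev that by (simp add: orthonormal_eigenbasis_def)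
  have 1: "(spectral_mat n u g *\<^sub>v w) $ a = (\<Sum>j<n. g j * (u j \<bullet> w) * u j $ a)" if "a < n" for a
  proof -
    have "(spectral_mat n u g *\<^sub>v w) $ a = (\<Sum>b<n. (\<Sum>j<n. g j * u j $ a * u j $ b) * w $ b)"
      using that w by (subst index_mult_mat_vec) (auto simp: spectral_mat_def scalar_prod_eq_sum[of _ n])
    also have "\<dots> = (\<Sum>j<n. \<Sum>b<n. g j * u j $ a * u j $ b * w $ b)"
      by (subst sum.swap) (simp add: sum_distrib_right)
    also have "\<dots> = (\<Sum>j<n. g j * (u j \<bullet> w) * u j $ a)"
      using w by (intro sum.cong) (auto simp: scalar_prod_eq_sum[of _ n] sum_distrib_left sum_distrib_right mult_ac)
    finally show ?thesis .
  qed
  have "u i \<bullet> (spectral_mat n u g *\<^sub>v w) = (\<Sum>a<n. u i $ a * (\<Sum>j<n. g j * (u j \<bullet> w) * u j $ a))"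
    using 1 w u[OF i] by (subst scalar_prod_eq_sum[of _ n]) (auto simp del: index_mult_mat_vec)
  also have "\<dots> = (\<Sum>j<n. \<Sum>a<n. u i $ a * (g j * (u j \<bullet> w) * u j $ a))"
    by (subst sum.swap) (simp add: sum_distrib_left)
  also have "\<dots> = (\<Sum>j<n. g j * (u j \<bullet> w) * (u i \<bullet> u j))"
    using u by (intro sum.cong) (auto simp: scalar_prod_eq_sum[of _ n] sum_distrib_left mult_ac)
  also have "\<dots> = (\<Sum>j<n. if j = i then g j * (u j \<bullet> w) else 0)"
    using ev i by (intro sum.cong) (auto simp: orthonormal_eigenbasis_def)
  also have "\<dots> = g i * (u i \<bullet> w)" using i by simp
  finally show ?thesis .
qed

lemma lambda_min_pos_inv_sqrt:
  fixes A :: "real Matrix.mat"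
  assumes A: "A \<in> carrier_mat n n" "transpose_mat A = A" and pos: "lambda_min A > 0"
  shows "is_inv_sqrt A (inv_sqrt_mat A)"
proof -
  obtain u d where ev: "orthonormal_eigenbasis n A u d"
    using symmetric_mat_orthonormal_eigenbasis[OF A] .
  have d: "0 < d i" if "i < n" for i
    using lambda_min_orthonormal_eigenbasis[OF ev A that] pos by simp
  define R where "R = spectral_mat n u (\<lambda>i. 1 / sqrt (d i))"
  have R: "R \<in> carrier_mat n n" "transpose_mat R = R" by (auto simp: R_def)
  have uR: "u i \<bullet> (R *\<^sub>v w) = (1 / sqrt (d i)) * (u i \<bullet> w)" if "i < n" "w \<in> carrier_vec n" for i w
    unfolding R_def by (rule spectral_mat_mult[OF ev that])
  have uA: "u i \<bullet> (A *\<^sub>v w) = d i * (u i \<bullet> w)" if "i < n" "w \<in> carrier_vec n" for i w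
    using orthonormal_eigenbasis_mult[OF ev A that] .
  have Rw: "R *\<^sub>v w \<in> carrier_vec n" if "w \<in> carrier_vec n" for w
    using R that by simp
  have Aw: "A *\<^sub>v w \<in> carrier_vec n" if "w \<in> carrier_vec n" for w
    using A that by simp
  have "R * R * A = 1\<^sub>m n"
  proof (rule mat_eqI_mult_vec[of _ n])
    fix w :: "real Matrix.vec" assume w: "w \<in> carrier_vec n"
    have "R * R * A *\<^sub>v w = R *\<^sub>v (R *\<^sub>v (A *\<^sub>v w))"
      using R A w Aw[OF w] by (simp add: assoc_mult_mat_vec[of _ n n _ n])
    also have "\<dots> = w"
    proof (rule orthonormal_basis_vec_eqI[OF ev _ w])
      fix i assume i: "i < n"
      have "1 / sqrt (d i) * (1 / sqrt (d i) * (d i * x)) = x" for x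
        using d[OF i] by (simp add: field_simps)
      then show "u i \<bullet> (R *\<^sub>v (R *\<^sub>v (A *\<^sub>v w))) = u i \<bullet> w"
        using i w by (simp only: uR uA Rw Aw)
    qed (use w Rw Aw in auto)
    finally show "R * R * A *\<^sub>v w = 1\<^sub>m n *\<^sub>v w" using w by simp
  qed (use R A in auto)
  moreover from this have "A * (R * R) = 1\<^sub>m n"
    using R A by (intro mat_mult_left_right_inverse[of "R * R" n]) auto
  moreover have "0 < v \<bullet> (R *\<^sub>v v)" if v: "v \<in> carrier_vec n" "v \<noteq> 0\<^sub>v n" for v
  proof -
    have "u i \<in> carrier_vec n" if "i < n" for i
      using ev that by (simp add: orthonormal_eigenbasis_def)
    then obtain i where i: "i < n" "u i \<bullet> v \<noteq> 0"
      using orthonormal_basis_vec_eqI[OF ev v(1), of "0\<^sub>v n"] v by fastforce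
    have "v \<bullet> (R *\<^sub>v v) = (\<Sum>i<n. (u i \<bullet> v) * ((1 / sqrt (d i)) * (u i \<bullet> v)))"
      using orthonormal_basis_parseval[OF ev v(1) Rw[OF v(1)]] v uR by simp
    also have "\<dots> > 0"
    proof (rule sum_pos2[of _ i])
      show "0 < (u i \<bullet> v) * ((1 / sqrt (d i)) * (u i \<bullet> v))"
        using i d[OF i(1)] by (simp flip: power2_eq_square)
    next
      fix j assume "j \<in> {..<n}"
      then show "0 \<le> (u j \<bullet> v) * ((1 / sqrt (d j)) * (u j \<bullet> v))"
        using d[of j] by (simp add: zero_le_divide_iff)
    qed (use i in auto)
    finally show ?thesis .
  qed
  ultimately have "is_inv_sqrt A R"
    using R A by (auto simp: is_inv_sqrt_def inverts_mat_def)
  then show ?thesis unfolding inv_sqrt_mat_def by (rule someI)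
qed

text \<open>
  What the whitening matrix \<open>R = A\<^sup>-\<^sup>1\<^sup>/\<^sup>2\<close> is needed for: it turns the Gram matrix into the identity, is onto, and
  stretches squared norms by at most \<open>1/\<lambda>\<^sub>m\<^sub>i\<^sub>n\<close>.
\<close>

lemma inv_sqrt_mat_props:
  fixes A :: "real Matrix.mat"
  assumes A: "A \<in> carrier_mat n n" "transpose_mat A = A" and pos: "lambda_min A > 0"
  defines "R \<equiv> inv_sqrt_mat A"
  shows "R \<in> carrier_mat n n" "transpose_mat R = R" "R * A * R = 1\<^sub>m n"
    "\<And>c. c \<in> carrier_vec n \<Longrightarrow> \<exists>w\<in>carrier_vec n. c = R *\<^sub>v w"
    "\<And>v. v \<in> carrier_vec n \<Longrightarrow> (R *\<^sub>v v) \<bullet> (R *\<^sub>v v) \<le> (v \<bullet> v) / lambda_min A"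
proof -
  have inv: "is_inv_sqrt A R" unfolding R_def by (rule lambda_min_pos_inv_sqrt[OF A pos])
  then show R: "R \<in> carrier_mat n n" "transpose_mat R = R"
    using A by (auto simp: is_inv_sqrt_def)
  have RRA: "R * R * A = 1\<^sub>m n" and ARR: "A * (R * R) = 1\<^sub>m n"
    using inv A R by (auto simp: is_inv_sqrt_def inverts_mat_def)
  have "R * (R * A) = 1\<^sub>m n" using RRA R A by (simp add: assoc_mult_mat[of _ n n _ n _ n])
  then show "R * A * R = 1\<^sub>m n"
    using R A by (intro mat_mult_left_right_inverse[of R n]) auto
  show "\<exists>w\<in>carrier_vec n. c = R *\<^sub>v w" if c: "c \<in> carrier_vec n" for c
  proof (rule bexI[of _ "R *\<^sub>v (A *\<^sub>v c)"])
    have "R *\<^sub>v (R *\<^sub>v (A *\<^sub>v c)) = R * R * A *\<^sub>v c"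
      using R A c by (simp add: assoc_mult_mat_vec[of _ n n _ n])
    then show "c = R *\<^sub>v (R *\<^sub>v (A *\<^sub>v c))" using RRA c by simp
  qed (use R A c in auto)
  show "(R *\<^sub>v v) \<bullet> (R *\<^sub>v v) \<le> (v \<bullet> v) / lambda_min A" if v: "v \<in> carrier_vec n" for v
  proof -
    obtain u d where ev: "orthonormal_eigenbasis n A u d"
      using symmetric_mat_orthonormal_eigenbasis[OF A] .
    have d: "lambda_min A \<le> d i" if "i < n" for i
      using lambda_min_orthonormal_eigenbasis[OF ev A that] .
    define w where "w = R *\<^sub>v (R *\<^sub>v v)"
    have w: "w \<in> carrier_vec n" using R v by (simp add: w_def)
    have "A *\<^sub>v w = A * (R * R) *\<^sub>v v"
      using R A v by (simp add: w_def assoc_mult_mat_vec[of _ n n _ n])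
    then have Aw: "A *\<^sub>v w = v" using ARR v by simp
    have uw: "u i \<bullet> w = (u i \<bullet> v) / d i" if "i < n" for i
      using orthonormal_eigenbasis_mult[OF ev A that w] d[OF that] pos by (simp add: Aw)
    have "(R *\<^sub>v v) \<bullet> (R *\<^sub>v v) = v \<bullet> w"
      using symmetric_mat_scalar_prod[OF R v, of "R *\<^sub>v v"] R v by (simp add: w_def)
    also have "\<dots> = (\<Sum>i<n. (u i \<bullet> v) * ((u i \<bullet> v) / d i))"
      using orthonormal_basis_parseval[OF ev v w] uw by simp
    also have "\<dots> \<le> (\<Sum>i<n. (u i \<bullet> v) * (u i \<bullet> v) / lambda_min A)"
      using d pos by (intro sum_mono) (auto intro!: divide_left_mono mult_pos_pos intro: less_le_trans)
    also have "\<dots> = (v \<bullet> v) / lambda_min A"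
      using orthonormal_basis_parseval[OF ev v v] by (simp add: sum_divide_distrib)
    finally show ?thesis .
  qed
qed

section \<open>Rank-one updates and traces of powers\<close>

definition mat_trace :: "real Matrix.mat \<Rightarrow> real" where
  "mat_trace A = (\<Sum>i<dim_row A. A $$ (i, i))"

definition psd_mat :: "nat \<Rightarrow> real Matrix.mat \<Rightarrow> bool" where
  "psd_mat n P \<longleftrightarrow> P \<in> carrier_mat n n \<and> transpose_mat P = P \<and>
     (\<forall>z\<in>carrier_vec n. 0 \<le> z \<bullet> (P *\<^sub>v z))"

text \<open>
  If \<open>P\<close> is the inverse of \<open>A\<close>, this is the inverse of \<open>A + v v'\<close> by the Sherman-Morrison formula (see
  \<open>resolvent_inverse\<close>).
\<close>

definition sherman_morrison :: "nat \<Rightarrow> real Matrix.mat \<Rightarrow> real Matrix.vec \<Rightarrow> real Matrix.mat" where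
  "sherman_morrison n P v = Matrix.mat n n (\<lambda>(i, j).
     P $$ (i, j) - (P *\<^sub>v v) $ i * (P *\<^sub>v v) $ j / (1 + v \<bullet> (P *\<^sub>v v)))"

lemma sherman_morrison_carrier [simp]: "sherman_morrison n P v \<in> carrier_mat n n"
  by (simp add: sherman_morrison_def)

lemma sherman_morrison_mult:
  assumes P: "P \<in> carrier_mat n n" and v: "v \<in> carrier_vec n" and z: "z \<in> carrier_vec n"
  shows "sherman_morrison n P v *\<^sub>v z =
    P *\<^sub>v z - (((P *\<^sub>v v) \<bullet> z) / (1 + v \<bullet> (P *\<^sub>v v))) \<cdot>\<^sub>v (P *\<^sub>v v)"
proof (rule eq_vecI)
  define y where "y = P *\<^sub>v v"
  define s where "s = 1 + v \<bullet> y"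
  have y: "y \<in> carrier_vec n" using P v by (simp add: y_def)
  fix i assume "i < dim_vec (P *\<^sub>v z - (((P *\<^sub>v v) \<bullet> z) / (1 + v \<bullet> (P *\<^sub>v v))) \<cdot>\<^sub>v (P *\<^sub>v v))"
  then have i: "i < n" using P by simp
  have "(sherman_morrison n P v *\<^sub>v z) $ i = (\<Sum>j<n. (P $$ (i, j) - y $ i * y $ j / s) * z $ j)"
    using i z by (subst index_mult_mat_vec)
      (auto simp: sherman_morrison_def scalar_prod_eq_sum[of z n] y_def s_def)
  also have "\<dots> = (\<Sum>j<n. P $$ (i, j) * z $ j) - ((\<Sum>j<n. y $ j * z $ j) / s) * y $ i"
    unfolding left_diff_distrib sum_subtractf
    by (simp add: sum_distrib_left sum_distrib_right sum_divide_distrib mult_ac)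
  also have "(\<Sum>j<n. P $$ (i, j) * z $ j) = (P *\<^sub>v z) $ i"
    using i z P by (subst index_mult_mat_vec) (auto simp: scalar_prod_eq_sum[of z n])
  also have "(\<Sum>j<n. y $ j * z $ j) = y \<bullet> z"
    using z by (simp add: scalar_prod_eq_sum[of z n])
  finally show "(sherman_morrison n P v *\<^sub>v z) $ i =
      (P *\<^sub>v z - (((P *\<^sub>v v) \<bullet> z) / (1 + v \<bullet> (P *\<^sub>v v))) \<cdot>\<^sub>v (P *\<^sub>v v)) $ i"
    using i P y by (simp add: y_def s_def del: index_mult_mat_vec)
qed (use P in \<open>simp add: sherman_morrison_def\<close>)

lemma transpose_sherman_morrison:
  assumes "P \<in> carrier_mat n n" "transpose_mat P = P"
  shows "transpose_mat (sherman_morrison n P v) = sherman_morrison n P v"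
proof -
  have "P $$ (j, i) = P $$ (i, j)" if "i < n" "j < n" for i j
    using assms that by (metis carrier_matD index_transpose_mat(1))
  then show ?thesis by (intro eq_matI) (auto simp: sherman_morrison_def mult_ac)
qed

lemma psd_mat_eigenvalues_nonneg:
  assumes "psd_mat n P" "orthonormal_eigenbasis n P u d" "i < n"
  shows "0 \<le> d i"
proof -
  have u: "P *\<^sub>v u i = d i \<cdot>\<^sub>v u i" "u i \<bullet> u i = 1" "u i \<in> carrier_vec n"
    using assms(2,3) by (auto simp: orthonormal_eigenbasis_def)
  have "0 \<le> u i \<bullet> (P *\<^sub>v u i)" using assms(1) u(3) unfolding psd_mat_def by blast
  with u show ?thesis by simp
qed

lemma eigenbasis_pow_mult:
  assumes ev: "orthonormal_eigenbasis n P u d" and P: "P \<in> carrier_mat n n" "transpose_mat P = P"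
    and i: "i < n" and w: "w \<in> carrier_vec n"
  shows "u i \<bullet> ((P ^\<^sub>m m) *\<^sub>v w) = d i ^ m * (u i \<bullet> w)"
  using w
proof (induction m arbitrary: w)
  case (Suc m)
  have Pw: "P *\<^sub>v w \<in> carrier_vec n" using P Suc.prems by simp
  have "(P ^\<^sub>m Suc m) *\<^sub>v w = (P ^\<^sub>m m) *\<^sub>v (P *\<^sub>v w)"
    using P Suc.prems by (simp add: assoc_mult_mat_vec[of _ n n _ n])
  then show ?case
    using Suc.IH[OF Pw] orthonormal_eigenbasis_mult[OF ev P i Suc.prems] by simp
qed (use P in simp)

lemma scalar_prod_pow_eigenbasis:
  assumes ev: "orthonormal_eigenbasis n P u d" and P: "P \<in> carrier_mat n n" "transpose_mat P = P"
    and vw: "v \<in> carrier_vec n" "w \<in> carrier_vec n"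
  shows "v \<bullet> ((P ^\<^sub>m m) *\<^sub>v w) = (\<Sum>i<n. d i ^ m * ((u i \<bullet> v) * (u i \<bullet> w)))"
proof -
  have "(P ^\<^sub>m m) *\<^sub>v w \<in> carrier_vec n"
    using P vw by (intro mult_mat_vec_carrier[of _ n n]) auto
  then show ?thesis
    using orthonormal_basis_parseval[OF ev vw(1)] eigenbasis_pow_mult[OF ev P _ vw(2)]
    by (simp add: mult_ac)
qed

lemma mat_trace_unit_vec:
  assumes "A \<in> carrier_mat n n"
  shows "mat_trace A = (\<Sum>k<n. unit_vec n k \<bullet> (A *\<^sub>v unit_vec n k))"
  using assms by (auto simp: mat_trace_def intro!: sum.cong)

lemma mat_trace_pow_eigenbasis:
  assumes ev: "orthonormal_eigenbasis n P u d" and P: "P \<in> carrier_mat n n" "transpose_mat P = P"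
  shows "mat_trace (P ^\<^sub>m m) = (\<Sum>i<n. d i ^ m)"
proof -
  have u: "u i \<in> carrier_vec n" if "i < n" for i
    using ev that by (simp add: orthonormal_eigenbasis_def)
  have "mat_trace (P ^\<^sub>m m) = (\<Sum>k<n. \<Sum>i<n. d i ^ m * ((u i \<bullet> unit_vec n k) * (u i \<bullet> unit_vec n k)))"
    using P by (subst mat_trace_unit_vec[of _ n]) (auto simp: scalar_prod_pow_eigenbasis[OF ev P])
  also have "\<dots> = (\<Sum>i<n. d i ^ m * (\<Sum>k<n. u i $ k * u i $ k))"
    using u by (subst sum.swap) (auto simp: sum_distrib_left intro!: sum.cong)
  also have "\<dots> = (\<Sum>i<n. d i ^ m * (u i \<bullet> u i))"
    using u by (intro sum.cong) (auto simp: scalar_prod_eq_sum[of _ n])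
  also have "\<dots> = (\<Sum>i<n. d i ^ m)"
    using ev by (intro sum.cong) (auto simp: orthonormal_eigenbasis_def)
  finally show ?thesis .
qed

lemma psd_mat_eigenbasis:
  assumes "psd_mat n P"
  obtains u d where "orthonormal_eigenbasis n P u d" "\<And>i. i < n \<Longrightarrow> 0 \<le> d i"
  using assms symmetric_mat_orthonormal_eigenbasis[of P n] psd_mat_eigenvalues_nonneg[OF assms]
  by (metis psd_mat_def)

lemma psd_mat_pow_nonneg:
  assumes "psd_mat n P" "v \<in> carrier_vec n"
  shows "0 \<le> v \<bullet> ((P ^\<^sub>m m) *\<^sub>v v)"
proof -
  obtain u d where ev: "orthonormal_eigenbasis n P u d" and d: "\<And>i. i < n \<Longrightarrow> 0 \<le> d i"
    using psd_mat_eigenbasis[OF assms(1)] by blast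
  show ?thesis
    using assms d by (subst scalar_prod_pow_eigenbasis[OF ev]) (auto simp: psd_mat_def intro!: sum_nonneg)
qed

lemma psd_mat_cauchy_schwarz:
  assumes P: "psd_mat n P" and v: "v \<in> carrier_vec n" and z: "z \<in> carrier_vec n"
  shows "(v \<bullet> (P *\<^sub>v z))\<^sup>2 \<le> (v \<bullet> (P *\<^sub>v v)) * (z \<bullet> (P *\<^sub>v z))"
proof -
  obtain u d where ev: "orthonormal_eigenbasis n P u d" and d: "\<And>i. i < n \<Longrightarrow> 0 \<le> d i"
    using psd_mat_eigenbasis[OF P] by blast
  have P': "P \<in> carrier_mat n n" "transpose_mat P = P" using P by (auto simp: psd_mat_def)
  have form: "x \<bullet> (P *\<^sub>v y) = (\<Sum>i<n. (sqrt (d i) * (u i \<bullet> x)) * (sqrt (d i) * (u i \<bullet> y)))"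
    if "x \<in> carrier_vec n" "y \<in> carrier_vec n" for x y
  proof -
    have "x \<bullet> (P *\<^sub>v y) = (\<Sum>i<n. d i ^ 1 * ((u i \<bullet> x) * (u i \<bullet> y)))"
      using scalar_prod_pow_eigenbasis[OF ev P' that, of 1] P' by simp
    also have "\<dots> = (\<Sum>i<n. (sqrt (d i) * (u i \<bullet> x)) * (sqrt (d i) * (u i \<bullet> y)))"
    proof (intro sum.cong refl)
      fix i assume "i \<in> {..<n}"
      then have "d i = sqrt (d i) * sqrt (d i)" using d by simp
      then show "d i ^ 1 * ((u i \<bullet> x) * (u i \<bullet> y)) =
          (sqrt (d i) * (u i \<bullet> x)) * (sqrt (d i) * (u i \<bullet> y))"
        by (metis (no_types, opaque_lifting) mult.assoc mult.left_commute power_one_right)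
    qed
    finally show ?thesis .
  qed
  show ?thesis
    unfolding form[OF v z] form[OF v v] form[OF z z]
    using Cauchy_Schwarz_ineq_sum[of "\<lambda>i. sqrt (d i) * (u i \<bullet> v)" "\<lambda>i. sqrt (d i) * (u i \<bullet> z)" "{..<n}"]
    by (simp only: power2_eq_square)
qed

text \<open>
  The subtracted form is \<open>(v'Pz)\<^sup>2/(1 + v'Pv)\<close>, which the Cauchy-Schwarz inequality for \<open>P\<close> keeps below \<open>z'Pz\<close>.
\<close>

lemma psd_sherman_morrison:
  assumes P: "psd_mat n P" and v: "v \<in> carrier_vec n"
  shows "psd_mat n (sherman_morrison n P v)"
    and "\<And>z. z \<in> carrier_vec n \<Longrightarrow> z \<bullet> (sherman_morrison n P v *\<^sub>v z) \<le> z \<bullet> (P *\<^sub>v z)"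
proof -
  have P': "P \<in> carrier_mat n n" "transpose_mat P = P" using P by (auto simp: psd_mat_def)
  define a where "a = v \<bullet> (P *\<^sub>v v)"
  have a: "0 \<le> a" using P v by (auto simp: psd_mat_def a_def)
  have eq: "z \<bullet> (sherman_morrison n P v *\<^sub>v z) = z \<bullet> (P *\<^sub>v z) - (v \<bullet> (P *\<^sub>v z))\<^sup>2 / (1 + a)"
    if z: "z \<in> carrier_vec n" for z
  proof -
    have Pv: "P *\<^sub>v v \<in> carrier_vec n" "P *\<^sub>v z \<in> carrier_vec n" using P' v z by auto
    have 1: "(P *\<^sub>v v) \<bullet> z = v \<bullet> (P *\<^sub>v z)" using symmetric_mat_scalar_prod[OF P' v z] by simp
    moreover have "z \<bullet> (P *\<^sub>v v) = v \<bullet> (P *\<^sub>v z)" using comm_scalar_prod[OF z Pv(1)] 1 by simp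
    ultimately show ?thesis
      using Pv z P' by (simp add: sherman_morrison_mult[OF P'(1) v z] scalar_prod_minus_distrib[of _ n]
          a_def power2_eq_square)
  qed
  have "0 \<le> z \<bullet> (sherman_morrison n P v *\<^sub>v z)" if z: "z \<in> carrier_vec n" for z
  proof -
    have g: "0 \<le> z \<bullet> (P *\<^sub>v z)" using P z by (auto simp: psd_mat_def)
    have "(v \<bullet> (P *\<^sub>v z))\<^sup>2 \<le> a * (z \<bullet> (P *\<^sub>v z))"
      unfolding a_def by (rule psd_mat_cauchy_schwarz[OF P v z])
    also have "\<dots> \<le> (1 + a) * (z \<bullet> (P *\<^sub>v z))" using g by (intro mult_right_mono) auto
    finally show ?thesis using a by (simp add: eq[OF z] field_simps)
  qed
  then show "psd_mat n (sherman_morrison n P v)"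
    using transpose_sherman_morrison[OF P'] by (auto simp: psd_mat_def)
  show "z \<bullet> (sherman_morrison n P v *\<^sub>v z) \<le> z \<bullet> (P *\<^sub>v z)" if "z \<in> carrier_vec n" for z
    using a by (simp add: eq[OF that])
qed

lemma pow_mat_mult_vec_Suc:
  fixes P :: "real Matrix.mat"
  assumes "P \<in> carrier_mat n n" "z \<in> carrier_vec n"
  shows "(P ^\<^sub>m Suc m) *\<^sub>v z = (P ^\<^sub>m m) *\<^sub>v (P *\<^sub>v z)"
    and "(P ^\<^sub>m Suc m) *\<^sub>v z = P *\<^sub>v ((P ^\<^sub>m m) *\<^sub>v z)"
proof -
  have *: "(P ^\<^sub>m Suc m) *\<^sub>v z = (P ^\<^sub>m m) *\<^sub>v (P *\<^sub>v z)" if "z \<in> carrier_vec n" for m z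
    using assms that by (simp add: assoc_mult_mat_vec[of _ n n _ n])
  show "(P ^\<^sub>m Suc m) *\<^sub>v z = (P ^\<^sub>m m) *\<^sub>v (P *\<^sub>v z)"
    using *[OF assms(2)] .
  show "(P ^\<^sub>m Suc m) *\<^sub>v z = P *\<^sub>v ((P ^\<^sub>m m) *\<^sub>v z)"
    using assms(2)
  proof (induction m arbitrary: z)
    case (Suc m)
    then show ?case using * [of z "Suc m"] * [of z m] assms(1) Suc.IH[of "P *\<^sub>v z"] by simp
  qed (use assms in simp)
qed

lemma pow_mat_mult_vec_carrier:
  fixes P :: "real Matrix.mat"
  assumes "P \<in> carrier_mat n n" "z \<in> carrier_vec n"
  shows "(P ^\<^sub>m m) *\<^sub>v z \<in> carrier_vec n"
  using assms by (intro mult_mat_vec_carrier[of _ n n]) auto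

lemma pow_mat_scalar_prod:
  fixes P :: "real Matrix.mat"
  assumes P: "P \<in> carrier_mat n n" "transpose_mat P = P"
    and "v \<in> carrier_vec n" "w \<in> carrier_vec n"
  shows "v \<bullet> ((P ^\<^sub>m m) *\<^sub>v w) = ((P ^\<^sub>m m) *\<^sub>v v) \<bullet> w"
  using assms(3,4)
proof (induction m arbitrary: v w)
  case (Suc m)
  then show ?case
    using P pow_mat_mult_vec_Suc(1)[OF P(1), of w m] pow_mat_mult_vec_Suc(2)[OF P(1), of v m]
      symmetric_mat_scalar_prod[OF P, of "(P ^\<^sub>m m) *\<^sub>v v" w] pow_mat_mult_vec_carrier[OF P(1)]
    by simp
qed (use P in simp)

text \<open>
  In an eigenbasis, \<open>a m = \<Sum>\<^sub>k w\<^sub>k d\<^sub>k\<^sup>m\<close> are the moments of a measure on the nonnegative reals. Chebyshev's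
  inequality for the equally ordered functions \<open>d\<^sup>i\<close> and \<open>d\<^sup>j\<close> under the weights \<open>w\<^sub>k d\<^sub>k\<close> is the claim; it follows by
  symmetrising the double sum.
\<close>

lemma psd_moments_chebyshev:
  assumes P: "psd_mat n P" and v: "v \<in> carrier_vec n"
  defines "a \<equiv> \<lambda>m. v \<bullet> ((P ^\<^sub>m m) *\<^sub>v v)"
  shows "a (Suc i) * a (Suc j) \<le> a 1 * a (Suc (i + j))"
proof -
  obtain u d where ev: "orthonormal_eigenbasis n P u d" and d: "\<And>i. i < n \<Longrightarrow> 0 \<le> d i"
    using psd_mat_eigenbasis[OF P] by blast
  define w where "w = (\<lambda>k. (u k \<bullet> v)\<^sup>2)"
  have a: "a m = (\<Sum>k<n. d k ^ m * w k)" for m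
    using P unfolding a_def w_def power2_eq_square
    by (subst scalar_prod_pow_eigenbasis[OF ev _ _ v v]) (auto simp: psd_mat_def)
  have prod: "a m * a m' = (\<Sum>k<n. \<Sum>l<n. w k * w l * (d k ^ m * d l ^ m'))" for m m'
    unfolding a sum_product by (intro sum.cong refl) (simp only: mult_ac)
  have prod': "a m * a m' = (\<Sum>k<n. \<Sum>l<n. w k * w l * (d l ^ m * d k ^ m'))" for m m'
    by (rule trans[OF mult.commute], rule trans[OF prod], intro sum.cong refl) (simp only: mult_ac)
  have "2 * (a 1 * a (Suc (i + j))) - 2 * (a (Suc i) * a (Suc j)) =
      (a 1 * a (Suc (i + j)) + a 1 * a (Suc (i + j))) - (a (Suc i) * a (Suc j) + a (Suc i) * a (Suc j))"
    by simp
  also have "\<dots> = (\<Sum>k<n. \<Sum>l<n. w k * w l * (d k ^ 1 * d l ^ Suc (i + j)))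
       + (\<Sum>k<n. \<Sum>l<n. w k * w l * (d l ^ 1 * d k ^ Suc (i + j)))
       - ((\<Sum>k<n. \<Sum>l<n. w k * w l * (d k ^ Suc i * d l ^ Suc j))
       + (\<Sum>k<n. \<Sum>l<n. w k * w l * (d l ^ Suc i * d k ^ Suc j)))"
    using prod[of 1 "Suc (i + j)"] prod'[of 1 "Suc (i + j)"] prod[of "Suc i" "Suc j"] prod'[of "Suc i" "Suc j"]
    by linarith
  also have "\<dots> = (\<Sum>k<n. \<Sum>l<n. w k * w l * (d k * d l * ((d l ^ i - d k ^ i) * (d l ^ j - d k ^ j))))"
    unfolding sum.distrib[symmetric] sum_subtractf[symmetric]
    by (intro sum.cong refl) (simp add: power_add algebra_simps)
  also have "\<dots> \<ge> 0"
  proof (intro sum_nonneg)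
    fix k l assume "k \<in> {..<n}" "l \<in> {..<n}"
    then have d': "0 \<le> d k" "0 \<le> d l" using d by auto
    have "0 \<le> (d l ^ i - d k ^ i) * (d l ^ j - d k ^ j)"
    proof (cases "d k \<le> d l")
      case True
      then show ?thesis using d' True by (intro mult_nonneg_nonneg) (simp_all add: power_mono)
    next
      case False
      then show ?thesis using d' False by (intro mult_nonpos_nonpos) (simp_all add: power_mono)
    qed
    then show "0 \<le> w k * w l * (d k * d l * ((d l ^ i - d k ^ i) * (d l ^ j - d k ^ j)))"
      using d' by (simp add: w_def mult_nonneg_nonneg[of "d k * d l"] mult_nonneg_nonneg[of "w k * w l"])
  qed
  finally show ?thesis by simp
qed

text \<open>
  Applied to the mixed moments \<open>m i j = v'Q\<^sup>iP\<^sup>jv\<close> of a matrix \<open>P\<close> and its update \<open>Q\<close>, with \<open>a\<close> and \<open>q\<close> the pure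
  moments. Dropping the subtracted term shows \<open>q \<le> a\<close>; then each step of the recursion loses at most
  \<open>q (i+1) a (j+1) \<le> a (i+1) a (j+1) \<le> a 1 a (i+j+1)\<close>.
\<close>

lemma moment_recursion_lower_bound:
  fixes m :: "nat \<Rightarrow> nat \<Rightarrow> real" and a q :: "nat \<Rightarrow> real"
  assumes m0: "\<And>j. m 0 j = a j" and mq: "\<And>i. m i 0 = q i"
    and rec: "\<And>i j. m (Suc i) j = m i (Suc j) - q (Suc i) * a (Suc j)"
    and nonneg: "\<And>j. 0 \<le> a j" "\<And>j. 0 \<le> q j"
    and cheb: "\<And>i j. a (Suc i) * a (Suc j) \<le> a 1 * a (Suc (i + j))"
  shows "a (i + j) * (1 - real i * a 1) \<le> m i j"
proof -
  have "m i j \<le> a (i + j)" for i j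
  proof (induction i arbitrary: j)
    case (Suc i)
    have "m (Suc i) j \<le> m i (Suc j)" unfolding rec using nonneg by simp
    also have "\<dots> \<le> a (i + Suc j)" by (rule Suc.IH)
    finally show ?case by simp
  qed (simp add: m0)
  from this[of _ 0] have qa: "q i \<le> a i" for i by (simp add: mq)
  show ?thesis
  proof (induction i arbitrary: j)
    case (Suc i)
    have "q (Suc i) * a (Suc j) \<le> a (Suc i) * a (Suc j)"
      using qa nonneg by (intro mult_right_mono) auto
    also have "\<dots> \<le> a 1 * a (Suc (i + j))" by (rule cheb)
    finally have "q (Suc i) * a (Suc j) \<le> a 1 * a (Suc (i + j))" .
    with Suc.IH[of "Suc j"] show ?case by (simp add: rec algebra_simps)
  qed (simp add: m0)
qed

text \<open>
  Telescoping \<open>tr P\<^sup>p - tr Q\<^sup>p\<close> along the mixed products \<open>Q\<^sup>iP\<^sup>p\<^sup>-\<^sup>i\<close> leaves only the rank-one matrix \<open>P - Q\<close>, which turns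
  each difference into a mixed moment, as \<open>Qv = Pv/(1 + v'Pv)\<close>. The second part is the recursion of these moments.
\<close>

lemma trace_pow_sherman_morrison:
  assumes P: "psd_mat n P" and v: "v \<in> carrier_vec n"
  defines "Q \<equiv> sherman_morrison n P v"
  shows "mat_trace (P ^\<^sub>m p) - mat_trace (Q ^\<^sub>m p) =
    (\<Sum>i<p. ((Q ^\<^sub>m Suc i) *\<^sub>v v) \<bullet> ((P ^\<^sub>m (p - i)) *\<^sub>v v))"
    and "((Q ^\<^sub>m Suc i) *\<^sub>v v) \<bullet> ((P ^\<^sub>m j) *\<^sub>v v) =
      ((Q ^\<^sub>m i) *\<^sub>v v) \<bullet> ((P ^\<^sub>m Suc j) *\<^sub>v v)
        - (v \<bullet> ((Q ^\<^sub>m Suc i) *\<^sub>v v)) * (v \<bullet> ((P ^\<^sub>m Suc j) *\<^sub>v v))"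
proof -
  have P': "P \<in> carrier_mat n n" "transpose_mat P = P" using P by (auto simp: psd_mat_def)
  have Q: "psd_mat n Q" unfolding Q_def by (rule psd_sherman_morrison[OF P v])
  then have Q': "Q \<in> carrier_mat n n" "transpose_mat Q = Q" by (auto simp: psd_mat_def)
  define a where "a = v \<bullet> (P *\<^sub>v v)"
  have a: "0 \<le> a" using P v by (auto simp: psd_mat_def a_def)
  have Pv: "P *\<^sub>v v \<in> carrier_vec n" using P' v by simp
  have Qv: "Q *\<^sub>v v = (1 / (1 + a)) \<cdot>\<^sub>v (P *\<^sub>v v)"
  proof -
    have "(P *\<^sub>v v) \<bullet> v = a" using symmetric_mat_scalar_prod[OF P' v v] by (simp add: a_def)
    moreover have "x - (a / (1 + a)) * x = (1 / (1 + a)) * x" for x using a by (simp add: field_simps)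
    ultimately show ?thesis
      unfolding Q_def sherman_morrison_mult[OF P'(1) v v] a_def[symmetric] using P'
      by (intro eq_vecI) (auto simp del: index_mult_mat_vec)
  qed
  \<comment> \<open>The rank-one identity \<open>x'(P - Q)z = (v'Pz)(x'Qv)\<close>, from which everything else follows.\<close>
  have diff: "x \<bullet> (Q *\<^sub>v z) = x \<bullet> (P *\<^sub>v z) - (v \<bullet> (P *\<^sub>v z)) * (x \<bullet> (Q *\<^sub>v v))"
    if xz: "x \<in> carrier_vec n" "z \<in> carrier_vec n" for x z
  proof -
    have "(P *\<^sub>v v) \<bullet> z = v \<bullet> (P *\<^sub>v z)" using symmetric_mat_scalar_prod[OF P' v xz(2)] by simp
    then show ?thesis
      unfolding Qv using Pv xz P'
      by (simp add: Q_def sherman_morrison_mult[OF P'(1) v xz(2)] a_def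
          scalar_prod_minus_distrib[of _ n])
  qed
  let ?P = "\<lambda>i x. (P ^\<^sub>m i) *\<^sub>v x" and ?Q = "\<lambda>i x. (Q ^\<^sub>m i) *\<^sub>v x"
  note Pc = pow_mat_mult_vec_carrier[OF P'(1)] and Qc = pow_mat_mult_vec_carrier[OF Q'(1)]
  have step: "?Q (Suc i) x \<bullet> ?P j x =
      ?Q i x \<bullet> ?P (Suc j) x
        - (?Q (Suc i) v \<bullet> x) * (?P (Suc j) v \<bullet> x)"
    if x: "x \<in> carrier_vec n" for x i j
  proof -
    have "?Q (Suc i) x \<bullet> ?P j x = ?Q i x \<bullet> (Q *\<^sub>v ?P j x)"
      using symmetric_mat_scalar_prod[OF Q' Qc[OF x] Pc[OF x]]
      by (simp add: pow_mat_mult_vec_Suc(2)[OF Q'(1) x] del: pow_mat.simps)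
    also have "\<dots> = ?Q i x \<bullet> (P *\<^sub>v ?P j x)
        - (v \<bullet> (P *\<^sub>v ?P j x)) * (?Q i x \<bullet> (Q *\<^sub>v v))"
      by (rule diff[OF Qc[OF x] Pc[OF x]])
    also have "P *\<^sub>v ?P j x = (P ^\<^sub>m Suc j) *\<^sub>v x"
      by (rule pow_mat_mult_vec_Suc(2)[OF P'(1) x, symmetric])
    also have "v \<bullet> ?P (Suc j) x = ?P (Suc j) v \<bullet> x"
      by (rule pow_mat_scalar_prod[OF P' v x])
    also have "?Q i x \<bullet> (Q *\<^sub>v v) = ?Q (Suc i) v \<bullet> x"
    proof -
      have Qv': "Q *\<^sub>v v \<in> carrier_vec n" using Q' v by simp
      have "?Q i x \<bullet> (Q *\<^sub>v v) = x \<bullet> ?Q i (Q *\<^sub>v v)"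
        by (rule pow_mat_scalar_prod[OF Q' x Qv', symmetric])
      also have "\<dots> = ?Q (Suc i) v \<bullet> x"
        unfolding pow_mat_mult_vec_Suc(1)[OF Q'(1) v, symmetric]
        by (rule comm_scalar_prod[OF x Qc[OF v]])
      finally show ?thesis .
    qed
    finally show ?thesis by (simp only: mult_ac)
  qed
  show "?Q (Suc i) v \<bullet> ?P j v =
      ?Q i v \<bullet> ?P (Suc j) v
        - (v \<bullet> ?Q (Suc i) v) * (v \<bullet> ?P (Suc j) v)"
    unfolding step[OF v] comm_scalar_prod[OF v Qc[OF v]] comm_scalar_prod[OF v Pc[OF v]] by simp
  \<comment> \<open>This is the trace of \<open>Q\<^sup>iP\<^sup>j\<close>.\<close>
  define T where "T = (\<lambda>i j. \<Sum>k<n. ?Q i (unit_vec n k) \<bullet> ?P j (unit_vec n k))"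
  have T_step: "T i (Suc j) - T (Suc i) j = ?Q (Suc i) v \<bullet> ?P (Suc j) v" for i j
  proof -
    have "T i (Suc j) - T (Suc i) j =
        (\<Sum>k<n. (?Q (Suc i) v \<bullet> unit_vec n k) * (?P (Suc j) v \<bullet> unit_vec n k))"
      unfolding T_def sum_subtractf[symmetric] by (intro sum.cong refl, subst step) auto
    also have "\<dots> = (\<Sum>k<n. ?Q (Suc i) v $ k * ?P (Suc j) v $ k)"
      using Qc[OF v, of "Suc i"] Pc[OF v, of "Suc j"]
      by (intro sum.cong refl) (auto simp del: pow_mat.simps index_mult_mat_vec)
    also have "\<dots> = ?Q (Suc i) v \<bullet> ?P (Suc j) v"
      using Pc[OF v] by (simp add: scalar_prod_eq_sum[of _ n] del: pow_mat.simps index_mult_mat_vec)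
    finally show ?thesis .
  qed
  have "T 0 p - T p 0 = (\<Sum>i<p. T i (p - i) - T (Suc i) (p - Suc i))"
    using sum_lessThan_telescope'[of "\<lambda>i. T i (p - i)" p] by simp
  also have "\<dots> = (\<Sum>i<p. ?Q (Suc i) v \<bullet> ?P (p - i) v)"
  proof (intro sum.cong refl)
    fix i assume "i \<in> {..<p}"
    then have "p - i = Suc (p - Suc i)" by auto
    then show "T i (p - i) - T (Suc i) (p - Suc i) =
        ?Q (Suc i) v \<bullet> ?P (p - i) v"
      using T_step[of i "p - Suc i"] by (simp del: pow_mat.simps)
  qed
  also have "T 0 p = mat_trace (P ^\<^sub>m p)"
    using P' Q' by (subst mat_trace_unit_vec[of _ n]) (auto simp: T_def)
  also have "T p 0 = mat_trace (Q ^\<^sub>m p)"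
  proof -
    have "T p 0 = (\<Sum>k<n. ?Q p (unit_vec n k) \<bullet> unit_vec n k)"
      using P' by (auto simp: T_def)
    also have "\<dots> = (\<Sum>k<n. unit_vec n k \<bullet> ?Q p (unit_vec n k))"
      using Qc by (intro sum.cong refl comm_scalar_prod[of _ n]) auto
    finally show ?thesis using Q' by (subst mat_trace_unit_vec[of _ n]) auto
  qed
  finally show "mat_trace (P ^\<^sub>m p) - mat_trace (Q ^\<^sub>m p) =
    (\<Sum>i<p. ?Q (Suc i) v \<bullet> ?P (p - i) v)" .
qed

text \<open>
  To first order in \<open>v v'\<close> the decrease is \<open>p v'P\<^sup>p\<^sup>+\<^sup>1v\<close>. Each of the \<open>p\<close> mixed moments that make up the exact decrease is
  at least \<open>(1 - p v'Pv) v'P\<^sup>p\<^sup>+\<^sup>1v\<close>, so half of the first-order term survives.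
\<close>

lemma trace_pow_rank_one_decrease:
  assumes P: "psd_mat n P" and v: "v \<in> carrier_vec n" and small: "real p * (v \<bullet> (P *\<^sub>v v)) \<le> 1 / 2"
  shows "mat_trace (sherman_morrison n P v ^\<^sub>m p) \<le>
    mat_trace (P ^\<^sub>m p) - real p / 2 * (v \<bullet> ((P ^\<^sub>m Suc p) *\<^sub>v v))"
proof -
  define Q where "Q = sherman_morrison n P v"
  have Q: "psd_mat n Q" unfolding Q_def by (rule psd_sherman_morrison[OF P v])
  define m where "m = (\<lambda>i j. ((Q ^\<^sub>m i) *\<^sub>v v) \<bullet> ((P ^\<^sub>m j) *\<^sub>v v))"
  define a where "a = (\<lambda>j. v \<bullet> ((P ^\<^sub>m j) *\<^sub>v v))"
  define q where "q = (\<lambda>j. v \<bullet> ((Q ^\<^sub>m j) *\<^sub>v v))"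
  have carr: "P \<in> carrier_mat n n" "Q \<in> carrier_mat n n" using P Q by (auto simp: psd_mat_def)
  have a1: "a 1 = v \<bullet> (P *\<^sub>v v)" using carr by (simp add: a_def)
  have nonneg: "0 \<le> a j" "0 \<le> q j" for j
    using psd_mat_pow_nonneg[OF P v] psd_mat_pow_nonneg[OF Q v] by (auto simp: a_def q_def)
  have bound: "a (i + j) * (1 - real i * a 1) \<le> m i j" for i j
  proof (rule moment_recursion_lower_bound[where q = q])
    show "m (Suc i) j = m i (Suc j) - q (Suc i) * a (Suc j)" for i j
      unfolding m_def q_def a_def Q_def by (rule trace_pow_sherman_morrison(2)[OF P v])
    show "a (Suc i) * a (Suc j) \<le> a 1 * a (Suc (i + j))" for i j
      unfolding a_def by (rule psd_moments_chebyshev[OF P v])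
    show "m 0 j = a j" for j using carr v by (simp add: m_def a_def)
    show "m i 0 = q i" for i
      using carr v comm_scalar_prod[OF v pow_mat_mult_vec_carrier[OF carr(2) v]] by (simp add: m_def q_def)
  qed (rule nonneg)+
  have "real p / 2 * a (Suc p) = (\<Sum>i<p. a (Suc p) * (1 / 2))" by simp
  also have "\<dots> \<le> (\<Sum>i<p. m (Suc i) (p - i))"
  proof (rule sum_mono)
    fix i assume i: "i \<in> {..<p}"
    have "real (Suc i) * a 1 \<le> real p * a 1" using i nonneg(1)[of 1] by (intro mult_right_mono) auto
    also have "\<dots> \<le> 1 / 2" using small a1 by simp
    finally have "a (Suc p) * (1 / 2) \<le> a (Suc p) * (1 - real (Suc i) * a 1)"
      using nonneg(1)[of "Suc p"] by (intro mult_left_mono) auto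
    also have "\<dots> \<le> m (Suc i) (p - i)" using bound[of "Suc i" "p - i"] i by simp
    finally show "a (Suc p) * (1 / 2) \<le> m (Suc i) (p - i)" .
  qed
  also have "\<dots> = mat_trace (P ^\<^sub>m p) - mat_trace (Q ^\<^sub>m p)"
    unfolding m_def Q_def by (rule trace_pow_sherman_morrison(1)[OF P v, symmetric])
  finally show ?thesis unfolding a_def Q_def by simp
qed

text \<open>
  The tangent inequality \<open>p d\<^sup>p\<^sup>+\<^sup>1 \<ge> (p + 1) l d\<^sup>p - l\<^sup>p\<^sup>+\<^sup>1\<close>, summed over the eigenvalues. It replaces the power mean
  inequality between \<open>tr P\<^sup>p\<^sup>+\<^sup>1\<close> and \<open>tr P\<^sup>p\<close>: being linear in the traces, it passes to expectations.
\<close>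

lemma trace_pow_Suc_lower_bound:
  assumes P: "psd_mat n P" and l: "0 < l"
  shows "(real p + 1) * l * mat_trace (P ^\<^sub>m p) - real n * l ^ Suc p \<le> real p * mat_trace (P ^\<^sub>m Suc p)"
proof -
  obtain u d where ev: "orthonormal_eigenbasis n P u d" and d: "\<And>i. i < n \<Longrightarrow> 0 \<le> d i"
    using psd_mat_eigenbasis[OF P] by blast
  have P': "P \<in> carrier_mat n n" "transpose_mat P = P" using P by (auto simp: psd_mat_def)
  have "(real p + 1) * l * x ^ p - l ^ Suc p \<le> real p * x ^ Suc p" if x: "0 \<le> x" for x
  proof (cases "x = 0")
    case True
    then show ?thesis using l by (cases p) auto
  next
    case False
    with x have x: "0 < x" by simp
    have "1 + real (Suc p) * (l / x - 1) \<le> (1 + (l / x - 1)) ^ Suc p"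
      using l x by (intro Bernoulli_inequality) simp
    then have "(1 + real (Suc p) * (l / x - 1)) * x ^ Suc p \<le> (l / x) ^ Suc p * x ^ Suc p"
      using x by (intro mult_right_mono) auto
    also have "(l / x) ^ Suc p * x ^ Suc p = l ^ Suc p"
      using x by (simp add: power_divide)
    also have "(1 + real (Suc p) * (l / x - 1)) * x ^ Suc p = (real p + 1) * l * x ^ p - real p * x ^ Suc p"
      using x by (simp add: field_simps)
    finally show ?thesis by simp
  qed
  then have "(\<Sum>i<n. (real p + 1) * l * d i ^ p - l ^ Suc p) \<le> (\<Sum>i<n. real p * d i ^ Suc p)"
    using d by (intro sum_mono) auto
  then show ?thesis
    unfolding mat_trace_pow_eigenbasis[OF ev P']
    by (simp add: sum_subtractf sum_distrib_left)
qed

text \<open>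
  The inverse of \<open>c I + \<Sum>\<^sub>s\<^sub><\<^sub>t v\<^sub>s v\<^sub>s'\<close>, built by updates rather than by inversion so that its entries are visibly
  measurable functions of the vectors.
\<close>

fun resolvent :: "nat \<Rightarrow> real \<Rightarrow> (nat \<Rightarrow> real Matrix.vec) \<Rightarrow> nat \<Rightarrow> real Matrix.mat" where
  "resolvent n c v 0 = (1 / c) \<cdot>\<^sub>m 1\<^sub>m n"
| "resolvent n c v (Suc t) = sherman_morrison n (resolvent n c v t) (v t)"

lemma resolvent_psd:
  assumes c: "0 < c" and v: "\<And>s. s < t \<Longrightarrow> v s \<in> carrier_vec n"
  shows "psd_mat n (resolvent n c v t)"
    and "\<And>z. z \<in> carrier_vec n \<Longrightarrow> z \<bullet> (resolvent n c v t *\<^sub>v z) \<le> (z \<bullet> z) / c"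
proof -
  have "psd_mat n (resolvent n c v t) \<and>
    (\<forall>z\<in>carrier_vec n. z \<bullet> (resolvent n c v t *\<^sub>v z) \<le> (z \<bullet> z) / c)"
    using v
  proof (induction t)
    case 0
    have 1: "((1 / c) \<cdot>\<^sub>m 1\<^sub>m n) *\<^sub>v z = (1 / c) \<cdot>\<^sub>v z" if "z \<in> carrier_vec n" for z
      using that by (intro eq_vecI) (auto simp: row_smult)
    have "transpose_mat ((1 / c) \<cdot>\<^sub>m 1\<^sub>m n) = (1 / c) \<cdot>\<^sub>m (1\<^sub>m n :: real Matrix.mat)"
      by (intro eq_matI) auto
    then show ?case using c
      by (auto simp: psd_mat_def 1 scalar_prod_self_nonneg)
  next
    case (Suc t)
    then have P: "psd_mat n (resolvent n c v t)" by simp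
    have "v t \<in> carrier_vec n" using Suc by simp
    from psd_sherman_morrison[OF P this] Suc show ?case by fastforce
  qed
  then show "psd_mat n (resolvent n c v t)"
    "\<And>z. z \<in> carrier_vec n \<Longrightarrow> z \<bullet> (resolvent n c v t *\<^sub>v z) \<le> (z \<bullet> z) / c" by auto
qed

lemma resolvent_inverse:
  assumes c: "0 < c" and v: "\<And>s. s < t \<Longrightarrow> v s \<in> carrier_vec n" and w: "w \<in> carrier_vec n"
  shows "resolvent n c v t *\<^sub>v Matrix.vec n (\<lambda>a. c * w $ a + (\<Sum>s<t. (v s \<bullet> w) * v s $ a)) = w"
  using v
proof (induction t)
  case 0
  then show ?case using w c by (intro eq_vecI) (auto simp: row_smult)
next
  case (Suc t)
  define P where "P = resolvent n c v t"
  define z where "z = Matrix.vec n (\<lambda>a. c * w $ a + (\<Sum>s<t. (v s \<bullet> w) * v s $ a))"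
  have z: "z \<in> carrier_vec n" and vt: "v t \<in> carrier_vec n" using Suc by (auto simp: z_def)
  have psd: "psd_mat n P" unfolding P_def using Suc by (intro resolvent_psd c) auto
  then have P: "P \<in> carrier_mat n n" "transpose_mat P = P" by (auto simp: psd_mat_def)
  have Pz: "P *\<^sub>v z = w" unfolding P_def z_def using Suc by auto
  define a where "a = v t \<bullet> (P *\<^sub>v v t)"
  have a: "0 \<le> a" using psd vt by (auto simp: psd_mat_def a_def)
  have Pv: "P *\<^sub>v v t \<in> carrier_vec n" using P vt by simp
  have z_Suc: "Matrix.vec n (\<lambda>a. c * w $ a + (\<Sum>s<Suc t. (v s \<bullet> w) * v s $ a)) = z + (v t \<bullet> w) \<cdot>\<^sub>v v t"
    using vt by (intro eq_vecI) (auto simp: z_def)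
  have "sherman_morrison n P (v t) *\<^sub>v (z + (v t \<bullet> w) \<cdot>\<^sub>v v t) =
      P *\<^sub>v (z + (v t \<bullet> w) \<cdot>\<^sub>v v t) - (((P *\<^sub>v v t) \<bullet> (z + (v t \<bullet> w) \<cdot>\<^sub>v v t)) / (1 + a)) \<cdot>\<^sub>v (P *\<^sub>v v t)"
    unfolding a_def using z vt by (intro sherman_morrison_mult[OF P(1)]) auto
  also have "P *\<^sub>v (z + (v t \<bullet> w) \<cdot>\<^sub>v v t) = w + (v t \<bullet> w) \<cdot>\<^sub>v (P *\<^sub>v v t)"
    using P z vt by (simp add: mult_add_distrib_mat_vec[of _ n n] mult_mat_vec[of _ n n] Pz)
  also have "(P *\<^sub>v v t) \<bullet> (z + (v t \<bullet> w) \<cdot>\<^sub>v v t) = (v t \<bullet> w) * (1 + a)"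
  proof -
    have "(P *\<^sub>v v t) \<bullet> z = v t \<bullet> w"
      using symmetric_mat_scalar_prod[OF P vt z] by (simp add: Pz)
    moreover have "(P *\<^sub>v v t) \<bullet> v t = a"
      using symmetric_mat_scalar_prod[OF P vt vt] by (simp add: a_def)
    ultimately show ?thesis
      using Pv z vt by (simp add: scalar_prod_add_distrib[of _ n] algebra_simps)
  qed
  also have "(v t \<bullet> w) * (1 + a) / (1 + a) = v t \<bullet> w" using a by simp
  also have "w + (v t \<bullet> w) \<cdot>\<^sub>v (P *\<^sub>v v t) - (v t \<bullet> w) \<cdot>\<^sub>v (P *\<^sub>v v t) = w"
    using w P by (intro eq_vecI) (auto simp del: index_mult_mat_vec)
  finally show ?case by (simp only: z_Suc resolvent.simps P_def)
qed

text \<open>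
  A small value of the quadratic form of a matrix makes one of its eigenvalues small, hence an eigenvalue of
  the inverse large.
\<close>

lemma small_form_imp_large_resolvent_trace:
  assumes c: "0 < c" and v: "\<And>s. s < t \<Longrightarrow> v s \<in> carrier_vec n" and w: "w \<in> carrier_vec n"
    and x: "0 < x" and p: "0 < p"
    and small: "c * (w \<bullet> w) + (\<Sum>s<t. (v s \<bullet> w)\<^sup>2) < x * (w \<bullet> w)"
  shows "(1 / x) ^ p < mat_trace (resolvent n c v t ^\<^sub>m p)"
proof -
  define P where "P = resolvent n c v t"
  have psd: "psd_mat n P" unfolding P_def using v by (intro resolvent_psd c) auto
  then have P: "P \<in> carrier_mat n n" "transpose_mat P = P" by (auto simp: psd_mat_def)
  obtain u d where ev: "orthonormal_eigenbasis n P u d" and d: "\<And>i. i < n \<Longrightarrow> 0 \<le> d i"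
    using psd_mat_eigenbasis[OF psd] by blast
  define z where "z = Matrix.vec n (\<lambda>a. c * w $ a + (\<Sum>s<t. (v s \<bullet> w) * v s $ a))"
  have z: "z \<in> carrier_vec n" by (simp add: z_def)
  have Pz: "P *\<^sub>v z = w" unfolding P_def z_def by (rule resolvent_inverse[OF c v w])
  have wz: "z \<bullet> w = c * (w \<bullet> w) + (\<Sum>s<t. (v s \<bullet> w)\<^sup>2)"
  proof -
    have "z \<bullet> w = (\<Sum>a<n. z $ a * w $ a)" using w by (simp add: scalar_prod_eq_sum[of _ n])
    also have "\<dots> = (\<Sum>a<n. c * (w $ a * w $ a) + (\<Sum>s<t. (v s \<bullet> w) * (v s $ a * w $ a)))"
      by (intro sum.cong refl) (simp add: z_def distrib_right sum_distrib_right mult.assoc)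
    also have "\<dots> = c * (\<Sum>a<n. w $ a * w $ a) + (\<Sum>s<t. (v s \<bullet> w) * (\<Sum>a<n. v s $ a * w $ a))"
      unfolding sum.distrib sum_distrib_left by (subst sum.swap) simp
    finally show ?thesis
      unfolding scalar_prod_eq_sum[OF w, symmetric] by (simp add: power2_eq_square)
  qed
  have zw: "z \<bullet> w = (\<Sum>i<n. d i * (u i \<bullet> z)\<^sup>2)"
    using scalar_prod_pow_eigenbasis[OF ev P z z, of 1] P by (simp add: Pz power2_eq_square)
  have ww: "w \<bullet> w = (\<Sum>i<n. (d i)\<^sup>2 * (u i \<bullet> z)\<^sup>2)"
  proof -
    have "u i \<bullet> w = d i * (u i \<bullet> z)" if "i < n" for i
      using orthonormal_eigenbasis_mult[OF ev P that z] by (simp add: Pz)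
    then show ?thesis
      using orthonormal_basis_parseval[OF ev w w] by (simp add: power2_eq_square mult_ac)
  qed
  have "\<exists>i<n. d i * (u i \<bullet> z)\<^sup>2 < x * ((d i)\<^sup>2 * (u i \<bullet> z)\<^sup>2)"
  proof (rule ccontr)
    assume "\<not> ?thesis"
    then have "(\<Sum>i<n. x * ((d i)\<^sup>2 * (u i \<bullet> z)\<^sup>2)) \<le> (\<Sum>i<n. d i * (u i \<bullet> z)\<^sup>2)"
      by (intro sum_mono) (metis lessThan_iff not_less)
    moreover have "z \<bullet> w < x * (w \<bullet> w)" using small wz by simp
    ultimately show False unfolding zw ww by (simp add: sum_distrib_left)
  qed
  then obtain i where i: "i < n" "d i * (u i \<bullet> z)\<^sup>2 < x * ((d i)\<^sup>2 * (u i \<bullet> z)\<^sup>2)" by auto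
  then have "d i * (u i \<bullet> z)\<^sup>2 * 1 < d i * (u i \<bullet> z)\<^sup>2 * (x * d i)"
    by (simp add: power2_eq_square mult_ac)
  moreover have "0 \<le> d i * (u i \<bullet> z)\<^sup>2" using d[OF i(1)] by simp
  ultimately have "1 < x * d i" by (meson mult_left_mono not_less)
  then have "1 / x < d i" using x by (simp add: field_simps)
  then have "(1 / x) ^ p < d i ^ p" using x p by (intro power_strict_mono) auto
  also have "\<dots> \<le> (\<Sum>i<n. d i ^ p)" using i d by (intro member_le_sum) auto
  finally show ?thesis unfolding mat_trace_pow_eigenbasis[OF ev P, symmetric] P_def .
qed

section \<open>Lower tail of random quadratic forms\<close>

text \<open>
  Integrability of all entries of the random resolvents is obtained from closure of this class under the
  operations that build them.
\<close>

definition bdd_measurable :: "'b measure \<Rightarrow> ('b \<Rightarrow> real) \<Rightarrow> bool" where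
  "bdd_measurable N f \<longleftrightarrow> f \<in> borel_measurable N \<and> (\<exists>C. \<forall>x\<in>space N. \<bar>f x\<bar> \<le> C)"

lemma bdd_measurable_const: "bdd_measurable N (\<lambda>x. c)"
  by (auto simp: bdd_measurable_def)

lemma bdd_measurable_cong:
  assumes "\<And>x. x \<in> space N \<Longrightarrow> f x = g x"
  shows "bdd_measurable N f \<longleftrightarrow> bdd_measurable N g"
  using measurable_cong[of N f g] assms by (auto simp: bdd_measurable_def)

lemma bdd_measurable_diff:
  assumes "bdd_measurable N f" "bdd_measurable N g"
  shows "bdd_measurable N (\<lambda>x. f x - g x)"
proof -
  obtain C D where "\<forall>x\<in>space N. \<bar>f x\<bar> \<le> C" "\<forall>x\<in>space N. \<bar>g x\<bar> \<le> D"
    using assms by (auto simp: bdd_measurable_def)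
  then have "\<forall>x\<in>space N. \<bar>f x - g x\<bar> \<le> C + D" by fastforce
  then show ?thesis using assms by (auto simp: bdd_measurable_def)
qed

lemma bdd_measurable_mult:
  assumes "bdd_measurable N f" "bdd_measurable N g"
  shows "bdd_measurable N (\<lambda>x. f x * g x)"
proof -
  obtain C D where "\<forall>x\<in>space N. \<bar>f x\<bar> \<le> C" "\<forall>x\<in>space N. \<bar>g x\<bar> \<le> D"
    using assms by (auto simp: bdd_measurable_def)
  then have "\<forall>x\<in>space N. \<bar>f x * g x\<bar> \<le> C * D"
    by (metis abs_ge_zero abs_mult mult_mono order_trans)
  then show ?thesis using assms by (auto simp: bdd_measurable_def)
qed

lemma bdd_measurable_sum:
  assumes "\<And>i. i \<in> I \<Longrightarrow> bdd_measurable N (f i)"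
  shows "bdd_measurable N (\<lambda>x. \<Sum>i\<in>I. f i x)"
proof -
  obtain C where C: "\<forall>x\<in>space N. \<bar>f i x\<bar> \<le> C i" if "i \<in> I" for i
    using assms unfolding bdd_measurable_def by metis
  have "\<bar>\<Sum>i\<in>I. f i x\<bar> \<le> (\<Sum>i\<in>I. C i)" if "x \<in> space N" for x
    using C that by (intro order_trans[OF sum_abs] sum_mono) auto
  moreover have "(\<lambda>x. \<Sum>i\<in>I. f i x) \<in> borel_measurable N"
    using assms by (intro borel_measurable_sum) (auto simp: bdd_measurable_def)
  ultimately show ?thesis unfolding bdd_measurable_def by blast
qed

text \<open>
  The denominators \<open>1 + v'Pv\<close> of the update formula are at least 1.
\<close>

lemma bdd_measurable_divide:
  assumes "bdd_measurable N f" "bdd_measurable N g" "\<And>x. x \<in> space N \<Longrightarrow> 1 \<le> g x"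
  shows "bdd_measurable N (\<lambda>x. f x / g x)"
proof -
  obtain C where C: "\<forall>x\<in>space N. \<bar>f x\<bar> \<le> C"
    using assms by (auto simp: bdd_measurable_def)
  have "\<bar>f x / g x\<bar> \<le> C" if x: "x \<in> space N" for x
  proof -
    have "\<bar>f x / g x\<bar> = \<bar>f x\<bar> / g x" using assms(3)[OF x] by simp
    also have "\<dots> \<le> \<bar>f x\<bar> / 1" using assms(3)[OF x] by (intro divide_left_mono) auto
    finally show ?thesis using C x by fastforce
  qed
  then show ?thesis using assms by (auto simp: bdd_measurable_def)
qed

lemmas bdd_measurable_intros =
  bdd_measurable_const bdd_measurable_diff bdd_measurable_mult bdd_measurable_sum

lemma bdd_measurable_compose:
  assumes "bdd_measurable N f" "g \<in> measurable M N"
  shows "bdd_measurable M (\<lambda>x. f (g x))"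
  using assms measurable_space[OF assms(2)] by (fastforce simp: bdd_measurable_def)

lemma (in prob_space) bdd_measurable_integrable:
  assumes "bdd_measurable M f"
  shows "integrable M f"
proof -
  obtain C where "\<forall>x\<in>space M. \<bar>f x\<bar> \<le> C" and "f \<in> borel_measurable M"
    using assms by (auto simp: bdd_measurable_def)
  then show ?thesis by (intro integrable_const_bound[of _ C] AE_I2) auto
qed

lemma integral_double_sum:
  fixes F :: "nat \<Rightarrow> nat \<Rightarrow> 'b \<Rightarrow> real"
  assumes "\<And>i j. i < m \<Longrightarrow> j < n \<Longrightarrow> integrable P (F i j)"
  shows "integrable P (\<lambda>x. \<Sum>i<m. \<Sum>j<n. F i j x)"
    and "(\<integral>x. (\<Sum>i<m. \<Sum>j<n. F i j x) \<partial>P) = (\<Sum>i<m. \<Sum>j<n. \<integral>x. F i j x \<partial>P)"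
proof -
  have inner: "integrable P (\<lambda>x. \<Sum>j<n. F i j x)" if "i < m" for i
    using assms that by (intro Bochner_Integration.integrable_sum) auto
  show "integrable P (\<lambda>x. \<Sum>i<m. \<Sum>j<n. F i j x)"
    using assms by (intro Bochner_Integration.integrable_sum) auto
  have "(\<integral>x. (\<Sum>i<m. \<Sum>j<n. F i j x) \<partial>P) = (\<Sum>i<m. \<integral>x. (\<Sum>j<n. F i j x) \<partial>P)"
    using inner by (intro Bochner_Integration.integral_sum) auto
  then show "(\<integral>x. (\<Sum>i<m. \<Sum>j<n. F i j x) \<partial>P) = (\<Sum>i<m. \<Sum>j<n. \<integral>x. F i j x \<partial>P)"
    using assms by (simp add: Bochner_Integration.integral_sum cong: sum.cong_simp)
qed

lemma bdd_measurable_mult_mat_vec: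
  assumes "\<And>i j. i < n \<Longrightarrow> j < n \<Longrightarrow> bdd_measurable N (\<lambda>x. P x $$ (i, j))"
    and "\<And>i. i < n \<Longrightarrow> bdd_measurable N (\<lambda>x. v x $ i)"
    and carr: "\<And>x. x \<in> space N \<Longrightarrow> P x \<in> carrier_mat n n" "\<And>x. x \<in> space N \<Longrightarrow> v x \<in> carrier_vec n"
    and i: "i < n"
  shows "bdd_measurable N (\<lambda>x. (P x *\<^sub>v v x) $ i)"
proof -
  have "bdd_measurable N (\<lambda>x. \<Sum>j<n. P x $$ (i, j) * v x $ j)"
    using assms by (intro bdd_measurable_intros) auto
  moreover have "(P x *\<^sub>v v x) $ i = (\<Sum>j<n. P x $$ (i, j) * v x $ j)" if "x \<in> space N" for x
    using carr[OF that] i by (auto simp: scalar_prod_eq_sum[of _ n] intro!: sum.cong)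
  ultimately show ?thesis by (subst bdd_measurable_cong) auto
qed

lemma bdd_measurable_pow_mat:
  assumes "\<And>i j. i < n \<Longrightarrow> j < n \<Longrightarrow> bdd_measurable N (\<lambda>x. P x $$ (i, j))"
    and carr: "\<And>x. x \<in> space N \<Longrightarrow> P x \<in> carrier_mat n n"
    and "i < n" "j < n"
  shows "bdd_measurable N (\<lambda>x. (P x ^\<^sub>m m) $$ (i, j))"
  using assms(3,4)
proof (induction m arbitrary: i j)
  case 0
  have "bdd_measurable N (\<lambda>x. if i = j then 1 else 0)" by (rule bdd_measurable_const)
  then show ?case using 0 carrier_matD[OF carr] by (subst bdd_measurable_cong) auto
next
  case (Suc m)
  have "bdd_measurable N (\<lambda>x. \<Sum>k<n. (P x ^\<^sub>m m) $$ (i, k) * P x $$ (k, j))"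
    using assms Suc by (intro bdd_measurable_intros) auto
  moreover have "(P x ^\<^sub>m Suc m) $$ (i, j) = (\<Sum>k<n. (P x ^\<^sub>m m) $$ (i, k) * P x $$ (k, j))"
    if "x \<in> space N" for x
    using carr[OF that] Suc.prems
    by (auto simp: scalar_prod_eq_sum[of _ n] intro!: sum.cong)
  ultimately show ?case by (subst bdd_measurable_cong) auto
qed

lemma resolvent_carrier:
  "0 < c \<Longrightarrow> (\<And>s. s < t \<Longrightarrow> v s \<in> carrier_vec n) \<Longrightarrow> resolvent n c v t \<in> carrier_mat n n"
  using resolvent_psd(1) by (auto simp: psd_mat_def)

lemma resolvent_cong:
  "(\<And>s. s < t \<Longrightarrow> v s = v' s) \<Longrightarrow> resolvent n c v t = resolvent n c v' t"
  by (induction t) auto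

lemma bdd_measurable_resolvent:
  assumes c: "0 < c"
    and V: "\<And>s a. s < t \<Longrightarrow> a < n \<Longrightarrow> bdd_measurable N (\<lambda>x. V s x $ a)"
    and carr: "\<And>s x. s < t \<Longrightarrow> x \<in> space N \<Longrightarrow> V s x \<in> carrier_vec n"
    and "i < n" "j < n"
  shows "bdd_measurable N (\<lambda>x. resolvent n c (\<lambda>s. V s x) t $$ (i, j))"
  using V carr assms(4,5)
proof (induction t arbitrary: i j)
  case 0
  then show ?case by (simp add: bdd_measurable_const)
next
  case (Suc t)
  define P where "P = (\<lambda>x. resolvent n c (\<lambda>s. V s x) t)"
  have psd: "psd_mat n (P x)" if "x \<in> space N" for x
    unfolding P_def using Suc.prems that by (intro resolvent_psd c) auto
  then have Pc: "P x \<in> carrier_mat n n" if "x \<in> space N" for x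
    using that by (auto simp: psd_mat_def)
  have P: "bdd_measurable N (\<lambda>x. P x $$ (i, j))" if "i < n" "j < n" for i j
    unfolding P_def using Suc.prems(1,2) that by (intro Suc.IH) auto
  have y: "bdd_measurable N (\<lambda>x. (P x *\<^sub>v V t x) $ a)" if "a < n" for a
    using Suc.prems Pc P that by (intro bdd_measurable_mult_mat_vec[of n]) auto
  have "bdd_measurable N (\<lambda>x. \<Sum>a<n. V t x $ a * (P x *\<^sub>v V t x) $ a)"
    using Suc.prems y by (intro bdd_measurable_intros) auto
  moreover have "V t x \<bullet> (P x *\<^sub>v V t x) = (\<Sum>a<n. V t x $ a * (P x *\<^sub>v V t x) $ a)"
    if "x \<in> space N" for x
    using Pc[OF that] Suc.prems(2)[of t x] that
    by (subst scalar_prod_eq_sum[of _ n]) auto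
  ultimately have "bdd_measurable N (\<lambda>x. V t x \<bullet> (P x *\<^sub>v V t x))"
    by (subst bdd_measurable_cong) auto
  then have "bdd_measurable N (\<lambda>x. 1 - (0 - V t x \<bullet> (P x *\<^sub>v V t x)))"
    by (intro bdd_measurable_intros)
  then have den: "bdd_measurable N (\<lambda>x. 1 + V t x \<bullet> (P x *\<^sub>v V t x))" by simp
  have "bdd_measurable N (\<lambda>x. P x $$ (i, j) - (P x *\<^sub>v V t x) $ i * (P x *\<^sub>v V t x) $ j
      / (1 + V t x \<bullet> (P x *\<^sub>v V t x)))"
    using psd Suc.prems P y
    by (intro bdd_measurable_diff bdd_measurable_divide bdd_measurable_mult den)
      (auto simp: psd_mat_def)
  then show ?case using Suc.prems by (simp add: sherman_morrison_def P_def)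
qed

lemma mat_trace_resolvent_0:
  assumes "0 < c"
  shows "mat_trace (resolvent n c v 0 ^\<^sub>m p) = real n * (1 / c) ^ p"
proof -
  have "((1 / c) \<cdot>\<^sub>m 1\<^sub>m n) *\<^sub>v z = (1 / c) \<cdot>\<^sub>v z" if "z \<in> carrier_vec n" for z
    using that by (intro eq_vecI) (auto simp: row_smult)
  then have "orthonormal_eigenbasis n ((1 / c) \<cdot>\<^sub>m 1\<^sub>m n) (unit_vec n) (\<lambda>_. 1 / c)"
    by (auto simp: orthonormal_eigenbasis_def)
  moreover have "transpose_mat ((1 / c) \<cdot>\<^sub>m 1\<^sub>m n) = (1 / c) \<cdot>\<^sub>m (1\<^sub>m n :: real Matrix.mat)"
    by (intro eq_matI) auto
  ultimately show ?thesis by (simp add: mat_trace_pow_eigenbasis)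
qed

context prob_space
begin

lemma resolvent_pow_bdd_measurable:
  fixes X :: "nat \<Rightarrow> 'a \<Rightarrow> 'b" and f :: "'b \<Rightarrow> real Matrix.vec"
  assumes X: "\<And>s. s < t \<Longrightarrow> X s \<in> measurable M N"
    and f: "\<And>a. a < k \<Longrightarrow> bdd_measurable N (\<lambda>x. f x $ a)"
    and carr: "\<And>x. f x \<in> carrier_vec k"
    and c: "0 < c"
  defines "P \<equiv> \<lambda>\<omega>. resolvent k c (\<lambda>s. f (X s \<omega>)) t"
  shows "i < k \<Longrightarrow> j < k \<Longrightarrow> bdd_measurable M (\<lambda>\<omega>. (P \<omega> ^\<^sub>m m) $$ (i, j))"
    and "integrable M (\<lambda>\<omega>. mat_trace (P \<omega> ^\<^sub>m m))"
proof -
  have fX: "bdd_measurable M (\<lambda>\<omega>. f (X s \<omega>) $ a)" if "s < t" "a < k" for s a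
    using bdd_measurable_compose[OF f[OF that(2)] X[OF that(1)]] .
  have psd: "psd_mat k (P \<omega>)" for \<omega>
    unfolding P_def using carr by (intro resolvent_psd c) auto
  then have Pc: "P \<omega> \<in> carrier_mat k k" for \<omega> by (auto simp: psd_mat_def)
  have P: "bdd_measurable M (\<lambda>\<omega>. P \<omega> $$ (i, j))" if "i < k" "j < k" for i j
    unfolding P_def using that carr fX by (intro bdd_measurable_resolvent c) auto
  show P_bm: "bdd_measurable M (\<lambda>\<omega>. (P \<omega> ^\<^sub>m m) $$ (i, j))" if "i < k" "j < k" for m i j
    using P Pc that by (intro bdd_measurable_pow_mat[of k]) auto
  have tr: "mat_trace (P \<omega> ^\<^sub>m m) = (\<Sum>i<k. (P \<omega> ^\<^sub>m m) $$ (i, i))" for m \<omega>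
    using Pc[of \<omega>] by (simp add: mat_trace_def)
  show "integrable M (\<lambda>\<omega>. mat_trace (P \<omega> ^\<^sub>m m))"
    unfolding tr using P_bm
    by (intro bdd_measurable_integrable bdd_measurable_intros) auto
qed

text \<open>
  The resolvent at time \<open>t\<close> depends on the observations before \<open>t\<close> only, so it is independent of the next vector, whose
  second moment matrix is the identity: the expectation of \<open>v'P\<^sup>p\<^sup>+\<^sup>1v\<close> is that of the trace of \<open>P\<^sup>p\<^sup>+\<^sup>1\<close>.
\<close>

lemma expected_trace_step:
  fixes X :: "nat \<Rightarrow> 'a \<Rightarrow> 'b" and f :: "'b \<Rightarrow> real Matrix.vec"
  assumes indep: "indep_vars (\<lambda>_. N) X {..<n}"
    and f: "\<And>a. a < k \<Longrightarrow> bdd_measurable N (\<lambda>x. f x $ a)"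
    and carr: "\<And>x. f x \<in> carrier_vec k"
    and L: "\<And>x. x \<in> space N \<Longrightarrow> f x \<bullet> f x \<le> L"
    and iso: "\<And>s a b. s < n \<Longrightarrow> a < k \<Longrightarrow> b < k \<Longrightarrow>
        expectation (\<lambda>\<omega>. f (X s \<omega>) $ a * f (X s \<omega>) $ b) = (if a = b then 1 else 0)"
    and c: "0 < c" "2 * real p * L \<le> c" and t: "t < n"
  defines "P \<equiv> \<lambda>t \<omega>. resolvent k c (\<lambda>s. f (X s \<omega>)) t"
  shows "expectation (\<lambda>\<omega>. mat_trace (P (Suc t) \<omega> ^\<^sub>m p)) \<le>
      expectation (\<lambda>\<omega>. mat_trace (P t \<omega> ^\<^sub>m p)) - real p / 2 * expectation (\<lambda>\<omega>. mat_trace (P t \<omega> ^\<^sub>m Suc p))"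
proof -
  have X: "X s \<in> measurable M N" if "s < n" for s
    using indep that unfolding indep_vars_def by auto
  have fX: "bdd_measurable M (\<lambda>\<omega>. f (X s \<omega>) $ a)" if "s < n" "a < k" for s a
    using bdd_measurable_compose[OF f[OF that(2)] X[OF that(1)]] .
  have X': "X s \<in> measurable M N" if "s < t'" "t' \<le> n" for s t' using X that by auto
  note rp = resolvent_pow_bdd_measurable[OF X' f carr c(1)]
  have Pc: "P s \<omega> \<in> carrier_mat k k" for s \<omega>
    unfolding P_def using carr by (intro resolvent_carrier c) auto
  have P_bm: "bdd_measurable M (\<lambda>\<omega>. (P s \<omega> ^\<^sub>m m) $$ (i, j))" if "s \<le> n" "i < k" "j < k" for s m i j
    unfolding P_def by (rule rp(1)) (use that in auto)
  have tr: "mat_trace (P s \<omega> ^\<^sub>m m) = (\<Sum>i<k. (P s \<omega> ^\<^sub>m m) $$ (i, i))" for s m \<omega>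
    using Pc[of s \<omega>] by (simp add: mat_trace_def)
  have tr_int: "integrable M (\<lambda>\<omega>. mat_trace (P s \<omega> ^\<^sub>m m))" if "s \<le> n" for s m
    unfolding P_def by (rule rp(2)) (use that in auto)
  define V where "V = (\<lambda>\<omega>. f (X t \<omega>))"
  let ?Q = "\<lambda>\<omega>. P t \<omega> ^\<^sub>m Suc p"
  have quad: "V \<omega> \<bullet> (?Q \<omega> *\<^sub>v V \<omega>) =
      (\<Sum>i<k. \<Sum>j<k. ?Q \<omega> $$ (i, j) * (V \<omega> $ i * V \<omega> $ j))" for \<omega>
  proof -
    have Q: "?Q \<omega> \<in> carrier_mat k k" using Pc by (rule pow_carrier_mat)
    have "V \<omega> \<bullet> (?Q \<omega> *\<^sub>v V \<omega>) = (\<Sum>i<k. V \<omega> $ i * (?Q \<omega> *\<^sub>v V \<omega>) $ i)"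
      using Q carr by (intro scalar_prod_eq_sum mult_mat_vec_carrier[of _ k k]) (auto simp: V_def)
    also have "\<dots> = (\<Sum>i<k. V \<omega> $ i * (\<Sum>j<k. ?Q \<omega> $$ (i, j) * V \<omega> $ j))"
      using Pc[of t \<omega>] carr by (intro sum.cong refl arg_cong2[of _ _ _ _ "(*)"])
        (auto simp: V_def scalar_prod_eq_sum[of _ k] simp del: pow_mat.simps)
    finally show ?thesis by (simp add: sum_distrib_left mult_ac del: pow_mat.simps)
  qed
  have f_comp: "bdd_measurable (PiM I (\<lambda>_. N)) (\<lambda>x. f (x s) $ a)" if "s \<in> I" "a < k" for s a and I :: "nat set"
    by (rule bdd_measurable_compose[OF f[OF that(2)] measurable_component_singleton[OF that(1)]])
  have indep_entry: "integrable M (\<lambda>\<omega>. ?Q \<omega> $$ (i, j) * (V \<omega> $ i * V \<omega> $ j)) \<and>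
     expectation (\<lambda>\<omega>. ?Q \<omega> $$ (i, j) * (V \<omega> $ i * V \<omega> $ j)) =
     expectation (\<lambda>\<omega>. ?Q \<omega> $$ (i, j)) * (if i = j then 1 else 0)"
    if ij: "i < k" "j < k" for i j
  proof -
    define W where "W = (\<lambda>x. (resolvent k c (\<lambda>s. f (x s)) t ^\<^sub>m Suc p) $$ (i, j))"
    define U where "U = (\<lambda>x :: nat \<Rightarrow> 'b. f (x t) $ i * f (x t) $ j)"
    have W: "bdd_measurable (PiM {..<t} (\<lambda>_. N)) W"
      unfolding W_def using carr ij c
      by (intro bdd_measurable_pow_mat[of k] bdd_measurable_resolvent resolvent_carrier)
        (auto intro!: f_comp)
    have U: "bdd_measurable (PiM {t} (\<lambda>_. N)) U"
      unfolding U_def using ij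
      by (intro bdd_measurable_mult f_comp) auto
    have "indep_var (PiM {..<t} (\<lambda>_. N)) (\<lambda>\<omega>. restrict (\<lambda>i. X i \<omega>) {..<t})
        (PiM {t} (\<lambda>_. N)) (\<lambda>\<omega>. restrict (\<lambda>i. X i \<omega>) {t})"
      using t by (intro indep_var_restrict[OF indep]) auto
    then have "indep_var borel (W \<circ> (\<lambda>\<omega>. restrict (\<lambda>i. X i \<omega>) {..<t})) borel (U \<circ> (\<lambda>\<omega>. restrict (\<lambda>i. X i \<omega>) {t}))"
      using W U by (intro indep_var_compose) (auto simp: bdd_measurable_def)
    moreover have "W \<circ> (\<lambda>\<omega>. restrict (\<lambda>i. X i \<omega>) {..<t}) = (\<lambda>\<omega>. ?Q \<omega> $$ (i, j))"
      unfolding W_def P_def comp_def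
      by (intro ext arg_cong[of _ _ "\<lambda>A. (A ^\<^sub>m Suc p) $$ (i, j)"] resolvent_cong) auto
    moreover have "U \<circ> (\<lambda>\<omega>. restrict (\<lambda>i. X i \<omega>) {t}) = (\<lambda>\<omega>. V \<omega> $ i * V \<omega> $ j)"
      by (auto simp: U_def V_def comp_def)
    ultimately have ind: "indep_var borel (\<lambda>\<omega>. ?Q \<omega> $$ (i, j)) borel (\<lambda>\<omega>. V \<omega> $ i * V \<omega> $ j)"
      by simp
    have 1: "integrable M (\<lambda>\<omega>. ?Q \<omega> $$ (i, j))"
      by (intro bdd_measurable_integrable P_bm) (use ij t in auto)
    have 2: "integrable M (\<lambda>\<omega>. V \<omega> $ i * V \<omega> $ j)"
      unfolding V_def using fX ij t by (intro bdd_measurable_integrable bdd_measurable_mult) auto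
    show ?thesis
      using indep_var_integrable[OF ind 1 2] indep_var_lebesgue_integral[OF ind 1 2] iso[OF t ij]
      by (simp add: V_def del: pow_mat.simps)
  qed
  have quad_int: "integrable M (\<lambda>\<omega>. V \<omega> \<bullet> (?Q \<omega> *\<^sub>v V \<omega>))"
    unfolding quad using indep_entry by (intro integral_double_sum(1)) auto
  have quad_E: "expectation (\<lambda>\<omega>. V \<omega> \<bullet> (?Q \<omega> *\<^sub>v V \<omega>)) =
      expectation (\<lambda>\<omega>. mat_trace (?Q \<omega>))"
  proof -
    have "expectation (\<lambda>\<omega>. V \<omega> \<bullet> (?Q \<omega> *\<^sub>v V \<omega>)) =
      (\<Sum>i<k. \<Sum>j<k. expectation (\<lambda>\<omega>. ?Q \<omega> $$ (i, j) * (V \<omega> $ i * V \<omega> $ j)))"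
      unfolding quad using indep_entry by (intro integral_double_sum(2)) auto
    also have "\<dots> = (\<Sum>i<k. \<Sum>j<k. expectation (\<lambda>\<omega>. ?Q \<omega> $$ (i, j)) * (if i = j then 1 else 0))"
      using indep_entry by (intro sum.cong) auto
    also have "\<dots> = (\<Sum>i<k. expectation (\<lambda>\<omega>. ?Q \<omega> $$ (i, i)))"
      by (intro sum.cong refl) (simp add: if_distrib[of "(*) _"] del: pow_mat.simps cong: if_cong)
    also have "\<dots> = expectation (\<lambda>\<omega>. mat_trace (?Q \<omega>))"
      unfolding tr
      by (intro Bochner_Integration.integral_sum[symmetric] bdd_measurable_integrable P_bm) (use t in auto)
    finally show ?thesis .
  qed
  have step: "mat_trace (P (Suc t) \<omega> ^\<^sub>m p) \<le>
      mat_trace (P t \<omega> ^\<^sub>m p) - real p / 2 * (V \<omega> \<bullet> (?Q \<omega> *\<^sub>v V \<omega>))"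
    if \<omega>: "\<omega> \<in> space M" for \<omega>
  proof -
    have psd: "psd_mat k (P t \<omega>)" unfolding P_def using carr by (intro resolvent_psd c) auto
    have "V \<omega> \<bullet> (P t \<omega> *\<^sub>v V \<omega>) \<le> (V \<omega> \<bullet> V \<omega>) / c"
      unfolding P_def V_def using carr by (intro resolvent_psd c) auto
    also have "\<dots> \<le> L / c"
      unfolding V_def using L[OF measurable_space[OF X[OF t] \<omega>]] c(1) by (intro divide_right_mono) auto
    finally have "real p * (V \<omega> \<bullet> (P t \<omega> *\<^sub>v V \<omega>)) \<le> real p * (L / c)"
      by (intro mult_left_mono) auto
    also have "\<dots> \<le> 1 / 2" using c by (simp add: field_simps)
    finally have "mat_trace (sherman_morrison k (P t \<omega>) (V \<omega>) ^\<^sub>m p) \<le>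
      mat_trace (P t \<omega> ^\<^sub>m p) - real p / 2 * (V \<omega> \<bullet> (?Q \<omega> *\<^sub>v V \<omega>))"
      using carr by (intro trace_pow_rank_one_decrease[OF psd]) (auto simp: V_def)
    then show ?thesis by (simp add: P_def V_def)
  qed
  have "expectation (\<lambda>\<omega>. mat_trace (P (Suc t) \<omega> ^\<^sub>m p)) \<le>
      expectation (\<lambda>\<omega>. mat_trace (P t \<omega> ^\<^sub>m p) - real p / 2 * (V \<omega> \<bullet> (?Q \<omega> *\<^sub>v V \<omega>)))"
    using tr_int[of "Suc t" p] tr_int[of t p] t quad_int step
    by (intro integral_mono) auto
  also have "\<dots> = expectation (\<lambda>\<omega>. mat_trace (P t \<omega> ^\<^sub>m p)) - real p / 2 * expectation (\<lambda>\<omega>. mat_trace (?Q \<omega>))"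
    using tr_int[of t p] t quad_int unfolding quad_E[symmetric] by simp
  finally show "expectation (\<lambda>\<omega>. mat_trace (P (Suc t) \<omega> ^\<^sub>m p)) \<le>
      expectation (\<lambda>\<omega>. mat_trace (P t \<omega> ^\<^sub>m p)) - real p / 2 * expectation (\<lambda>\<omega>. mat_trace (?Q \<omega>))" .
qed

lemma indep_vars_reindex:
  assumes inj: "inj_on e I" and indep: "indep_vars M' X (e ` I)"
  shows "indep_vars (\<lambda>i. M' (e i)) (\<lambda>i. X (e i)) I"
proof -
  define F where "F = (\<lambda>i. {X i -` A \<inter> space M | A. A \<in> sets (M' i)})"
  have F: "indep_sets F (e ` I)" and X: "\<And>i. i \<in> I \<Longrightarrow> random_variable (M' (e i)) (X (e i))"
    using indep by (auto simp: indep_vars_def2 F_def)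
  have "indep_sets (\<lambda>i. F (e i)) I"
  proof (rule indep_setsI)
    fix i assume "i \<in> I"
    then show "F (e i) \<subseteq> events" using F by (auto simp: indep_sets_def)
  next
    fix A J assume J: "J \<noteq> {}" "J \<subseteq> I" "finite J" "\<forall>j\<in>J. A j \<in> F (e j)"
    define A' where "A' = (\<lambda>i. A (inv_into I e i))"
    have A': "A' (e j) = A j" if "j \<in> J" for j
      using that J inj by (auto simp: A'_def)
    have "prob (\<Inter>j\<in>e ` J. A' j) = (\<Prod>j\<in>e ` J. prob (A' j))"
      using J A' by (intro indep_setsD[OF F]) auto
    moreover have "(\<Prod>j\<in>e ` J. prob (A' j)) = (\<Prod>j\<in>J. prob (A' (e j)))"
      using inj_on_subset[OF inj J(2)] by (simp add: prod.reindex)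
    ultimately show "prob (\<Inter>j\<in>J. A j) = (\<Prod>j\<in>J. prob (A j))"
      using A' by (simp cong: INF_cong_simp prod.cong_simp)
  qed
  then show ?thesis using X by (simp add: indep_vars_def2 F_def)
qed

text \<open>
  With \<open>\<phi> t = E tr P\<^sub>t\<^sup>p\<close> and \<open>l t = 1/(c + t/2)\<close>, the bound \<open>\<phi> t \<le> k (l t)\<^sup>p\<close> propagates: the one-step decrease combined
  with the tangent inequality at \<open>l t\<close> gives \<open>\<phi> (t+1) \<le> k (l t)\<^sup>p (1 - p l t/2)\<close>, and Bernoulli's inequality bounds the last
  factor by \<open>(l (t+1)/l t)\<^sup>p\<close>.
\<close>

lemma resolvent_tail:
  fixes X :: "nat \<Rightarrow> 'a \<Rightarrow> 'b" and f :: "'b \<Rightarrow> real Matrix.vec"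
  assumes indep: "indep_vars (\<lambda>_. N) X {..<n}"
    and f: "\<And>a. a < k \<Longrightarrow> bdd_measurable N (\<lambda>x. f x $ a)"
    and carr: "\<And>x. f x \<in> carrier_vec k"
    and L: "\<And>x. x \<in> space N \<Longrightarrow> f x \<bullet> f x \<le> L"
    and iso: "\<And>s a b. s < n \<Longrightarrow> a < k \<Longrightarrow> b < k \<Longrightarrow>
        expectation (\<lambda>\<omega>. f (X s \<omega>) $ a * f (X s \<omega>) $ b) = (if a = b then 1 else 0)"
    and c: "0 < c" "2 * real p * L \<le> c" "real p + 1 \<le> 2 * c" and p: "0 < p" and n: "0 < n" and x: "0 < x"
  shows "\<exists>B\<in>events. prob B \<le> real k * (x / (c + real n / 2)) ^ p \<and>
     (\<forall>\<omega>\<in>space M - B. \<forall>w\<in>carrier_vec k. x * (w \<bullet> w) \<le> c * (w \<bullet> w) + (\<Sum>s<n. (f (X s \<omega>) \<bullet> w)\<^sup>2))"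
proof -
  define P where "P = (\<lambda>t \<omega>. resolvent k c (\<lambda>s. f (X s \<omega>)) t)"
  define \<phi> where "\<phi> = (\<lambda>t. expectation (\<lambda>\<omega>. mat_trace (P t \<omega> ^\<^sub>m p)))"
  define l where "l = (\<lambda>t. 1 / (c + real t / 2))"
  have X: "X s \<in> measurable M N" if "s < t" "t \<le> n" for s t
    using indep that unfolding indep_vars_def by auto
  have tr_int: "integrable M (\<lambda>\<omega>. mat_trace (P s \<omega> ^\<^sub>m m))" if "s \<le> n" for s m
    unfolding P_def by (rule resolvent_pow_bdd_measurable(2)[OF X f carr c(1)]) (use that in auto)
  have psd: "psd_mat k (P t \<omega>)" for t \<omega>
    unfolding P_def using carr by (intro resolvent_psd c) auto
  have "\<phi> t \<le> real k * l t ^ p" if "t \<le> n" for t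
    using that
  proof (induction t)
    case 0
    show ?case using c mat_trace_resolvent_0[OF c(1)] by (simp add: \<phi>_def P_def l_def prob_space del: resolvent.simps)
  next
    case (Suc t)
    have l: "0 < l t" unfolding l_def using c by simp
    have "(real p + 1) * l t * \<phi> t - real k * l t ^ Suc p =
        expectation (\<lambda>\<omega>. (real p + 1) * l t * mat_trace (P t \<omega> ^\<^sub>m p) - real k * l t ^ Suc p)"
      using tr_int[of t p] Suc.prems by (simp add: \<phi>_def prob_space)
    also have "\<dots> \<le> expectation (\<lambda>\<omega>. real p * mat_trace (P t \<omega> ^\<^sub>m Suc p))"
      using tr_int[of t] Suc.prems
      by (intro integral_mono trace_pow_Suc_lower_bound[OF psd l]) (simp_all del: pow_mat.simps)
    also have "\<dots> = real p * expectation (\<lambda>\<omega>. mat_trace (P t \<omega> ^\<^sub>m Suc p))" by simp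
    finally have 1: "(real p + 1) * l t * \<phi> t - real k * l t ^ Suc p \<le>
        real p * expectation (\<lambda>\<omega>. mat_trace (P t \<omega> ^\<^sub>m Suc p))" .
    have "\<phi> (Suc t) \<le> \<phi> t - real p / 2 * expectation (\<lambda>\<omega>. mat_trace (P t \<omega> ^\<^sub>m Suc p))"
      unfolding \<phi>_def P_def by (rule expected_trace_step[OF indep f carr L iso c(1,2)]) (use Suc.prems in auto)
    also have "\<dots> \<le> \<phi> t * (1 - (real p + 1) * l t / 2) + real k * l t ^ p * (l t / 2)"
      using 1 by (simp add: field_simps)
    also have "\<dots> \<le> real k * l t ^ p * (1 - (real p + 1) * l t / 2) + real k * l t ^ p * (l t / 2)"
    proof (intro add_right_mono mult_right_mono)
      show "\<phi> t \<le> real k * l t ^ p" using Suc by simp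
      \<comment> \<open>The coefficient of \<open>\<phi> t\<close> has to be nonnegative for the induction hypothesis to be of use.\<close>
      have "real p + 1 \<le> 2 * (c + real t / 2)" using c by simp
      then show "0 \<le> 1 - (real p + 1) * l t / 2"
        using c by (simp add: l_def field_simps add_pos_nonneg)
    qed
    also have "\<dots> = real k * l t ^ p * (1 - real p * (l t / 2))" by (simp add: field_simps)
    also have "\<dots> \<le> real k * l t ^ p * (1 / (1 + l t / 2)) ^ p"
    proof (intro mult_left_mono)
      define y where "y = l t / 2"
      have y: "0 < y" using l by (simp add: y_def)
      have "1 - real p * y \<le> 1 + real p * (- (y / (1 + y)))"
        using y by (simp add: mult_left_mono field_simps)
      also have "\<dots> \<le> (1 + - (y / (1 + y))) ^ p"
        using y by (intro Bernoulli_inequality) (simp add: field_simps)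
      also have "1 + - (y / (1 + y)) = 1 / (1 + y)" using y by (simp add: field_simps)
      finally show "1 - real p * (l t / 2) \<le> (1 / (1 + l t / 2)) ^ p" by (simp add: y_def)
    qed (use l in auto)
    also have "\<dots> = real k * (l t * (1 / (1 + l t / 2))) ^ p"
      unfolding power_mult_distrib by (simp only: mult.assoc)
    also have "l t * (1 / (1 + l t / 2)) = l (Suc t)"
    proof -
      define u where "u = c + real t / 2"
      have u: "0 < u" using c by (simp add: u_def add_pos_nonneg)
      have "(1 + 1 / u / 2) * u = u + 1 / 2" using u by (simp add: field_simps)
      then have "1 / u * (1 / (1 + 1 / u / 2)) = 1 / (u + 1 / 2)" by (simp add: mult.commute)
      then show ?thesis by (simp add: l_def u_def add_divide_distrib add_ac)
    qed
    finally show ?case .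
  qed
  from this[of n] have \<phi>: "\<phi> n \<le> real k * (1 / (c + real n / 2)) ^ p" by (simp add: l_def)
  define B where "B = {\<omega>\<in>space M. (1 / x) ^ p \<le> mat_trace (P n \<omega> ^\<^sub>m p)}"
  have nonneg: "0 \<le> mat_trace (P n \<omega> ^\<^sub>m p)" for \<omega>
  proof -
    obtain u d where ev: "orthonormal_eigenbasis k (P n \<omega>) u d" and d: "\<And>i. i < k \<Longrightarrow> 0 \<le> d i"
      using psd_mat_eigenbasis[OF psd] by blast
    show ?thesis using d psd[of n \<omega>] by (subst mat_trace_pow_eigenbasis[OF ev]) (auto simp: psd_mat_def intro!: sum_nonneg)
  qed
  have B: "B \<in> events"
    unfolding B_def using borel_measurable_integrable[OF tr_int[of n p]] by measurable
  have "prob B \<le> \<phi> n / (1 / x) ^ p"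
    unfolding B_def \<phi>_def using x tr_int[of n p] nonneg by (intro integral_Markov_inequality_measure[where A = "{}"]) auto
  also have "\<dots> \<le> real k * (1 / (c + real n / 2)) ^ p / (1 / x) ^ p"
    using \<phi> x by (intro divide_right_mono) auto
  also have "\<dots> = real k * (x / (c + real n / 2)) ^ p"
    by (simp add: power_divide)
  finally have "prob B \<le> real k * (x / (c + real n / 2)) ^ p" .
  moreover have "x * (w \<bullet> w) \<le> c * (w \<bullet> w) + (\<Sum>s<n. (f (X s \<omega>) \<bullet> w)\<^sup>2)"
    if "\<omega> \<in> space M - B" "w \<in> carrier_vec k" for \<omega> w
  proof (rule ccontr)
    assume "\<not> ?thesis"
    then have "(1 / x) ^ p < mat_trace (P n \<omega> ^\<^sub>m p)"
      unfolding P_def using carr that(2) x p c by (intro small_form_imp_large_resolvent_trace) auto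
    then show False using that(1) by (auto simp: B_def)
  qed
  ultimately show ?thesis using B by blast
qed

end

section \<open>Algebra of least squares\<close>

lemma moore_penrose_right_inverse:
  assumes A: "A \<in> carrier_mat n n" and det: "Determinant.det A \<noteq> 0"
  shows "moore_penrose A \<in> carrier_mat n n" "A * moore_penrose A = 1\<^sub>m n"
proof -
  obtain B where B: "B \<in> carrier_mat n n" "B * A = 1\<^sub>m n" "A * B = 1\<^sub>m n"
    using det_non_zero_imp_unit[OF A det, of "()"] by (auto simp: Units_def ring_mat_simps)
  have "is_moore_penrose A B" using A B by (simp add: is_moore_penrose_def)
  moreover have "C = B" if "is_moore_penrose A C" for C
  proof -
    have C: "C \<in> carrier_mat n n" "A * C * A = A" using that A by (auto simp: is_moore_penrose_def)
    have "C = B * A * C * (A * B)" using B C by simp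
    also have "\<dots> = B * (A * C * A) * B"
      using A B(1) C(1) by (simp add: assoc_mult_mat[of _ n n _ n _ n])
    also have "\<dots> = B" using A B C(2) by simp
    finally show ?thesis .
  qed
  ultimately have "moore_penrose A = B" unfolding moore_penrose_def by (rule the_equality)
  then show "moore_penrose A \<in> carrier_mat n n" "A * moore_penrose A = 1\<^sub>m n" using B by auto
qed

lemma design_mat_carrier [simp]: "design_mat K n f xs \<in> carrier_mat n K"
  by (simp add: design_mat_def)

lemma design_mat_mult:
  assumes "\<And>x. f x \<in> carrier_vec K" "c \<in> carrier_vec K" "i < n"
  shows "(design_mat K n f xs *\<^sub>v c) $ i = f (xs (int i + 1)) \<bullet> c"
proof -
  have "Matrix.row (design_mat K n f xs) i = f (xs (int i + 1))"
    using assms(3) carrier_vecD[OF assms(1)] by (intro eq_vecI) (auto simp: design_mat_def)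
  then show ?thesis using assms(3) by (simp add: design_mat_def)
qed

lemma design_mat_mult_scalar_prod:
  assumes "\<And>x. f x \<in> carrier_vec K" "c \<in> carrier_vec K" "y \<in> carrier_vec n"
  shows "c \<bullet> (transpose_mat (design_mat K n f xs) *\<^sub>v y) = (\<Sum>i<n. (f (xs (int i + 1)) \<bullet> c) * y $ i)"
proof -
  define B where "B = design_mat K n f xs"
  have B: "B \<in> carrier_mat n K" by (simp add: B_def)
  have Bc: "B *\<^sub>v c \<in> carrier_vec n" using B assms(2) by simp
  have "c \<bullet> (transpose_mat B *\<^sub>v y) = (transpose_mat B *\<^sub>v y) \<bullet> c"
    using B assms by (intro comm_scalar_prod[of _ K]) auto
  also have "\<dots> = y \<bullet> (B *\<^sub>v c)" using transpose_vec_mult_scalar[OF B assms(2,3)] by simp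
  also have "\<dots> = (\<Sum>i<n. y $ i * (B *\<^sub>v c) $ i)" by (rule scalar_prod_eq_sum[OF Bc])
  also have "\<dots> = (\<Sum>i<n. (f (xs (int i + 1)) \<bullet> c) * y $ i)"
    unfolding B_def using assms by (intro sum.cong refl) (simp add: design_mat_mult del: index_mult_mat_vec)
  finally show ?thesis by (simp add: B_def)
qed

text \<open>
  Positivity of the empirical quadratic form makes \<open>B'B\<close> invertible, so the Moore-Penrose inverse in the definition is
  an inverse and the coefficient vector solves \<open>B'B ch = B'y\<close>.
\<close>

lemma series_ls_normal_equations:
  assumes f: "\<And>x. f x \<in> carrier_vec K"
    and pos: "\<And>c. c \<in> carrier_vec K \<Longrightarrow> c \<noteq> 0\<^sub>v K \<Longrightarrow> 0 < (\<Sum>i<n. (f (xs (int i + 1)) \<bullet> c)\<^sup>2)"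
  obtains ch where "ch \<in> carrier_vec K" "series_ls K n f xs ys = (\<lambda>x. f x \<bullet> ch)"
    "\<And>c. c \<in> carrier_vec K \<Longrightarrow> (\<Sum>i<n. (f (xs (int i + 1)) \<bullet> c) * (f (xs (int i + 1)) \<bullet> ch)) =
       (\<Sum>i<n. (f (xs (int i + 1)) \<bullet> c) * ys (int i + 1))"
proof -
  let ?F = "\<lambda>i. f (xs (int i + 1))"
  define B where "B = design_mat K n f xs"
  define A where "A = transpose_mat B * B"
  define y where "y = Matrix.vec n (\<lambda>i. ys (int i + 1))"
  have B: "B \<in> carrier_mat n K" "transpose_mat B \<in> carrier_mat K n" by (simp_all add: B_def)
  have A: "A \<in> carrier_mat K K" using B by (simp add: A_def)
  have y: "y \<in> carrier_vec n" by (simp add: y_def)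
  have form: "c \<bullet> (A *\<^sub>v d) = (\<Sum>i<n. (?F i \<bullet> c) * (?F i \<bullet> d))"
    if "c \<in> carrier_vec K" "d \<in> carrier_vec K" for c d
  proof -
    have "c \<bullet> (A *\<^sub>v d) = c \<bullet> (transpose_mat B *\<^sub>v (B *\<^sub>v d))"
      using B that by (simp add: A_def assoc_mult_mat_vec[of _ K n _ K])
    also have "\<dots> = (\<Sum>i<n. (?F i \<bullet> c) * (B *\<^sub>v d) $ i)"
      unfolding B_def using f that by (intro design_mat_mult_scalar_prod) (auto simp: mult_mat_vec_carrier[of _ n K])
    also have "\<dots> = (\<Sum>i<n. (?F i \<bullet> c) * (?F i \<bullet> d))"
      unfolding B_def using f that by (intro sum.cong refl) (simp add: design_mat_mult del: index_mult_mat_vec)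
    finally show ?thesis .
  qed
  have "Determinant.det A \<noteq> 0"
  proof
    assume "Determinant.det A = 0"
    then obtain c where c: "c \<in> carrier_vec K" "c \<noteq> 0\<^sub>v K" "A *\<^sub>v c = 0\<^sub>v K"
      using det_0_iff_vec_prod_zero[OF A] by auto
    have "c \<bullet> (A *\<^sub>v c) = 0" using c by simp
    then show False using form[OF c(1) c(1)] pos[OF c(1,2)] by (simp add: power2_eq_square)
  qed
  note MP = moore_penrose_right_inverse[OF A this]
  define ch where "ch = (moore_penrose A * transpose_mat B) *\<^sub>v y"
  have ch: "ch \<in> carrier_vec K"
    unfolding ch_def using B MP y by (intro mult_mat_vec_carrier[of _ K n]) auto
  have "A *\<^sub>v ch = (A * (moore_penrose A * transpose_mat B)) *\<^sub>v y"
    unfolding ch_def using A B MP y by (intro assoc_mult_mat_vec[symmetric, of _ K K _ n]) auto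
  also have "A * (moore_penrose A * transpose_mat B) = transpose_mat B"
    using A B MP by (simp add: assoc_mult_mat[of _ K K _ K _ n, symmetric])
  finally have Ach: "A *\<^sub>v ch = transpose_mat B *\<^sub>v y" .
  show ?thesis
  proof (rule that[OF ch])
    show "series_ls K n f xs ys = (\<lambda>x. f x \<bullet> ch)"
      by (simp add: series_ls_def Let_def ch_def A_def B_def y_def fun_eq_iff)
    fix c :: "real Matrix.vec" assume c: "c \<in> carrier_vec K"
    have "(\<Sum>i<n. (?F i \<bullet> c) * (?F i \<bullet> ch)) = c \<bullet> (A *\<^sub>v ch)"
      using form[OF c ch] by simp
    also have "\<dots> = c \<bullet> (transpose_mat B *\<^sub>v y)" by (simp add: Ach)
    also have "\<dots> = (\<Sum>i<n. (?F i \<bullet> c) * y $ i)"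
      unfolding B_def by (rule design_mat_mult_scalar_prod[OF f c y])
    also have "\<dots> = (\<Sum>i<n. (?F i \<bullet> c) * ys (int i + 1))"
      by (intro sum.cong) (auto simp: y_def)
    finally show "(\<Sum>i<n. (?F i \<bullet> c) * (?F i \<bullet> ch)) =
       (\<Sum>i<n. (?F i \<bullet> c) * ys (int i + 1))" .
  qed
qed

lemma scalar_prod_cauchy_schwarz:
  fixes v w :: "real Matrix.vec"
  assumes "v \<in> carrier_vec n" "w \<in> carrier_vec n"
  shows "(v \<bullet> w)\<^sup>2 \<le> (v \<bullet> v) * (w \<bullet> w)"
  using Cauchy_Schwarz_ineq_sum[of "($) v" "($) w" "{..<n}"] assms
  by (simp add: scalar_prod_eq_sum[of _ n] power2_eq_square)

text \<open>
  The difference \<open>d\<close> of the coefficient vectors solves the normal equations for the responses \<open>e = ys - hs\<close>. Tested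
  against \<open>d\<close> itself and written in whitened coordinates \<open>w\<close>, they read \<open>\<Sum>\<^sub>i (w'g\<^sub>i)\<^sup>2 = w'S\<close> with \<open>S = \<Sum>\<^sub>i e\<^sub>i g\<^sub>i\<close>; the lower
  isometry and the Cauchy-Schwarz inequality give \<open>\<kappa> n |w| \<le> |S|\<close>.
\<close>

lemma series_ls_variance_bound:
  assumes f: "\<And>x. f x \<in> carrier_vec K"
    and fR: "\<And>c. c \<in> carrier_vec K \<Longrightarrow> \<exists>w\<in>carrier_vec K. \<forall>x. f x \<bullet> c = g x \<bullet> w"
    and fR0: "\<And>c. c \<in> carrier_vec K \<Longrightarrow> c \<noteq> 0\<^sub>v K \<Longrightarrow> 0 < (\<Sum>i<n. (f (xs (int i + 1)) \<bullet> c)\<^sup>2)"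
    and iso: "\<And>w. w \<in> carrier_vec K \<Longrightarrow> \<kappa> * real n * (w \<bullet> w) \<le> (\<Sum>i<n. (g (xs (int i + 1)) \<bullet> w)\<^sup>2)"
    and \<kappa>: "0 < \<kappa>"
  obtains w where "w \<in> carrier_vec K"
    "\<And>x. series_ls K n f xs ys x - series_ls K n f xs hs x = g x \<bullet> w"
    "(\<kappa> * real n)\<^sup>2 * (w \<bullet> w) \<le> (\<Sum>a<K. (\<Sum>i<n. (ys (int i + 1) - hs (int i + 1)) * g (xs (int i + 1)) $ a)\<^sup>2)"
proof -
  let ?F = "\<lambda>i. f (xs (int i + 1))" and ?G = "\<lambda>i. g (xs (int i + 1))"
  obtain c1 where c1: "c1 \<in> carrier_vec K" "series_ls K n f xs ys = (\<lambda>x. f x \<bullet> c1)"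
    "\<And>c. c \<in> carrier_vec K \<Longrightarrow> (\<Sum>i<n. (?F i \<bullet> c) * (?F i \<bullet> c1)) =
       (\<Sum>i<n. (?F i \<bullet> c) * ys (int i + 1))"
    using series_ls_normal_equations[where f = f and xs = xs, OF f fR0] by blast
  obtain c2 where c2: "c2 \<in> carrier_vec K" "series_ls K n f xs hs = (\<lambda>x. f x \<bullet> c2)"
    "\<And>c. c \<in> carrier_vec K \<Longrightarrow> (\<Sum>i<n. (?F i \<bullet> c) * (?F i \<bullet> c2)) =
       (\<Sum>i<n. (?F i \<bullet> c) * hs (int i + 1))"
    using series_ls_normal_equations[where f = f and xs = xs, OF f fR0] by blast
  define d where "d = c1 - c2"
  have d: "d \<in> carrier_vec K" using c1 c2 by (simp add: d_def)
  have fd: "f x \<bullet> d = f x \<bullet> c1 - f x \<bullet> c2" for x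
    unfolding d_def by (rule scalar_prod_minus_distrib[OF f c1(1) c2(1)])
  obtain w where w: "w \<in> carrier_vec K" "\<And>x. f x \<bullet> d = g x \<bullet> w"
    using fR[OF d] by blast
  define e where "e = (\<lambda>i. ys (int i + 1) - hs (int i + 1))"
  define S where "S = Matrix.vec K (\<lambda>a. \<Sum>i<n. e i * ?G i $ a)"
  have S: "S \<in> carrier_vec K" by (simp add: S_def)
  have "(\<Sum>i<n. (?G i \<bullet> w)\<^sup>2) = (\<Sum>i<n. (?F i \<bullet> d) * (?F i \<bullet> d))"
    by (simp add: w(2) power2_eq_square)
  also have "\<dots> = (\<Sum>i<n. (?F i \<bullet> d) * (?F i \<bullet> c1)) -
      (\<Sum>i<n. (?F i \<bullet> d) * (?F i \<bullet> c2))"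
    unfolding sum_subtractf[symmetric] right_diff_distrib[symmetric] fd[symmetric] ..
  also have "\<dots> = (\<Sum>i<n. (?F i \<bullet> d) * e i)"
    unfolding c1(3)[OF d] c2(3)[OF d] e_def by (simp add: sum_subtractf right_diff_distrib)
  also have "\<dots> = (\<Sum>i<n. (\<Sum>a<K. ?G i $ a * w $ a) * e i)"
    using w(1) by (simp add: w(2) scalar_prod_eq_sum[of _ K])
  also have "\<dots> = S \<bullet> w"
  proof -
    have "S \<bullet> w = (\<Sum>a<K. \<Sum>i<n. e i * ?G i $ a * w $ a)"
      using w(1) by (simp add: scalar_prod_eq_sum[of _ K] S_def sum_distrib_right)
    also have "\<dots> = (\<Sum>i<n. (\<Sum>a<K. ?G i $ a * w $ a) * e i)"
      by (subst sum.swap) (simp add: sum_distrib_left sum_distrib_right mult_ac)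
    finally show ?thesis by simp
  qed
  finally have le: "\<kappa> * real n * (w \<bullet> w) \<le> S \<bullet> w" using iso[OF w(1)] by simp
  have ww: "0 \<le> w \<bullet> w" by (rule scalar_prod_self_nonneg)
  have "(\<kappa> * real n)\<^sup>2 * (w \<bullet> w) \<le> S \<bullet> S"
  proof (cases "w \<bullet> w = 0")
    case True
    then show ?thesis using scalar_prod_self_nonneg[of S] by simp
  next
    case False
    have "(\<kappa> * real n * (w \<bullet> w))\<^sup>2 \<le> (S \<bullet> w)\<^sup>2"
      using le \<kappa> ww by (intro power_mono) auto
    also have "\<dots> \<le> (S \<bullet> S) * (w \<bullet> w)" by (rule scalar_prod_cauchy_schwarz[OF S w(1)])
    finally have "((\<kappa> * real n)\<^sup>2 * (w \<bullet> w)) * (w \<bullet> w) \<le> (S \<bullet> S) * (w \<bullet> w)"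
      by (simp add: power2_eq_square mult_ac)
    then show ?thesis using False ww by (simp add: mult_le_cancel_right)
  qed
  also have "S \<bullet> S = (\<Sum>a<K. (\<Sum>i<n. e i * ?G i $ a)\<^sup>2)"
    using S by (simp add: scalar_prod_eq_sum[of _ K] S_def power2_eq_square)
  finally show ?thesis
    using w c1(2) c2(2) fd by (intro that[OF w(1)]) (auto simp: e_def)
qed

text \<open>
  The fitted values are the orthogonal projection of the responses in the empirical inner product, so the fit of
  the residual \<open>r = hs - c0'f\<close> is no longer than \<open>r\<close>.
\<close>

lemma series_ls_bias_bound:
  assumes f: "\<And>x. f x \<in> carrier_vec K"
    and fR: "\<And>c. c \<in> carrier_vec K \<Longrightarrow> \<exists>w\<in>carrier_vec K. \<forall>x. f x \<bullet> c = g x \<bullet> w"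
    and fR0: "\<And>c. c \<in> carrier_vec K \<Longrightarrow> c \<noteq> 0\<^sub>v K \<Longrightarrow> 0 < (\<Sum>i<n. (f (xs (int i + 1)) \<bullet> c)\<^sup>2)"
    and iso: "\<And>w. w \<in> carrier_vec K \<Longrightarrow> \<kappa> * real n * (w \<bullet> w) \<le> (\<Sum>i<n. (g (xs (int i + 1)) \<bullet> w)\<^sup>2)"
    and c0: "c0 \<in> carrier_vec K"
  obtains w where "w \<in> carrier_vec K"
    "\<And>x. series_ls K n f xs hs x - f x \<bullet> c0 = g x \<bullet> w"
    "\<kappa> * real n * (w \<bullet> w) \<le> (\<Sum>i<n. (hs (int i + 1) - f (xs (int i + 1)) \<bullet> c0)\<^sup>2)"
proof -
  let ?F = "\<lambda>i. f (xs (int i + 1))"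
  obtain c2 where c2: "c2 \<in> carrier_vec K" "series_ls K n f xs hs = (\<lambda>x. f x \<bullet> c2)"
    "\<And>c. c \<in> carrier_vec K \<Longrightarrow> (\<Sum>i<n. (?F i \<bullet> c) * (?F i \<bullet> c2)) =
       (\<Sum>i<n. (?F i \<bullet> c) * hs (int i + 1))"
    using series_ls_normal_equations[where f = f and xs = xs, OF f fR0] by blast
  define d where "d = c2 - c0"
  have d: "d \<in> carrier_vec K" using c0 c2 by (simp add: d_def)
  have fd: "f x \<bullet> d = f x \<bullet> c2 - f x \<bullet> c0" for x
    unfolding d_def by (rule scalar_prod_minus_distrib[OF f c2(1) c0])
  obtain w where w: "w \<in> carrier_vec K" "\<And>x. f x \<bullet> d = g x \<bullet> w"
    using fR[OF d] by blast
  define r where "r = (\<lambda>i. hs (int i + 1) - ?F i \<bullet> c0)"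
  define s where "s = (\<lambda>i. ?F i \<bullet> d)"
  have "(\<Sum>i<n. s i * s i) = (\<Sum>i<n. s i * (?F i \<bullet> c2)) - (\<Sum>i<n. s i * (?F i \<bullet> c0))"
    unfolding sum_subtractf[symmetric] right_diff_distrib[symmetric] fd[symmetric] s_def ..
  also have "\<dots> = (\<Sum>i<n. s i * r i)"
    unfolding s_def c2(3)[OF d] r_def by (simp add: sum_subtractf right_diff_distrib)
  finally have orth: "(\<Sum>i<n. s i * s i) = (\<Sum>i<n. s i * r i)" .
  have "(\<Sum>i<n. (s i)\<^sup>2) + (\<Sum>i<n. (r i - s i)\<^sup>2) = (\<Sum>i<n. (r i)\<^sup>2) + 2 * ((\<Sum>i<n. s i * s i) - (\<Sum>i<n. s i * r i))"
    unfolding sum_subtractf[symmetric] sum_distrib_left sum.distrib[symmetric]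
    by (intro sum.cong refl) (simp add: power2_eq_square algebra_simps)
  then have "(\<Sum>i<n. (s i)\<^sup>2) \<le> (\<Sum>i<n. (r i)\<^sup>2)"
    using orth sum_nonneg[of "{..<n}" "\<lambda>i. (r i - s i)\<^sup>2"] by simp
  then have "\<kappa> * real n * (w \<bullet> w) \<le> (\<Sum>i<n. (r i)\<^sup>2)"
    using iso[OF w(1)] by (simp add: s_def w(2))
  then show ?thesis using w c2(2) fd by (intro that[OF w(1)]) (auto simp: r_def)
qed

section \<open>Spectral norm, stationarity and stochastic order\<close>

lemma lambda_min_quadratic_form:
  fixes A :: "real Matrix.mat"
  assumes A: "A \<in> carrier_mat n n" "transpose_mat A = A" and v: "v \<in> carrier_vec n"
  shows "lambda_min A * (v \<bullet> v) \<le> v \<bullet> (A *\<^sub>v v)"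
proof -
  obtain u d where ev: "orthonormal_eigenbasis n A u d"
    using symmetric_mat_orthonormal_eigenbasis[OF A] .
  have "lambda_min A * (v \<bullet> v) = (\<Sum>i<n. lambda_min A * ((u i \<bullet> v) * (u i \<bullet> v)))"
    by (simp add: orthonormal_basis_parseval[OF ev v v] sum_distrib_left)
  also have "\<dots> \<le> (\<Sum>i<n. d i * ((u i \<bullet> v) * (u i \<bullet> v)))"
    using lambda_min_orthonormal_eigenbasis[OF ev A] by (intro sum_mono mult_right_mono) auto
  also have "\<dots> = v \<bullet> (A *\<^sub>v v)"
    using scalar_prod_pow_eigenbasis[OF ev A v v, of 1] A by simp
  finally show ?thesis .
qed

text \<open>
  Shows that the supremum defining the spectral norm is over a bounded set.
\<close>

lemma mult_mat_vec_norm_bound: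
  fixes A :: "real Matrix.mat"
  assumes A: "A \<in> carrier_mat m n" and v: "v \<in> carrier_vec n"
  shows "(A *\<^sub>v v) \<bullet> (A *\<^sub>v v) \<le> (\<Sum>i<m. Matrix.row A i \<bullet> Matrix.row A i) * (v \<bullet> v)"
proof -
  have "A *\<^sub>v v \<in> carrier_vec m" using A v by simp
  then have "(A *\<^sub>v v) \<bullet> (A *\<^sub>v v) = (\<Sum>i<m. (Matrix.row A i \<bullet> v)\<^sup>2)"
    using A by (simp add: scalar_prod_eq_sum[of _ m] power2_eq_square)
  also have "\<dots> \<le> (\<Sum>i<m. (Matrix.row A i \<bullet> Matrix.row A i) * (v \<bullet> v))"
    using A v by (intro sum_mono scalar_prod_cauchy_schwarz[of _ n]) auto
  finally show ?thesis by (simp add: sum_distrib_right)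
qed

lemma eucl_norm_mult_le_spectral_norm:
  assumes A: "A \<in> carrier_mat m n" and v: "v \<in> carrier_vec n"
  shows "eucl_norm (A *\<^sub>v v) \<le> spectral_norm A * eucl_norm v"
proof (cases "v \<bullet> v = 0")
  case True
  then have "v = 0\<^sub>v n" by (rule scalar_prod_self_eq_0[OF v])
  then have "A *\<^sub>v v = 0\<^sub>v m" using A by (intro eq_vecI) auto
  then show ?thesis using True by (simp add: eucl_norm_def)
next
  case False
  then have pos: "0 < v \<bullet> v" using scalar_prod_self_nonneg[of v] by simp
  define s where "s = 1 / eucl_norm v"
  have s: "0 < s" using pos by (simp add: s_def eucl_norm_def)
  have en_smult: "eucl_norm (s \<cdot>\<^sub>v w) = s * eucl_norm w" for w
  proof -
    have "(s \<cdot>\<^sub>v w) \<bullet> (s \<cdot>\<^sub>v w) = s\<^sup>2 * (w \<bullet> w)"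
      by (simp add: scalar_prod_def sum_distrib_left power2_eq_square mult_ac)
    then show ?thesis using s by (simp add: eucl_norm_def real_sqrt_mult)
  qed
  have bdd: "bdd_above ((\<lambda>v. eucl_norm (A *\<^sub>v v)) ` {v \<in> carrier_vec (dim_col A). eucl_norm v \<le> 1})"
  proof (rule bdd_aboveI2)
    fix w :: "real Matrix.vec" assume "w \<in> {v \<in> carrier_vec (dim_col A). eucl_norm v \<le> 1}"
    then have w: "w \<in> carrier_vec n" "w \<bullet> w \<le> 1" using A by (auto simp: eucl_norm_def)
    have "(A *\<^sub>v w) \<bullet> (A *\<^sub>v w) \<le> (\<Sum>i<m. Matrix.row A i \<bullet> Matrix.row A i) * (w \<bullet> w)"
      by (rule mult_mat_vec_norm_bound[OF A w(1)])
    also have "\<dots> \<le> (\<Sum>i<m. Matrix.row A i \<bullet> Matrix.row A i) * 1"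
      using w by (intro mult_left_mono sum_nonneg scalar_prod_self_nonneg) auto
    finally show "eucl_norm (A *\<^sub>v w) \<le> sqrt (\<Sum>i<m. Matrix.row A i \<bullet> Matrix.row A i)"
      by (simp add: eucl_norm_def)
  qed
  have "eucl_norm (A *\<^sub>v (s \<cdot>\<^sub>v v)) \<le> spectral_norm A"
    unfolding spectral_norm_def
  proof (rule cSUP_upper[OF _ bdd])
    have "eucl_norm (s \<cdot>\<^sub>v v) = 1" using s by (simp add: en_smult) (simp add: s_def)
    then show "s \<cdot>\<^sub>v v \<in> {v \<in> carrier_vec (dim_col A). eucl_norm v \<le> 1}" using A v by simp
  qed
  also have "A *\<^sub>v (s \<cdot>\<^sub>v v) = s \<cdot>\<^sub>v (A *\<^sub>v v)" by (rule mult_mat_vec[OF A v])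
  finally have "s * eucl_norm (A *\<^sub>v v) \<le> spectral_norm A" by (simp add: en_smult)
  then show ?thesis using pos by (simp add: s_def field_simps eucl_norm_def)
qed

lemma smult_mat_mult_vec:
  fixes C :: "real Matrix.mat"
  assumes "C \<in> carrier_mat m n" "w \<in> carrier_vec n"
  shows "(s \<cdot>\<^sub>m C) *\<^sub>v w = s \<cdot>\<^sub>v (C *\<^sub>v w)"
  using assms by (intro eq_vecI) (auto simp: row_smult)

lemma spectral_norm_near_identity:
  fixes f :: "'a \<Rightarrow> real Matrix.vec" and xs :: "int \<Rightarrow> 'a"
  assumes f: "\<And>x. f x \<in> carrier_vec K" and w: "w \<in> carrier_vec K" and n: "0 < n"
  defines "B \<equiv> design_mat K n f xs"
  shows "(1 - spectral_norm ((1 / real n) \<cdot>\<^sub>m (transpose_mat B * B) - 1\<^sub>m K)) * real n * (w \<bullet> w)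
     \<le> (\<Sum>i<n. (f (xs (int i + 1)) \<bullet> w)\<^sup>2)"
proof -
  let ?F = "\<lambda>i. f (xs (int i + 1))"
  have B: "B \<in> carrier_mat n K" "transpose_mat B * B \<in> carrier_mat K K" by (auto simp: B_def intro!: mult_carrier_mat[of _ K n])
  define E where "E = (1 / real n) \<cdot>\<^sub>m (transpose_mat B * B) - 1\<^sub>m K"
  have E: "E \<in> carrier_mat K K" unfolding E_def by (intro minus_carrier_mat one_carrier_mat)
  have Ew: "E *\<^sub>v w \<in> carrier_vec K" using E w by simp
  have Bw: "B *\<^sub>v w \<in> carrier_vec n" using B w by simp
  have BBw: "transpose_mat B *\<^sub>v (B *\<^sub>v w) \<in> carrier_vec K"
    using B Bw by (intro mult_mat_vec_carrier[of _ K n]) auto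
  have "E *\<^sub>v w = (1 / real n) \<cdot>\<^sub>v (transpose_mat B *\<^sub>v (B *\<^sub>v w)) - w"
  proof -
    have "E *\<^sub>v w = ((1 / real n) \<cdot>\<^sub>m (transpose_mat B * B)) *\<^sub>v w - 1\<^sub>m K *\<^sub>v w"
      unfolding E_def using B w by (intro minus_mult_distrib_mat_vec[of _ K K]) auto
    also have "((1 / real n) \<cdot>\<^sub>m (transpose_mat B * B)) *\<^sub>v w = (1 / real n) \<cdot>\<^sub>v ((transpose_mat B * B) *\<^sub>v w)"
      by (rule smult_mat_mult_vec[OF B(2) w])
    also have "(transpose_mat B * B) *\<^sub>v w = transpose_mat B *\<^sub>v (B *\<^sub>v w)"
      using B w by (intro assoc_mult_mat_vec[of _ K n _ K]) auto
    finally show ?thesis using w by simp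
  qed
  then have "w \<bullet> (E *\<^sub>v w) = (1 / real n) * (w \<bullet> (transpose_mat B *\<^sub>v (B *\<^sub>v w))) - w \<bullet> w"
    using w BBw by (simp add: scalar_prod_minus_distrib[of _ K])
  also have "w \<bullet> (transpose_mat B *\<^sub>v (B *\<^sub>v w)) = (\<Sum>i<n. (?F i \<bullet> w) * (B *\<^sub>v w) $ i)"
    unfolding B_def using Bw by (intro design_mat_mult_scalar_prod f w) (simp add: B_def)
  also have "\<dots> = (\<Sum>i<n. (?F i \<bullet> w)\<^sup>2)"
    unfolding B_def using f w
    by (intro sum.cong refl) (simp add: design_mat_mult power2_eq_square del: index_mult_mat_vec)
  finally have wEw: "w \<bullet> (E *\<^sub>v w) = (1 / real n) * (\<Sum>i<n. (?F i \<bullet> w)\<^sup>2) - w \<bullet> w" .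
  have "\<bar>w \<bullet> (E *\<^sub>v w)\<bar> \<le> eucl_norm w * eucl_norm (E *\<^sub>v w)"
  proof -
    have "\<bar>w \<bullet> (E *\<^sub>v w)\<bar> = sqrt ((w \<bullet> (E *\<^sub>v w))\<^sup>2)" by simp
    also have "\<dots> \<le> sqrt ((w \<bullet> w) * ((E *\<^sub>v w) \<bullet> (E *\<^sub>v w)))"
      by (intro real_sqrt_le_mono scalar_prod_cauchy_schwarz[OF w Ew])
    finally show ?thesis by (simp add: eucl_norm_def real_sqrt_mult)
  qed
  also have "\<dots> \<le> eucl_norm w * (spectral_norm E * eucl_norm w)"
    by (intro mult_left_mono eucl_norm_mult_le_spectral_norm[OF E w])
      (simp add: eucl_norm_def scalar_prod_self_nonneg)
  also have "\<dots> = spectral_norm E * (w \<bullet> w)"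
    using scalar_prod_self_nonneg[of w] by (simp add: eucl_norm_def)
  finally have "- (spectral_norm E * (w \<bullet> w)) \<le> (1 / real n) * (\<Sum>i<n. (?F i \<bullet> w)\<^sup>2) - w \<bullet> w"
    unfolding wEw by linarith
  then have "(1 - spectral_norm E) * (w \<bullet> w) \<le> (1 / real n) * (\<Sum>i<n. (?F i \<bullet> w)\<^sup>2)"
    unfolding left_diff_distrib mult_1 by linarith
  then have "real n * ((1 - spectral_norm E) * (w \<bullet> w)) \<le>
      real n * ((1 / real n) * (\<Sum>i<n. (?F i \<bullet> w)\<^sup>2))"
    by (rule mult_left_mono) simp
  also have "\<dots> = (\<Sum>i<n. (?F i \<bullet> w)\<^sup>2)" using n by simp
  also have "real n * ((1 - spectral_norm E) * (w \<bullet> w)) = (1 - spectral_norm E) * real n * (w \<bullet> w)"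
    by (simp only: mult_ac)
  finally show ?thesis by (simp only: E_def)
qed

lemma integrable_mult_of_squares:
  fixes f g :: "'b \<Rightarrow> real"
  assumes "f \<in> borel_measurable M" "g \<in> borel_measurable M"
    and "integrable M (\<lambda>x. (f x)\<^sup>2)" "integrable M (\<lambda>x. (g x)\<^sup>2)"
  shows "integrable M (\<lambda>x. f x * g x)"
proof (rule Bochner_Integration.integrable_bound)
  show "integrable M (\<lambda>x. (f x)\<^sup>2 + (g x)\<^sup>2)" using assms by simp
  show "(\<lambda>x. f x * g x) \<in> borel_measurable M" using assms by simp
  have "\<bar>a * b\<bar> \<le> a\<^sup>2 + b\<^sup>2" for a b :: real
  proof -
    have "2 * (\<bar>a\<bar> * \<bar>b\<bar>) \<le> a\<^sup>2 + b\<^sup>2" using sum_squares_bound[of "\<bar>a\<bar>" "\<bar>b\<bar>"] by simp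
    moreover have "0 \<le> \<bar>a\<bar> * \<bar>b\<bar>" by simp
    ultimately show ?thesis unfolding abs_mult by linarith
  qed
  then show "AE x in M. norm (f x * g x) \<le> norm ((f x)\<^sup>2 + (g x)\<^sup>2)" by simp
qed

lemma strictly_stationary_distr:
  assumes st: "strictly_stationary M N UNIV X"
  shows "distr M N (X i) = distr M N (X 1)"
proof -
  have X: "X j \<in> measurable M N" for j using st by (auto simp: strictly_stationary_def)
  have comp: "distr (distr M (Pi\<^sub>M {1::int} (\<lambda>_. N)) (\<lambda>\<omega>. \<lambda>j\<in>{1}. X (j + k) \<omega>)) N (\<lambda>x. x 1) = distr M N (X (1 + k))" for k
  proof -
    have "(\<lambda>\<omega>. \<lambda>j\<in>{1}. X (j + k) \<omega>) \<in> measurable M (Pi\<^sub>M {1::int} (\<lambda>_. N))"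
      using X by (intro measurable_restrict) auto
    then show ?thesis
      by (subst distr_distr) (auto simp: comp_def)
  qed
  have "distr M (Pi\<^sub>M {1} (\<lambda>_. N)) (\<lambda>\<omega>. \<lambda>j\<in>{1}. X (j + (i - 1)) \<omega>) =
        distr M (Pi\<^sub>M {1} (\<lambda>_. N)) (\<lambda>\<omega>. \<lambda>j\<in>{1}. X j \<omega>)"
    using st by (auto simp: strictly_stationary_def)
  then show ?thesis using comp[of "i - 1"] comp[of 0] by simp
qed

context prob_space
begin

text \<open>
  Markov's inequality, except that the level \<open>m / \<eta>\<close> itself is not exceptional. Thus \<open>m = 0\<close> is covered, where \<open>T\<close> vanishes
  almost surely; this happens when \<open>h\<^sub>0\<close> lies in the sieve space.
\<close>

lemma markov_cover:
  assumes T: "integrable M T" "\<And>\<omega>. \<omega> \<in> space M \<Longrightarrow> 0 \<le> T \<omega>" and E: "expectation T \<le> m" and \<eta>: "0 < \<eta>"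
  obtains B where "B \<in> events" "prob B \<le> \<eta>" "\<And>\<omega>. \<omega> \<in> space M - B \<Longrightarrow> T \<omega> \<le> m / \<eta>"
proof -
  have ET: "0 \<le> expectation T" using T(2) by (intro integral_nonneg_AE AE_I2) auto
  then have m: "0 \<le> m" using E by simp
  have meas [measurable]: "T \<in> borel_measurable M" using T(1) by simp
  show ?thesis
  proof (cases "m = 0")
    case True
    have "expectation T = 0" using E ET True by simp
    then have "AE \<omega> in M. T \<omega> = 0"
      using integral_nonneg_eq_0_iff_AE[OF T(1)] T(2) by (auto intro: AE_I2)
    then have ae: "AE \<omega> in M. \<not> 0 < T \<omega>" by auto
    have ev: "{\<omega>\<in>space M. 0 < T \<omega>} \<in> events" by measurable
    show ?thesis
    proof (rule that[OF ev])
      have "prob {\<omega>\<in>space M. 0 < T \<omega>} = 0"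
        using ae ev by (subst prob_eq_0) auto
      then show "prob {\<omega>\<in>space M. 0 < T \<omega>} \<le> \<eta>" using \<eta> by simp
    qed (use True in auto)
  next
    case False
    then have m: "0 < m" using m by simp
    have ev: "{\<omega>\<in>space M. m / \<eta> \<le> T \<omega>} \<in> events" by measurable
    show ?thesis
    proof (rule that[OF ev])
      have "prob {\<omega>\<in>space M. m / \<eta> \<le> T \<omega>} \<le> expectation T / (m / \<eta>)"
        using T m \<eta> by (intro integral_Markov_inequality_measure[where A = "{}"]) auto
      also have "\<dots> \<le> m / (m / \<eta>)" using E m \<eta> by (intro divide_right_mono) auto
      finally show "prob {\<omega>\<in>space M. m / \<eta> \<le> T \<omega>} \<le> \<eta>" using m by simp
    qed auto
  qed
qed

text \<open>
  Exceptional sets need not be measurable, and outer probabilities are handled through measurable sets that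
  contain them.
\<close>

lemma bigO_pI:
  assumes A: "\<And>\<eta>. 0 < \<eta> \<Longrightarrow> 0 < A \<eta>"
    and "\<And>\<eta>. 0 < \<eta> \<Longrightarrow> \<forall>\<^sub>F n in sequentially. \<exists>B\<in>events. prob B < \<eta> \<and>
     (\<forall>\<omega>\<in>space M - B. \<bar>Z n \<omega>\<bar> \<le> A \<eta> * a n)"
  shows "bigO_p M Z a"
  unfolding bigO_p_def
proof (intro allI impI exI conjI)
  fix \<eta> :: real assume \<eta>: "0 < \<eta>"
  show "0 < A \<eta>" using A[OF \<eta>] .
  show "\<forall>\<^sub>F n in sequentially. outer_measure_of M {\<omega> \<in> space M. \<bar>Z n \<omega>\<bar> > A \<eta> * a n} < ennreal \<eta>"
    using assms(2)[OF \<eta>]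
  proof eventually_elim
    case (elim n)
    then obtain B where B: "B \<in> events" "prob B < \<eta>" "\<forall>\<omega>\<in>space M - B. \<bar>Z n \<omega>\<bar> \<le> A \<eta> * a n" by blast
    have "outer_measure_of M {\<omega> \<in> space M. \<bar>Z n \<omega>\<bar> > A \<eta> * a n} \<le> outer_measure_of M B"
      using B(3) by (intro outer_measure_of_mono) (auto simp: not_le[symmetric])
    also have "\<dots> = ennreal (prob B)" using B(1) by (simp add: emeasure_eq_measure)
    also have "\<dots> < ennreal \<eta>" using B(2) \<eta> by (intro ennreal_lessI) auto
    finally show ?case .
  qed
qed

lemma smallo_p_cover:
  assumes "smallo_p M Z (\<lambda>_. 1)" "0 < \<delta>" "0 < \<eta>"
  shows "\<forall>\<^sub>F n in sequentially. \<exists>B\<in>events. prob B < \<eta> \<and> (\<forall>\<omega>\<in>space M - B. \<bar>Z n \<omega>\<bar> \<le> \<delta>)"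
proof -
  have "(\<lambda>n. outer_measure_of M {\<omega> \<in> space M. \<bar>Z n \<omega>\<bar> > \<delta>}) \<longlonglongrightarrow> 0"
    using assms by (simp add: smallo_p_def)
  then have "\<forall>\<^sub>F n in sequentially. outer_measure_of M {\<omega> \<in> space M. \<bar>Z n \<omega>\<bar> > \<delta>} < ennreal \<eta>"
    using assms(3) by (auto simp: order_tendsto_iff)
  then show ?thesis
  proof eventually_elim
    case (elim n)
    then obtain B where B: "B \<in> events" "{\<omega> \<in> space M. \<bar>Z n \<omega>\<bar> > \<delta>} \<subseteq> B" "emeasure M B < ennreal \<eta>"
      unfolding outer_measure_of_def by (auto simp: INF_less_iff)
    have "prob B < \<eta>" using B(3) assms(3) by (simp add: emeasure_eq_measure ennreal_less_iff)
    then show ?case using B(1,2) by (intro bexI[of _ B]) (auto simp: not_less[symmetric])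
  qed
qed

text \<open>
  \<open>\<phi>(X\<^sub>i)\<close> is known at time \<open>i - 1\<close>. Therefore the summands are orthogonal, the later innovation having conditional mean
  zero, and each contributes at most \<open>C E[\<phi>(X\<^sub>1)\<^sup>2]\<close> by the bound on the conditional variance and stationarity.
\<close>

lemma martingale_noise_second_moment:
  fixes X :: "int \<Rightarrow> 'a \<Rightarrow> 'b" and \<epsilon> :: "int \<Rightarrow> 'a \<Rightarrow> real" and \<phi> :: "'b \<Rightarrow> real"
  assumes st: "strictly_stationary M N UNIV X"
    and mds: "martingale_difference M (past_algebra M N X \<epsilon>) {1..} \<epsilon>"
    and var: "\<And>i. i \<ge> 1 \<Longrightarrow> AE \<omega> in M.
      nn_cond_exp M (past_algebra M N X \<epsilon> (i - 1)) (\<lambda>\<omega>. ennreal ((\<epsilon> i \<omega>)\<^sup>2)) \<omega> \<le> ennreal C"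
    and C: "0 \<le> C"
    and \<phi>: "\<phi> \<in> borel_measurable N" "integrable (distr M N (X 1)) (\<lambda>x. (\<phi> x)\<^sup>2)"
  shows "integrable M (\<lambda>\<omega>. (\<Sum>i<n. \<epsilon> (int i + 1) \<omega> * \<phi> (X (int i + 1) \<omega>))\<^sup>2)" (is "integrable M ?S")
    and "expectation (\<lambda>\<omega>. (\<Sum>i<n. \<epsilon> (int i + 1) \<omega> * \<phi> (X (int i + 1) \<omega>))\<^sup>2)
      \<le> C * real n * (\<integral>x. (\<phi> x)\<^sup>2 \<partial>distr M N (X 1))"
proof -
  define F where "F = past_algebra M N X \<epsilon>"
  define m where "m = (\<integral>x. (\<phi> x)\<^sup>2 \<partial>distr M N (X 1))"
  define h where "h = (\<lambda>i \<omega>. \<epsilon> i \<omega> * \<phi> (X i \<omega>))"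
  have X [measurable]: "X j \<in> measurable M N" for j using st by (auto simp: strictly_stationary_def)
  note [measurable] = \<phi>(1)
  have sub: "subalgebra M (F i)" for i using mds by (auto simp: martingale_difference_def F_def)
  have F_mono: "sets (F i) \<subseteq> sets (F j)" if "i \<le> j" for i j
    using mds that by (auto simp: martingale_difference_def F_def)
  have F_space: "space (F i) = space M" for i using sub[of i] by (simp add: subalgebra_def)
  have F_lift: "f \<in> measurable (F j) L" if "f \<in> measurable (F i) L" "i \<le> j" for i j f and L :: "'c measure"
    using that F_mono[OF that(2)] F_space by (auto simp: measurable_def)
  have eps_F: "\<epsilon> i \<in> borel_measurable (F i)" if "1 \<le> i" for i
    using mds that by (auto simp: martingale_difference_def F_def)
  have eps_M [measurable]: "\<epsilon> i \<in> borel_measurable M" if "1 \<le> i" for i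
    using measurable_from_subalg[OF sub eps_F[OF that]] .
  have X_F: "X i \<in> measurable (F (i - 1)) N" for i
  proof (rule measurableI)
    fix \<omega> assume "\<omega> \<in> space (F (i - 1))"
    then show "X i \<omega> \<in> space N" using measurable_space[OF X] by (simp add: F_space)
  next
    fix A assume A: "A \<in> sets N"
    define G where "G = {X j -` A \<inter> space M | j A. j \<le> i - 1 + 1 \<and> A \<in> sets N} \<union>
      {\<epsilon> j -` A \<inter> space M | j A. j \<le> i - 1 \<and> A \<in> sets borel}"
    have "G \<subseteq> Pow (space M)" by (auto simp: G_def)
    then have "sets (F (i - 1)) = sigma_sets (space M) G"
      by (simp add: F_def past_algebra_def G_def sets_measure_of)
    moreover have "X i -` A \<inter> space M \<in> G" unfolding G_def using A by auto
    ultimately show "X i -` A \<inter> space (F (i - 1)) \<in> sets (F (i - 1))"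
      by (simp add: F_space sigma_sets.Basic)
  qed
  have fin: "finite_measure_subalgebra M (F i)" for i
    using sub by (simp add: finite_measure_subalgebra_def finite_measure_subalgebra_axioms_def finite_measure_axioms)
  have m_nn: "(\<integral>\<^sup>+ \<omega>. ennreal ((\<phi> (X i \<omega>))\<^sup>2) \<partial>M) = ennreal m" for i
  proof -
    have "(\<integral>\<^sup>+ \<omega>. ennreal ((\<phi> (X i \<omega>))\<^sup>2) \<partial>M) = (\<integral>\<^sup>+ x. ennreal ((\<phi> x)\<^sup>2) \<partial>distr M N (X i))"
      by (subst nn_integral_distr) auto
    also have "\<dots> = ennreal m"
      unfolding strictly_stationary_distr[OF st, of i] m_def using \<phi>(2) by (intro nn_integral_eq_integral) auto
    finally show ?thesis .
  qed
  have m: "0 \<le> m" by (simp add: m_def)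
  have h_nn: "(\<integral>\<^sup>+ \<omega>. ennreal ((h i \<omega>)\<^sup>2) \<partial>M) \<le> ennreal (C * m)" if i: "1 \<le> i" for i
  proof -
    interpret finite_measure_subalgebra M "F (i - 1)" by (rule fin)
    have e [measurable]: "\<epsilon> i \<in> borel_measurable M" using eps_M[OF i] .
    have "(\<integral>\<^sup>+ \<omega>. ennreal ((h i \<omega>)\<^sup>2) \<partial>M) = (\<integral>\<^sup>+ \<omega>. ennreal ((\<phi> (X i \<omega>))\<^sup>2) * ennreal ((\<epsilon> i \<omega>)\<^sup>2) \<partial>M)"
      by (intro nn_integral_cong) (simp add: h_def power_mult_distrib ennreal_mult' mult.commute)
    also have "\<dots> = (\<integral>\<^sup>+ \<omega>. ennreal ((\<phi> (X i \<omega>))\<^sup>2) * nn_cond_exp M (F (i - 1)) (\<lambda>\<omega>. ennreal ((\<epsilon> i \<omega>)\<^sup>2)) \<omega> \<partial>M)"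
    proof (rule nn_cond_exp_intg[symmetric])
      have "(\<lambda>\<omega>. \<phi> (X i \<omega>)) \<in> borel_measurable (F (i - 1))"
        by (rule measurable_compose[OF X_F \<phi>(1)])
      then show "(\<lambda>\<omega>. ennreal ((\<phi> (X i \<omega>))\<^sup>2)) \<in> borel_measurable (F (i - 1))" by simp
      show "(\<lambda>\<omega>. ennreal ((\<epsilon> i \<omega>)\<^sup>2)) \<in> borel_measurable M" using e by simp
    qed
    also have "\<dots> \<le> (\<integral>\<^sup>+ \<omega>. ennreal ((\<phi> (X i \<omega>))\<^sup>2) * ennreal C \<partial>M)"
      using var[OF i] by (intro nn_integral_mono_AE) (auto simp: F_def intro!: mult_left_mono)
    also have "\<dots> = ennreal m * ennreal C"
      by (subst nn_integral_multc) (auto simp: m_nn)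
    finally show ?thesis using C m by (simp add: ennreal_mult' mult.commute)
  qed
  have h_M: "h i \<in> borel_measurable M" if "1 \<le> i" for i
    unfolding h_def using eps_M[OF that] by measurable
  have h_int: "integrable M (\<lambda>\<omega>. (h i \<omega>)\<^sup>2)" if "1 \<le> i" for i
    using h_nn[OF that] h_M[OF that] by (intro integrableI_bounded) (auto intro: le_less_trans)
  have h_E: "expectation (\<lambda>\<omega>. (h i \<omega>)\<^sup>2) \<le> C * m" if "1 \<le> i" for i
  proof -
    have "ennreal (expectation (\<lambda>\<omega>. (h i \<omega>)\<^sup>2)) = (\<integral>\<^sup>+ \<omega>. ennreal ((h i \<omega>)\<^sup>2) \<partial>M)"
      by (intro nn_integral_eq_integral[symmetric] h_int that) auto
    then show ?thesis using h_nn[OF that] C m by (metis ennreal_le_iff mult_nonneg_nonneg)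
  qed
  have prod_int: "integrable M (\<lambda>\<omega>. h i \<omega> * h j \<omega>)" if "1 \<le> i" "1 \<le> j" for i j
    using h_M h_int that by (intro integrable_mult_of_squares) auto
  have orth: "expectation (\<lambda>\<omega>. h i \<omega> * h j \<omega>) = 0" if ij: "1 \<le> i" "i < j" for i j
  proof -
    interpret finite_measure_subalgebra M "F (j - 1)" by (rule fin)
    define W where "W = (\<lambda>\<omega>. h i \<omega> * \<phi> (X j \<omega>))"
    have e: "\<epsilon> i \<in> borel_measurable (F (j - 1))" using F_lift[OF eps_F[OF ij(1)], of "j - 1"] ij by simp
    have Xi: "X i \<in> measurable (F (j - 1)) N" using F_lift[OF X_F[of i], of "j - 1"] ij by simp
    have W: "W \<in> borel_measurable (F (j - 1))"
      unfolding W_def h_def using e Xi X_F[of j] by measurable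
    have eq: "h i \<omega> * h j \<omega> = W \<omega> * \<epsilon> j \<omega>" for \<omega> by (simp add: W_def h_def)
    have "integrable M (\<lambda>\<omega>. W \<omega> * \<epsilon> j \<omega>)" using prod_int[of i j] ij unfolding eq by simp
    then have "expectation (\<lambda>\<omega>. W \<omega> * \<epsilon> j \<omega>) = expectation (\<lambda>\<omega>. W \<omega> * real_cond_exp M (F (j - 1)) (\<epsilon> j) \<omega>)"
      using real_cond_exp_intg(2)[OF _ W eps_M[of j]] ij by simp
    also have "\<dots> = expectation (\<lambda>\<omega>. 0)"
    proof (rule integral_cong_AE)
      have "AE \<omega> in M. real_cond_exp M (F (j - 1)) (\<epsilon> j) \<omega> = 0"
        using mds ij by (auto simp: martingale_difference_def F_def)
      then show "AE \<omega> in M. W \<omega> * real_cond_exp M (F (j - 1)) (\<epsilon> j) \<omega> = 0" by auto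
      show "(\<lambda>\<omega>. W \<omega> * real_cond_exp M (F (j - 1)) (\<epsilon> j) \<omega>) \<in> borel_measurable M"
        using measurable_from_subalg[OF sub W] by measurable
    qed simp
    finally show ?thesis unfolding eq by simp
  qed
  have sq: "?S \<omega> = (\<Sum>i<n. \<Sum>j<n. h (int i + 1) \<omega> * h (int j + 1) \<omega>)" for \<omega>
    by (simp add: h_def power2_eq_square sum_product)
  show "integrable M ?S"
    unfolding sq using prod_int by (intro integral_double_sum(1)) auto
  have "expectation ?S = (\<Sum>i<n. \<Sum>j<n. expectation (\<lambda>\<omega>. h (int i + 1) \<omega> * h (int j + 1) \<omega>))"
    unfolding sq using prod_int by (intro integral_double_sum(2)) auto
  also have "\<dots> = (\<Sum>i<n. \<Sum>j<n. if i = j then expectation (\<lambda>\<omega>. (h (int i + 1) \<omega>)\<^sup>2) else 0)"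
  proof (intro sum.cong refl)
    fix i j
    show "expectation (\<lambda>\<omega>. h (int i + 1) \<omega> * h (int j + 1) \<omega>) =
        (if i = j then expectation (\<lambda>\<omega>. (h (int i + 1) \<omega>)\<^sup>2) else 0)"
      using orth[of "int i + 1" "int j + 1"] orth[of "int j + 1" "int i + 1"]
      by (cases i j rule: linorder_cases) (auto simp: power2_eq_square mult.commute)
  qed
  also have "\<dots> = (\<Sum>i<n. expectation (\<lambda>\<omega>. (h (int i + 1) \<omega>)\<^sup>2))" by simp
  also have "\<dots> \<le> (\<Sum>i<n. C * m)" using h_E by (intro sum_mono) auto
  finally show "expectation ?S
      \<le> C * real n * (\<integral>x. (\<phi> x)\<^sup>2 \<partial>distr M N (X 1))"
    by (simp add: m_def mult_ac)
qed

end

section \<open>Whitened sieves\<close>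

lemma isotropic_quadratic_form:
  fixes g :: "'a \<Rightarrow> real Matrix.vec"
  assumes int: "\<And>a b. a < k \<Longrightarrow> b < k \<Longrightarrow> integrable P (\<lambda>x. g x $ a * g x $ b)"
    and iso: "\<And>a b. a < k \<Longrightarrow> b < k \<Longrightarrow> (\<integral>x. g x $ a * g x $ b \<partial>P) = (if a = b then 1 else 0)"
    and w: "w \<in> carrier_vec k"
  shows "integrable P (\<lambda>x. (g x \<bullet> w)\<^sup>2)" "(\<integral>x. (g x \<bullet> w)\<^sup>2 \<partial>P) = w \<bullet> w"
proof -
  have sq: "(g x \<bullet> w)\<^sup>2 = (\<Sum>a<k. \<Sum>b<k. w $ a * w $ b * (g x $ a * g x $ b))" for x
    by (simp add: scalar_prod_eq_sum[OF w] power2_eq_square sum_product mult_ac)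
  have prod: "integrable P (\<lambda>x. w $ a * w $ b * (g x $ a * g x $ b))" if "a < k" "b < k" for a b
    using int that by (intro integrable_mult_right) auto
  show "integrable P (\<lambda>x. (g x \<bullet> w)\<^sup>2)"
    unfolding sq by (rule integral_double_sum(1)) (rule prod)
  have "(\<integral>x. (g x \<bullet> w)\<^sup>2 \<partial>P) = (\<Sum>a<k. \<Sum>b<k. \<integral>x. w $ a * w $ b * (g x $ a * g x $ b) \<partial>P)"
    unfolding sq by (rule integral_double_sum(2)) (rule prod)
  also have "\<dots> = (\<Sum>a<k. \<Sum>b<k. if a = b then w $ a * w $ a else 0)"
    using iso by (intro sum.cong refl) auto
  also have "\<dots> = w \<bullet> w" by (simp add: scalar_prod_eq_sum[OF w])
  finally show "(\<integral>x. (g x \<bullet> w)\<^sup>2 \<partial>P) = w \<bullet> w" .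
qed

lemma sieve_vec_carrier [simp]: "sieve_vec b D k n x \<in> carrier_vec k"
  by (simp add: sieve_vec_def)

text \<open>
  A positive smallest eigenvalue forces positive diagonal entries of the Gram matrix, and these would be 0 for a
  basis function that is not square integrable. This is the source of all integrability; the rest is \<open>R G R = I\<close>.
\<close>

lemma sieve_vec_orth_whitening:
  fixes X :: "int \<Rightarrow> 'w \<Rightarrow> 'a"
  assumes X: "X 1 \<in> measurable M N"
    and meas: "\<And>j. j < k \<Longrightarrow> (\<lambda>x. sieve_vec b D k n x $ j) \<in> borel_measurable N"
    and pos: "lambda_min (gram_mat M X b D k n) > 0"
  defines "f \<equiv> sieve_vec b D k n" and "g \<equiv> sieve_vec_orth M X b D k n"
  shows "\<And>x. g x \<in> carrier_vec k"
    and "\<And>a. a < k \<Longrightarrow> (\<lambda>x. g x $ a) \<in> borel_measurable N"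
    and "\<And>a b. a < k \<Longrightarrow> b < k \<Longrightarrow> integrable (distr M N (X 1)) (\<lambda>x. g x $ a * g x $ b)"
    and "\<And>a b. a < k \<Longrightarrow> b < k \<Longrightarrow> (\<integral>x. g x $ a * g x $ b \<partial>distr M N (X 1)) = (if a = b then 1 else 0)"
    and "\<And>c. c \<in> carrier_vec k \<Longrightarrow> \<exists>w\<in>carrier_vec k. (\<forall>x. f x \<bullet> c = g x \<bullet> w) \<and> (c \<noteq> 0\<^sub>v k \<longrightarrow> w \<noteq> 0\<^sub>v k)"
    and "\<And>x. g x \<bullet> g x \<le> (f x \<bullet> f x) / lambda_min (gram_mat M X b D k n)"
proof -
  define G where "G = gram_mat M X b D k n"
  define R where "R = inv_sqrt_mat G"
  define P where "P = distr M N (X 1)"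
  have f: "f x \<in> carrier_vec k" for x by (simp add: f_def)
  have f_meas: "(\<lambda>x. f x $ j) \<in> borel_measurable N" if "j < k" for j
    using meas[OF that] by (simp add: f_def)
  have G: "G \<in> carrier_mat k k" "transpose_mat G = G"
    by (auto simp: G_def gram_mat_def mult.commute intro!: eq_matI)
  note R = inv_sqrt_mat_props[OF G, folded R_def, OF pos[folded G_def]]
  have Rsym: "R $$ (i, j) = R $$ (j, i)" if "i < k" "j < k" for i j
    using R(1,2) that by (metis carrier_matD index_transpose_mat(1))
  have g_def': "g x = R *\<^sub>v f x" for x by (simp add: g_def sieve_vec_orth_def R_def G_def f_def)
  show g: "g x \<in> carrier_vec k" for x using R(1) f by (simp add: g_def')
  have g_comp: "g x $ a = (\<Sum>j<k. R $$ (a, j) * f x $ j)" if "a < k" for x a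
    using R(1) f[of x] that by (auto simp: g_def' scalar_prod_eq_sum[of _ k] intro!: sum.cong)
  show g_meas: "(\<lambda>x. g x $ a) \<in> borel_measurable N" if "a < k" for a
    using f_meas that unfolding g_comp[OF that] by (intro borel_measurable_sum borel_measurable_times) auto
  have G_entry: "G $$ (i, j) = (\<integral>x. f x $ i * f x $ j \<partial>P)" if "i < k" "j < k" for i j
    using X f_meas that unfolding P_def
    by (subst integral_distr) (auto simp: G_def gram_mat_def f_def)
  have f_sq: "integrable P (\<lambda>x. (f x $ i)\<^sup>2)" if i: "i < k" for i
  proof (rule ccontr)
    assume "\<not> ?thesis"
    then have "G $$ (i, i) = 0"
      using i by (simp add: G_entry power2_eq_square not_integrable_integral_eq)
    moreover have "lambda_min G * (unit_vec k i \<bullet> unit_vec k i) \<le> unit_vec k i \<bullet> (G *\<^sub>v unit_vec k i)"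
      by (rule lambda_min_quadratic_form[OF G]) simp
    ultimately show False using i G pos by (simp add: G_def[symmetric])
  qed
  have f_prod: "integrable P (\<lambda>x. f x $ i * f x $ j)" if "i < k" "j < k" for i j
    using f_meas f_sq that by (intro integrable_mult_of_squares) (auto simp: P_def)
  have g_prod: "g x $ a * g x $ b = (\<Sum>i<k. \<Sum>j<k. R $$ (a, i) * R $$ (b, j) * (f x $ i * f x $ j))"
    if "a < k" "b < k" for a b x
    using that by (simp add: g_comp sum_product mult_ac)
  show "integrable (distr M N (X 1)) (\<lambda>x. g x $ a * g x $ b)" if "a < k" "b < k" for a b
    using f_prod unfolding g_prod[OF that] P_def[symmetric]
    by (intro integral_double_sum(1) integrable_mult_right) auto
  show "(\<integral>x. g x $ a * g x $ b \<partial>distr M N (X 1)) = (if a = b then 1 else 0)" if ab: "a < k" "b < k" for a b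
  proof -
    have "(\<integral>x. g x $ a * g x $ b \<partial>P) = (\<Sum>i<k. \<Sum>j<k. \<integral>x. R $$ (a, i) * R $$ (b, j) * (f x $ i * f x $ j) \<partial>P)"
      unfolding g_prod[OF ab] using f_prod by (intro integral_double_sum(2) integrable_mult_right) auto
    also have "\<dots> = (\<Sum>i<k. \<Sum>j<k. R $$ (a, i) * G $$ (i, j) * R $$ (j, b))"
      using ab by (intro sum.cong refl) (simp add: G_entry Rsym[of b])
    also have "\<dots> = (R * G * R) $$ (a, b)"
    proof -
      have "(R * G * R) $$ (a, b) = (\<Sum>i<k. R $$ (a, i) * (\<Sum>j<k. G $$ (i, j) * R $$ (j, b)))"
        using ab R(1) G(1) by (auto simp: scalar_prod_def atLeast0LessThan intro!: sum.cong)
      also have "\<dots> = (\<Sum>i<k. \<Sum>j<k. R $$ (a, i) * G $$ (i, j) * R $$ (j, b))"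
        by (simp add: sum_distrib_left mult.assoc)
      finally show ?thesis by simp
    qed
    finally show ?thesis using ab by (simp add: R(3) P_def)
  qed
  show "\<exists>w\<in>carrier_vec k. (\<forall>x. f x \<bullet> c = g x \<bullet> w) \<and> (c \<noteq> 0\<^sub>v k \<longrightarrow> w \<noteq> 0\<^sub>v k)" if c: "c \<in> carrier_vec k" for c
  proof -
    obtain w where w: "w \<in> carrier_vec k" "c = R *\<^sub>v w" using R(4)[OF c] by blast
    have "f x \<bullet> c = g x \<bullet> w" for x
      unfolding w(2) g_def' by (rule symmetric_mat_scalar_prod[OF R(1,2) f w(1)])
    moreover have "R *\<^sub>v 0\<^sub>v k = 0\<^sub>v k" using R(1) by (intro eq_vecI) auto
    ultimately show ?thesis using w by auto
  qed
  show "g x \<bullet> g x \<le> (f x \<bullet> f x) / lambda_min (gram_mat M X b D k n)" for x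
    unfolding g_def' G_def[symmetric] by (rule R(5)[OF f])
qed

text \<open>
  The one-sided comparison of empirical and population norms on which both rates rest; 1/32 is what the tail bound
  for independent data delivers with simple constants.
\<close>

definition lower_isometry ::
  "nat \<Rightarrow> nat \<Rightarrow> ('a \<Rightarrow> real Matrix.vec) \<Rightarrow> (int \<Rightarrow> 'a) \<Rightarrow> bool" where
  "lower_isometry k n g xs \<longleftrightarrow> (\<forall>w\<in>carrier_vec k.
     1 / 32 * real n * (w \<bullet> w) \<le> (\<Sum>i<n. (g (xs (int i + 1)) \<bullet> w)\<^sup>2))"

context prob_space
begin

text \<open>
  The tail bound with \<open>p\<close> equal to \<open>ln k\<close> rounded up, \<open>c = 2pL\<close> and \<open>x = n/32 + c\<close>. As \<open>c \<le> n/32\<close>, the base \<open>x/(c + n/2)\<close> is at most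
  \<open>1/8 \<le> e\<^sup>-\<^sup>2\<close>, so the bound is \<open>k e\<^sup>-\<^sup>2\<^sup>p \<le> 1/k\<close>.
\<close>

lemma iid_lower_isometry:
  fixes X :: "int \<Rightarrow> 'a \<Rightarrow> 'b" and g :: "'b \<Rightarrow> real Matrix.vec"
  assumes indep: "indep_vars (\<lambda>_. N) X {1..int n}"
    and distr: "\<And>i. distr M N (X i) = distr M N (X 1)"
    and g_meas: "\<And>a. a < k \<Longrightarrow> (\<lambda>x. g x $ a) \<in> borel_measurable N"
    and carr: "\<And>x. g x \<in> carrier_vec k"
    and L: "\<And>x. x \<in> space N \<Longrightarrow> g x \<bullet> g x \<le> L"
    and iso: "\<And>a b. a < k \<Longrightarrow> b < k \<Longrightarrow> (\<integral>x. g x $ a * g x $ b \<partial>distr M N (X 1)) = (if a = b then 1 else 0)"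
    and k: "3 \<le> k" and n: "0 < n" and small: "128 * L * ln (real k) \<le> real n"
  shows "\<exists>B\<in>events. prob B \<le> 1 / real k \<and> (\<forall>\<omega>\<in>space M - B. lower_isometry k n g (\<lambda>i. X i \<omega>))"
proof -
  define X' where "X' = (\<lambda>s. X (int s + 1))"
  have X: "X i \<in> measurable M N" if "i \<in> {1..int n}" for i
    using indep that unfolding indep_vars_def by auto
  have image: "(\<lambda>s. int s + 1) ` {..<n} = {1..int n}"
  proof (intro equalityI subsetI)
    fix i assume "i \<in> {1..int n}"
    then show "i \<in> (\<lambda>s. int s + 1) ` {..<n}" by (intro image_eqI[of _ _ "nat (i - 1)"]) auto
  qed auto
  have indep': "indep_vars (\<lambda>_. N) X' {..<n}"
    unfolding X'_def using indep image
    by (intro indep_vars_reindex[where e = "\<lambda>s. int s + 1" and M' = "\<lambda>_. N"]) (auto simp: inj_on_def)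
  have X'_meas: "X' s \<in> measurable M N" if "s < n" for s
    unfolding X'_def using that by (intro X) auto
  have g_le: "(g x $ a)\<^sup>2 \<le> L" if "a < k" "x \<in> space N" for x a
  proof -
    have "g x $ a * g x $ a \<le> (\<Sum>a<k. g x $ a * g x $ a)" using that by (intro member_le_sum) auto
    also have "\<dots> \<le> L" using L[OF that(2)] carr[of x] by (simp add: scalar_prod_eq_sum[of _ k])
    finally show ?thesis by (simp add: power2_eq_square)
  qed
  have g_bm: "bdd_measurable N (\<lambda>x. g x $ a)" if "a < k" for a
    unfolding bdd_measurable_def
  proof (intro conjI exI[of _ "sqrt L"] ballI)
    fix x assume "x \<in> space N"
    then show "\<bar>g x $ a\<bar> \<le> sqrt L" using g_le[OF that] by (intro real_le_rsqrt) simp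
  qed (rule g_meas[OF that])
  have iso': "expectation (\<lambda>\<omega>. g (X' s \<omega>) $ a * g (X' s \<omega>) $ b) = (if a = b then 1 else 0)"
    if "s < n" "a < k" "b < k" for s a b
  proof -
    have "expectation (\<lambda>\<omega>. g (X' s \<omega>) $ a * g (X' s \<omega>) $ b) = (\<integral>x. g x $ a * g x $ b \<partial>distr M N (X' s))"
      using X'_meas that g_meas by (subst integral_distr) auto
    also have "distr M N (X' s) = distr M N (X 1)" unfolding X'_def by (rule distr)
    finally show ?thesis using iso that by simp
  qed
  \<comment> \<open>Some vector has squared norm at least 1, since its first coordinate has second moment 1. This makes
    \<open>c\<close> large enough for the tail bound.\<close>
  have L1: "1 \<le> L"
  proof -
    have "1 = expectation (\<lambda>\<omega>. g (X' 0 \<omega>) $ 0 * g (X' 0 \<omega>) $ 0)" using iso' n k by simp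
    also have "\<dots> \<le> expectation (\<lambda>\<omega>. L)"
      using g_le[of 0] k measurable_space[OF X'_meas[OF n]] n
      by (intro integral_mono bdd_measurable_integrable bdd_measurable_mult bdd_measurable_const
          bdd_measurable_compose[OF g_bm X'_meas]) (auto simp: power2_eq_square)
    finally show ?thesis by (simp add: prob_space)
  qed
  define p where "p = nat \<lceil>ln (real k)\<rceil>"
  define c where "c = 2 * real p * L"
  have "exp 1 \<le> real k" using e_less_272 k by simp
  then have lnk: "1 \<le> ln (real k)" using k by (subst ln_ge_iff) auto
  have p: "ln (real k) \<le> real p" "real p \<le> 2 * ln (real k)" "0 < p"
    using lnk unfolding p_def by linarith+
  have "4 * L * ln (real k) \<le> real n / 32" using small by simp
  moreover have "c \<le> 4 * L * ln (real k)" unfolding c_def using p L1 mult_left_mono[OF p(2), of "2 * L"] by (simp add: mult_ac)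
  ultimately have c_le: "c \<le> real n / 32" by simp
  have pc: "2 * real p \<le> c" unfolding c_def using L1 mult_left_mono[OF L1, of "2 * real p"] by simp
  have c: "0 < c" "2 * real p * L \<le> c" "real p + 1 \<le> 2 * c"
    using pc p(3) by (simp_all add: c_def[symmetric])
  define x where "x = real n / 32 + c"
  have x: "0 < x" using c by (simp add: x_def add_nonneg_pos)
  obtain B where B: "B \<in> events" "prob B \<le> real k * (x / (c + real n / 2)) ^ p"
    "\<forall>\<omega>\<in>space M - B. \<forall>w\<in>carrier_vec k. x * (w \<bullet> w) \<le> c * (w \<bullet> w) + (\<Sum>s<n. (g (X' s \<omega>) \<bullet> w)\<^sup>2)"
    using resolvent_tail[OF indep' g_bm carr L iso' c p(3) n x] by blast
  have "x / (c + real n / 2) \<le> exp (- 2)"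
  proof -
    have "exp (2 :: real) = exp 1 * exp 1" by (simp add: exp_add[symmetric])
    also have "\<dots> \<le> 2.72 * 2.72" using e_less_272 by (intro mult_mono) auto
    finally have e: "exp (2 :: real) \<le> 8" by simp
    have "x * 8 \<le> c + real n / 2" using c_le c(1) by (simp add: x_def)
    moreover have "x * exp 2 \<le> x * 8" using e x by (intro mult_left_mono) auto
    ultimately have "x * exp 2 \<le> c + real n / 2" by simp
    then show ?thesis using c(1) by (simp add: exp_minus field_simps)
  qed
  then have "(x / (c + real n / 2)) ^ p \<le> exp (- 2) ^ p"
    using x c by (intro power_mono) auto
  also have "\<dots> = exp (- 2 * real p)" by (simp add: exp_of_nat_mult[symmetric] mult.commute)
  also have "\<dots> \<le> exp (- 2 * ln (real k))" using p by simp
  also have "\<dots> = exp (- ln (real k)) * exp (- ln (real k))" by (simp add: exp_add[symmetric])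
  also have "\<dots> = 1 / real k * (1 / real k)"
    using k by (simp add: exp_minus inverse_eq_divide)
  finally have "real k * (x / (c + real n / 2)) ^ p \<le> real k * (1 / real k * (1 / real k))"
    by (intro mult_left_mono) auto
  then have "prob B \<le> 1 / real k" using B(2) k by simp
  moreover have "lower_isometry k n g (\<lambda>i. X i \<omega>)" if "\<omega> \<in> space M - B" for \<omega>
    unfolding lower_isometry_def
  proof
    fix w :: "real Matrix.vec" assume "w \<in> carrier_vec k"
    then have "x * (w \<bullet> w) \<le> c * (w \<bullet> w) + (\<Sum>s<n. (g (X' s \<omega>) \<bullet> w)\<^sup>2)" using B(3) that by blast
    then show "1 / 32 * real n * (w \<bullet> w) \<le> (\<Sum>i<n. (g (X (int i + 1) \<omega>) \<bullet> w)\<^sup>2)"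
      by (simp add: x_def X'_def algebra_simps)
  qed
  ultimately show ?thesis using B(1) by blast
qed

end

section \<open>Convergence rates\<close>

text \<open>
  \<open>f n\<close> spans the sieve and \<open>g n\<close> is an orthonormal basis of it in \<open>L\<^sup>2(X)\<close>. Conditions on \<open>g\<close> are imposed only where
  the sieve dimension and the sample size are positive.
\<close>

locale whitened_sieve = prob_space M for M :: "'a measure" +
  fixes N :: "'b measure" and X :: "int \<Rightarrow> 'a \<Rightarrow> 'b" and K :: "nat \<Rightarrow> nat"
    and f g :: "nat \<Rightarrow> 'b \<Rightarrow> real Matrix.vec"
  assumes stationary: "strictly_stationary M N UNIV X"
    and K: "\<forall>\<^sub>F n in sequentially. 1 \<le> K n"
    and f: "\<And>n x. f n x \<in> carrier_vec (K n)"
    and g: "\<And>n x. 1 \<le> K n \<Longrightarrow> 1 \<le> n \<Longrightarrow> g n x \<in> carrier_vec (K n)"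
    and g_meas: "\<And>n a. 1 \<le> K n \<Longrightarrow> 1 \<le> n \<Longrightarrow> a < K n \<Longrightarrow> (\<lambda>x. g n x $ a) \<in> borel_measurable N"
    and g_int: "\<And>n a b. 1 \<le> K n \<Longrightarrow> 1 \<le> n \<Longrightarrow> a < K n \<Longrightarrow> b < K n \<Longrightarrow>
       integrable (distr M N (X 1)) (\<lambda>x. g n x $ a * g n x $ b)"
    and g_iso: "\<And>n a b. 1 \<le> K n \<Longrightarrow> 1 \<le> n \<Longrightarrow> a < K n \<Longrightarrow> b < K n \<Longrightarrow>
       (\<integral>x. g n x $ a * g n x $ b \<partial>distr M N (X 1)) = (if a = b then 1 else 0)"
    and fg: "\<And>n c. 1 \<le> K n \<Longrightarrow> 1 \<le> n \<Longrightarrow> c \<in> carrier_vec (K n) \<Longrightarrow>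
       \<exists>w\<in>carrier_vec (K n). (\<forall>x. f n x \<bullet> c = g n x \<bullet> w) \<and> (c \<noteq> 0\<^sub>v (K n) \<longrightarrow> w \<noteq> 0\<^sub>v (K n))"
    and isometry: "\<And>\<eta>. 0 < \<eta> \<Longrightarrow> \<forall>\<^sub>F n in sequentially. \<exists>B\<in>events. prob B < \<eta> \<and>
       (\<forall>\<omega>\<in>space M - B. lower_isometry (K n) n (g n) (\<lambda>i. X i \<omega>))"
begin

definition P :: "'b measure" where "P = distr M N (X 1)"

abbreviation ls :: "nat \<Rightarrow> 'a \<Rightarrow> (int \<Rightarrow> real) \<Rightarrow> 'b \<Rightarrow> real" where
  "ls n \<omega> \<equiv> series_ls (K n) n (f n) (\<lambda>i. X i \<omega>)"

lemma X_measurable: "X i \<in> measurable M N"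
  using stationary by (auto simp: strictly_stationary_def)

lemma empirical_form_pos:
  assumes "1 \<le> K n" "1 \<le> n" "lower_isometry (K n) n (g n) xs" "c \<in> carrier_vec (K n)" "c \<noteq> 0\<^sub>v (K n)"
  shows "0 < (\<Sum>i<n. (f n (xs (int i + 1)) \<bullet> c)\<^sup>2)"
proof -
  obtain w where w: "w \<in> carrier_vec (K n)" "\<And>x. f n x \<bullet> c = g n x \<bullet> w" "w \<noteq> 0\<^sub>v (K n)"
    using fg[OF assms(1,2,4)] assms(5) by blast
  have "0 < w \<bullet> w"
    using scalar_prod_self_nonneg[of w] scalar_prod_self_eq_0[OF w(1)] w(3) by fastforce
  then have "0 < 1 / 32 * real n * (w \<bullet> w)" using assms(2) by simp
  also have "\<dots> \<le> (\<Sum>i<n. (g n (xs (int i + 1)) \<bullet> w)\<^sup>2)"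
    using assms(3) w(1) by (simp add: lower_isometry_def)
  finally show ?thesis by (simp add: w(2))
qed

lemma eventually_nonempty: "\<forall>\<^sub>F n in sequentially. 1 \<le> K n \<and> 1 \<le> n"
  using K eventually_ge_at_top[of 1] by eventually_elim simp

lemma whitened_quadratic_form:
  assumes "1 \<le> K n" "1 \<le> n" and w: "w \<in> carrier_vec (K n)"
  shows "integrable P (\<lambda>x. (g n x \<bullet> w)\<^sup>2)" "(\<integral>x. (g n x \<bullet> w)\<^sup>2 \<partial>P) = w \<bullet> w"
  using isotropic_quadratic_form[OF _ _ w, of P "g n"] g_int[OF assms(1,2)] g_iso[OF assms(1,2)]
  by (auto simp: P_def)

text \<open>
  Where the lower isometry holds, \<open>|w|\<^sup>2 \<le> (32/n)\<^sup>2 T\<close> with \<open>E T \<le> C n K\<close>; Markov's inequality at level \<open>\<eta>/2\<close> explains the constant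
  \<open>2 \<cdot> 32\<^sup>2 C/\<eta>\<close>.
\<close>

lemma series_ls_noise_rate:
  assumes mds: "martingale_difference M (past_algebra M N X \<epsilon>) {1..} \<epsilon>"
    and var: "\<And>i. i \<ge> 1 \<Longrightarrow> AE \<omega> in M.
      nn_cond_exp M (past_algebra M N X \<epsilon> (i - 1)) (\<lambda>\<omega>. ennreal ((\<epsilon> i \<omega>)\<^sup>2)) \<omega> \<le> ennreal C"
    and C: "0 \<le> C"
    and model: "\<And>i \<omega>. i \<ge> 1 \<Longrightarrow> \<omega> \<in> space M \<Longrightarrow> Y i \<omega> = h i \<omega> + \<epsilon> i \<omega>"
  shows "bigO_p M (\<lambda>n \<omega>. L2_norm P (\<lambda>x.
      ls n \<omega> (\<lambda>i. Y i \<omega>) x - ls n \<omega> (\<lambda>i. h i \<omega>) x))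
    (\<lambda>n. sqrt (real (K n) / real n))"
proof (rule bigO_pI[where A = "\<lambda>\<eta>. sqrt (2048 * C / \<eta>) + 1"])
  let ?Z = "\<lambda>n \<omega>. L2_norm P (\<lambda>x. ls n \<omega> (\<lambda>i. Y i \<omega>) x - ls n \<omega> (\<lambda>i. h i \<omega>) x)"
  fix \<eta> :: real assume \<eta>: "0 < \<eta>"
  define A where "A = sqrt (2048 * C / \<eta>) + 1"
  show "0 < sqrt (2048 * C / \<eta>) + 1"
    using \<eta> C by (intro add_nonneg_pos) auto
  have "\<forall>\<^sub>F n in sequentially. \<exists>B\<in>events. prob B < \<eta> \<and>
      (\<forall>\<omega>\<in>space M - B. \<bar>?Z n \<omega>\<bar> \<le> A * sqrt (real (K n) / real n))"
    using eventually_nonempty isometry[OF half_gt_zero[OF \<eta>]]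
  proof eventually_elim
    case (elim n)
    then have Kn: "1 \<le> K n" and n: "1 \<le> n" by auto
    obtain B1 where B1: "B1 \<in> events" "prob B1 < \<eta> / 2"
      "\<And>\<omega>. \<omega> \<in> space M - B1 \<Longrightarrow> lower_isometry (K n) n (g n) (\<lambda>i. X i \<omega>)"
      using elim(2) by blast
    note quad = whitened_quadratic_form[OF Kn n]
    define T where "T = (\<lambda>\<omega>. \<Sum>a<K n. (\<Sum>i<n. \<epsilon> (int i + 1) \<omega> * g n (X (int i + 1) \<omega>) $ a)\<^sup>2)"
    note mom = martingale_noise_second_moment[OF stationary mds var C, where n = n]
    have g_sq: "integrable P (\<lambda>x. (g n x $ a)\<^sup>2)" "(\<integral>x. (g n x $ a)\<^sup>2 \<partial>P) = 1" if "a < K n" for a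
      using g_int[OF Kn n that that] g_iso[OF Kn n that that] by (simp_all add: power2_eq_square P_def)
    have T_int: "integrable M T"
      unfolding T_def using g_sq g_meas[OF Kn n]
      by (intro Bochner_Integration.integrable_sum mom(1)) (auto simp: P_def)
    have "expectation T = (\<Sum>a<K n. expectation (\<lambda>\<omega>. (\<Sum>i<n. \<epsilon> (int i + 1) \<omega> * g n (X (int i + 1) \<omega>) $ a)\<^sup>2))"
      unfolding T_def using g_sq g_meas[OF Kn n]
      by (intro Bochner_Integration.integral_sum mom(1)) (auto simp: P_def)
    also have "\<dots> \<le> (\<Sum>a<K n. C * real n)"
    proof (rule sum_mono)
      fix a assume "a \<in> {..<K n}"
      then have a: "a < K n" by simp
      show "expectation (\<lambda>\<omega>. (\<Sum>i<n. \<epsilon> (int i + 1) \<omega> * g n (X (int i + 1) \<omega>) $ a)\<^sup>2) \<le> C * real n"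
        using mom(2)[OF _ g_meas[OF Kn n a]] g_sq[OF a] by (simp add: P_def)
    qed
    finally have ET: "expectation T \<le> C * real n * real (K n)" by (simp add: mult_ac)
    have T0: "0 \<le> T \<omega>" for \<omega> by (simp add: T_def sum_nonneg)
    obtain B2 where B2: "B2 \<in> events" "prob B2 \<le> \<eta> / 2"
      "\<And>\<omega>. \<omega> \<in> space M - B2 \<Longrightarrow> T \<omega> \<le> C * real n * real (K n) / (\<eta> / 2)"
      using markov_cover[OF T_int T0 ET, of "\<eta> / 2"] \<eta> by auto
    have "prob (B1 \<union> B2) \<le> prob B1 + prob B2" using B1 B2 by (intro measure_Un_le) auto
    then have "prob (B1 \<union> B2) < \<eta>" using B1 B2 by simp
    moreover have "\<bar>?Z n \<omega>\<bar> \<le> A * sqrt (real (K n) / real n)"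
      if \<omega>: "\<omega> \<in> space M - (B1 \<union> B2)" for \<omega>
    proof -
      have li: "lower_isometry (K n) n (g n) (\<lambda>i. X i \<omega>)" using B1(3) \<omega> by auto
      obtain w where w: "w \<in> carrier_vec (K n)"
        "\<And>x. ls n \<omega> (\<lambda>i. Y i \<omega>) x
          - ls n \<omega> (\<lambda>i. h i \<omega>) x = g n x \<bullet> w"
        "(1 / 32 * real n)\<^sup>2 * (w \<bullet> w) \<le>
          (\<Sum>a<K n. (\<Sum>i<n. (Y (int i + 1) \<omega> - h (int i + 1) \<omega>) * g n (X (int i + 1) \<omega>) $ a)\<^sup>2)"
      proof (rule series_ls_variance_bound[where f = "f n" and g = "g n" and K = "K n" and n = n
            and xs = "\<lambda>i. X i \<omega>" and ys = "\<lambda>i. Y i \<omega>" and hs = "\<lambda>i. h i \<omega>" and \<kappa> = "1 / 32"])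
        show "\<exists>w\<in>carrier_vec (K n). \<forall>x. f n x \<bullet> c = g n x \<bullet> w" if "c \<in> carrier_vec (K n)" for c
          using fg[OF Kn n that] by blast
      qed (use f empirical_form_pos[OF Kn n li] li in \<open>auto simp: lower_isometry_def\<close>)
      have "(1 / 32 * real n)\<^sup>2 * (w \<bullet> w) \<le> T \<omega>"
        using w(3) model \<omega> by (simp add: T_def)
      also have "\<dots> \<le> C * real n * real (K n) / (\<eta> / 2)" using B2(3) \<omega> by auto
      finally have "w \<bullet> w \<le> 2048 * C / \<eta> * (real (K n) / real n)"
        using n \<eta> by (simp add: field_simps power2_eq_square)
      then have "sqrt (w \<bullet> w) \<le> sqrt (2048 * C / \<eta> * (real (K n) / real n))" by simp
      also have "\<dots> = sqrt (2048 * C / \<eta>) * sqrt (real (K n) / real n)" by (rule real_sqrt_mult)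
      also have "\<dots> \<le> A * sqrt (real (K n) / real n)"
        unfolding A_def by (intro mult_right_mono) auto
      finally show ?thesis
        using scalar_prod_self_nonneg[of w] by (simp add: L2_norm_def w(2) quad(2)[OF w(1)])
    qed
    ultimately show ?case using B1(1) B2(1) by (intro bexI[of _ "B1 \<union> B2"]) auto
  qed
  then show "\<forall>\<^sub>F n in sequentially. \<exists>B\<in>events. prob B < \<eta> \<and>
      (\<forall>\<omega>\<in>space M - B. \<bar>?Z n \<omega>\<bar> \<le> (sqrt (2048 * C / \<eta>) + 1) * sqrt (real (K n) / real n))"
    by (simp only: A_def)
qed

text \<open>
  Where the lower isometry holds, \<open>\<parallel>w'g\<parallel>\<^sup>2 = |w|\<^sup>2\<close> is at most \<open>32/n\<close> times the empirical sum of squares of \<open>r = h0 - hK\<close>, whose mean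
  is \<open>n \<parallel>r\<parallel>\<^sup>2\<close> by stationarity. Outside an event of probability \<open>\<eta>/2\<close> this is \<open>64 \<parallel>r\<parallel>\<^sup>2/\<eta>\<close>, and
  \<open>\<parallel>w'g - r\<parallel>\<^sup>2 \<le> 2 |w|\<^sup>2 + 2 \<parallel>r\<parallel>\<^sup>2\<close> gives the constant.
\<close>

lemma series_ls_approximation_rate:
  assumes hK: "\<And>n. 1 \<le> n \<Longrightarrow> \<exists>c\<in>carrier_vec (K n). \<forall>x. hK n x = f n x \<bullet> c" and h0_meas: "h0 \<in> borel_measurable N"
    and h0_int: "integrable P (\<lambda>x. (h0 x)\<^sup>2)"
  shows "bigO_p M (\<lambda>n \<omega>. L2_norm P (\<lambda>x.
      ls n \<omega> (\<lambda>i. h0 (X i \<omega>)) x - h0 x))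
    (\<lambda>n. L2_norm P (\<lambda>x. h0 x - hK n x))"
proof (rule bigO_pI[where A = "\<lambda>\<eta>. sqrt (128 / \<eta> + 2)"])
  let ?Z = "\<lambda>n \<omega>. L2_norm P (\<lambda>x. ls n \<omega> (\<lambda>i. h0 (X i \<omega>)) x - h0 x)"
  fix \<eta> :: real assume \<eta>: "0 < \<eta>"
  define A where "A = sqrt (128 / \<eta> + 2)"
  show "0 < sqrt (128 / \<eta> + 2)"
    using \<eta> by (simp add: add_pos_pos)
  have "\<forall>\<^sub>F n in sequentially. \<exists>B\<in>events. prob B < \<eta> \<and>
      (\<forall>\<omega>\<in>space M - B. \<bar>?Z n \<omega>\<bar> \<le> A * L2_norm P (\<lambda>x. h0 x - hK n x))"
    using eventually_nonempty isometry[OF half_gt_zero[OF \<eta>]]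
  proof eventually_elim
    case (elim n)
    then have Kn: "1 \<le> K n" and n: "1 \<le> n" by auto
    obtain B1 where B1: "B1 \<in> events" "prob B1 < \<eta> / 2"
      "\<And>\<omega>. \<omega> \<in> space M - B1 \<Longrightarrow> lower_isometry (K n) n (g n) (\<lambda>i. X i \<omega>)"
      using elim(2) by blast
    obtain c where c: "c \<in> carrier_vec (K n)" "\<And>x. hK n x = f n x \<bullet> c"
      using hK[OF n] by blast
    define r where "r = (\<lambda>x. h0 x - hK n x)"
    define m where "m = (\<integral>x. (r x)\<^sup>2 \<partial>P)"
    note quad = whitened_quadratic_form[OF Kn n]
    have g_meas': "(\<lambda>x. g n x \<bullet> w) \<in> borel_measurable N" if "w \<in> carrier_vec (K n)" for w
      unfolding scalar_prod_eq_sum[OF that] using g_meas[OF Kn n]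
      by (intro borel_measurable_sum borel_measurable_times) auto
    obtain w0 where w0: "w0 \<in> carrier_vec (K n)" "\<And>x. hK n x = g n x \<bullet> w0"
      using fg[OF Kn n c(1)] by (auto simp: c(2))
    have r_meas: "r \<in> borel_measurable N"
      unfolding r_def w0(2) using h0_meas g_meas'[OF w0(1)] by simp
    have sq_diff: "(a - b)\<^sup>2 \<le> 2 * a\<^sup>2 + 2 * b\<^sup>2" for a b :: real
      using zero_le_power2[of "a + b"] by (simp add: power2_eq_square algebra_simps)
    have r_int: "integrable P (\<lambda>x. (r x)\<^sup>2)"
    proof (rule Bochner_Integration.integrable_bound)
      show "integrable P (\<lambda>x. 2 * (h0 x)\<^sup>2 + 2 * (g n x \<bullet> w0)\<^sup>2)"
        using h0_int quad(1)[OF w0(1)] by (simp add: P_def)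
      show "(\<lambda>x. (r x)\<^sup>2) \<in> borel_measurable P" using r_meas by (simp add: P_def)
      show "AE x in P. norm ((r x)\<^sup>2) \<le> norm (2 * (h0 x)\<^sup>2 + 2 * (g n x \<bullet> w0)\<^sup>2)"
        using sq_diff by (intro AE_I2) (simp add: r_def w0(2))
    qed
    define T where "T = (\<lambda>\<omega>. \<Sum>i<n. (r (X (int i + 1) \<omega>))\<^sup>2)"
    have rX: "integrable M (\<lambda>\<omega>. (r (X i \<omega>))\<^sup>2)" "expectation (\<lambda>\<omega>. (r (X i \<omega>))\<^sup>2) = m" for i
    proof -
      have "integrable (distr M N (X i)) (\<lambda>x. (r x)\<^sup>2)" "(\<integral>x. (r x)\<^sup>2 \<partial>distr M N (X i)) = m"
        using r_int strictly_stationary_distr[OF stationary, of i] by (simp_all add: m_def P_def)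
      then show "integrable M (\<lambda>\<omega>. (r (X i \<omega>))\<^sup>2)" "expectation (\<lambda>\<omega>. (r (X i \<omega>))\<^sup>2) = m"
        using r_meas X_measurable[of i] by (simp_all add: integrable_distr_eq integral_distr)
    qed
    have T_int: "integrable M T" unfolding T_def using rX by (intro Bochner_Integration.integrable_sum) auto
    have ET: "expectation T \<le> real n * m" unfolding T_def using rX by (subst Bochner_Integration.integral_sum) auto
    have T0: "0 \<le> T \<omega>" for \<omega> by (simp add: T_def sum_nonneg)
    obtain B2 where B2: "B2 \<in> events" "prob B2 \<le> \<eta> / 2"
      "\<And>\<omega>. \<omega> \<in> space M - B2 \<Longrightarrow> T \<omega> \<le> real n * m / (\<eta> / 2)"
      using markov_cover[OF T_int T0 ET, of "\<eta> / 2"] \<eta> by auto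
    have "prob (B1 \<union> B2) \<le> prob B1 + prob B2" using B1 B2 by (intro measure_Un_le) auto
    then have "prob (B1 \<union> B2) < \<eta>" using B1 B2 by simp
    moreover have "\<bar>?Z n \<omega>\<bar> \<le> A * L2_norm P r"
      if \<omega>: "\<omega> \<in> space M - (B1 \<union> B2)" for \<omega>
    proof -
      have li: "lower_isometry (K n) n (g n) (\<lambda>i. X i \<omega>)" using B1(3) \<omega> by auto
      obtain w where w: "w \<in> carrier_vec (K n)"
        "\<And>x. ls n \<omega> (\<lambda>i. h0 (X i \<omega>)) x - f n x \<bullet> c = g n x \<bullet> w"
        "1 / 32 * real n * (w \<bullet> w) \<le>
          (\<Sum>i<n. (h0 (X (int i + 1) \<omega>) - f n (X (int i + 1) \<omega>) \<bullet> c)\<^sup>2)"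
      proof (rule series_ls_bias_bound[where f = "f n" and g = "g n" and K = "K n" and n = n
            and xs = "\<lambda>i. X i \<omega>" and hs = "\<lambda>i. h0 (X i \<omega>)" and \<kappa> = "1 / 32" and ?c0.0 = c])
        show "\<exists>w\<in>carrier_vec (K n). \<forall>x. f n x \<bullet> c = g n x \<bullet> w" if "c \<in> carrier_vec (K n)" for c
          using fg[OF Kn n that] by blast
      qed (use f empirical_form_pos[OF Kn n li] li c in \<open>auto simp: lower_isometry_def\<close>)
      have "1 / 32 * real n * (w \<bullet> w) \<le> T \<omega>" using w(3) by (simp add: T_def r_def c(2))
      also have "\<dots> \<le> real n * m / (\<eta> / 2)" using B2(3) \<omega> by auto
      finally have ww: "w \<bullet> w \<le> 64 / \<eta> * m" using n \<eta> by (simp add: field_simps)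
      have eq: "ls n \<omega> (\<lambda>i. h0 (X i \<omega>)) x - h0 x = g n x \<bullet> w - r x" for x
        using w(2)[of x] by (simp add: r_def c(2))
      have "(\<integral>x. (g n x \<bullet> w - r x)\<^sup>2 \<partial>P) \<le> (\<integral>x. 2 * (g n x \<bullet> w)\<^sup>2 + 2 * (r x)\<^sup>2 \<partial>P)"
        using quad(1)[OF w(1)] r_int sq_diff by (intro integral_mono') auto
      also have "\<dots> = 2 * (w \<bullet> w) + 2 * m"
        using quad[OF w(1)] r_int by (simp add: m_def)
      also have "\<dots> \<le> 2 * (64 / \<eta> * m) + 2 * m" using ww by simp
      also have "\<dots> = (128 / \<eta> + 2) * m" by (simp add: distrib_right)
      finally have "sqrt (\<integral>x. (g n x \<bullet> w - r x)\<^sup>2 \<partial>P) \<le> sqrt ((128 / \<eta> + 2) * m)" by simp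
      also have "\<dots> = A * L2_norm P r" by (simp add: A_def L2_norm_def m_def real_sqrt_mult)
      finally show ?thesis unfolding eq by (simp add: L2_norm_def)
    qed
    ultimately show ?case using B1(1) B2(1) unfolding r_def by (intro bexI[of _ "B1 \<union> B2"]) auto
  qed
  then show "\<forall>\<^sub>F n in sequentially. \<exists>B\<in>events. prob B < \<eta> \<and>
      (\<forall>\<omega>\<in>space M - B. \<bar>?Z n \<omega>\<bar> \<le> (sqrt (128 / \<eta> + 2)) * L2_norm P (\<lambda>x. h0 x - hK n x))"
    by (simp only: A_def)
qed

end

theorem lemma2p5:
  fixes M :: "'w measure"
    and \<X> :: "'a::euclidean_space set"
    and X :: "int \<Rightarrow> 'w \<Rightarrow> 'a"
    and Y \<epsilon> :: "int \<Rightarrow> 'w \<Rightarrow> real"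
    and h0 :: "'a \<Rightarrow> real"
    and D :: "nat \<Rightarrow> 'a set"
    and b :: "nat \<Rightarrow> nat \<Rightarrow> 'a \<Rightarrow> real"
    and K :: "nat \<Rightarrow> nat"
    and h0K :: "nat \<Rightarrow> 'a \<Rightarrow> real"
    and N P\<^sub>X :: "'a measure"
    and \<F> :: "int \<Rightarrow> 'w measure"
    and h_hat h_tilde :: "nat \<Rightarrow> 'w \<Rightarrow> 'a \<Rightarrow> real"
  assumes N: "N = restrict_space borel \<X>"
    and PX: "P\<^sub>X = distr M N (X 1)"
    and F: "\<F> = past_algebra M N X \<epsilon>"
    and h_hat: "\<And>n \<omega>. h_hat n \<omega> =
      series_ls (K n) n (sieve_vec b D (K n) n) (\<lambda>i. X i \<omega>) (\<lambda>i. Y i \<omega>)"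
    and h_tilde: "\<And>n \<omega>. h_tilde n \<omega> =
      series_ls (K n) n (sieve_vec b D (K n) n) (\<lambda>i. X i \<omega>) (\<lambda>i. h0 (X i \<omega>))"
    and prob: "prob_space M"
    and X_rv: "\<And>i. X i \<in> measurable M N"
    and eps_rv: "\<And>i. \<epsilon> i \<in> borel_measurable M"
    and D: "\<And>n. n \<ge> 1 \<Longrightarrow> D n \<subseteq> \<X> \<and> compact (D n) \<and> convex (D n) \<and> interior (D n) \<noteq> {}"
    and D_mono: "\<And>n. n \<ge> 1 \<Longrightarrow> D n \<subseteq> D (Suc n)"
    and b_meas: "\<And>k j. 1 \<le> j \<Longrightarrow> j \<le> k \<Longrightarrow> b k j \<in> borel_measurable N"
    and K: "filterlim K at_top sequentially"
    and h0_meas: "h0 \<in> borel_measurable N"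
    and h0_L2: "integrable P\<^sub>X (\<lambda>x. (h0 x)\<^sup>2)"
    and h0K: "\<And>n. n \<ge> 1 \<Longrightarrow> is_L2_projection P\<^sub>X (sieve_space b D (K n) n) h0 (h0K n)"
    and model: "\<And>i \<omega>. i \<ge> 1 \<Longrightarrow> \<omega> \<in> space M \<Longrightarrow> Y i \<omega> = h0 (X i \<omega>) + \<epsilon> i \<omega>"
    and model_mean: "\<And>i. i \<ge> 1 \<Longrightarrow>
      AE \<omega> in M. real_cond_exp M (vimage_algebra (space M) (X i) N) (\<epsilon> i) \<omega> = 0"
    and stationary: "strictly_stationary M N UNIV X"
    and eps_stationary: "strictly_stationary M borel {1..} \<epsilon>"
    and eps_mds: "martingale_difference M \<F> {1..} \<epsilon>"
    and eps_var: "\<exists>C::real. \<forall>i\<ge>1. AE \<omega> in M.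
      nn_cond_exp M (\<F> (i - 1)) (\<lambda>\<omega>. ennreal ((\<epsilon> i \<omega>)\<^sup>2)) \<omega> \<le> ennreal C"
    and eig: "\<And>k n. k \<ge> 1 \<Longrightarrow> n \<ge> 1 \<Longrightarrow> lambda_min (gram_mat M X b D k n) > 0"
    and gram_conv:
      "((\<forall>n\<ge>1. iid_vars M N {1..int n} X) \<and>
        (\<lambda>n. zeta_Kn \<X> b D (K n) n *
              ennreal (lambda_Kn M X b D (K n) n * sqrt (ln (real (K n)) / real n))) \<longlonglongrightarrow> 0) \<or>
       smallo_p M
        (\<lambda>n \<omega>. let B = design_mat (K n) n (sieve_vec_orth M X b D (K n) n) (\<lambda>i. X i \<omega>) in
           spectral_norm ((1 / real n) \<cdot>\<^sub>m (transpose_mat B * B) - 1\<^sub>m (K n)))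
        (\<lambda>_. 1)"
  shows
    "bigO_p M (\<lambda>n \<omega>. L2_norm P\<^sub>X (\<lambda>x. h_hat n \<omega> x - h_tilde n \<omega> x))
       (\<lambda>n. sqrt (real (K n) / real n)) \<and>
     bigO_p M (\<lambda>n \<omega>. L2_norm P\<^sub>X (\<lambda>x. h_tilde n \<omega> x - h0 x))
       (\<lambda>n. L2_norm P\<^sub>X (\<lambda>x. h0 x - h0K n x))"
proof -
  interpret prob_space M by (rule prob)
  define f where "f = (\<lambda>n. sieve_vec b D (K n) n)"
  define g where "g = (\<lambda>n. sieve_vec_orth M X b D (K n) n)"
  have f_carr: "f n x \<in> carrier_vec (K n)" for n x by (simp add: f_def)
  have f_meas: "(\<lambda>x. sieve_vec b D k n x $ j) \<in> borel_measurable N" if n: "n \<ge> 1" and j: "j < k" for k n j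
  proof -
    have "D n \<subseteq> \<X>" "compact (D n)" using D[OF n] by auto
    then have "D n \<in> sets N"
      unfolding N by (auto simp: sets_restrict_space compact_imp_closed intro!: image_eqI[of _ _ "D n"])
    then have "(\<lambda>x. b k (Suc j) x * indicator (D n) x) \<in> borel_measurable N"
      using b_meas[of "Suc j" k] j by (intro borel_measurable_times borel_measurable_indicator) auto
    then show ?thesis using j by (simp add: sieve_vec_def)
  qed
  note white = sieve_vec_orth_whitening[OF X_rv f_meas eig]
  have spaceN: "space N = \<X>" by (simp add: N space_restrict_space)
  have K_ge: "\<forall>\<^sub>F n in sequentially. k \<le> K n" for k
    using K by (simp add: filterlim_at_top)
  have isometry: "\<forall>\<^sub>F n in sequentially. \<exists>B\<in>events. prob B < \<eta> \<and>
       (\<forall>\<omega>\<in>space M - B. lower_isometry (K n) n (g n) (\<lambda>i. X i \<omega>))" if \<eta>: "0 < \<eta>" for \<eta> :: real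
    using gram_conv
  proof (elim disjE conjE, goal_cases)
    case iid: 1
    have pos: "0 < ennreal (1 / 12)" by simp
    show ?case
      using order_tendstoD(2)[OF iid(2) pos]
        K_ge[of 3] K_ge[of "nat \<lceil>1 / \<eta>\<rceil> + 1"] eventually_ge_at_top[of 1]
    proof eventually_elim
      case (elim n)
      then have n: "n \<ge> 1" and Kn: "K n \<ge> 1" by auto
      define l where "l = lambda_min (gram_mat M X b D (K n) n)"
      have l: "0 < l" unfolding l_def using eig n Kn by simp
      define s where "s = sqrt (ln (real (K n)) / real n)"
      have lnK: "0 < ln (real (K n))" using elim by simp
      have s: "0 < s" using lnK n by (simp add: s_def)
      have lam: "lambda_Kn M X b D (K n) n = 1 / sqrt l"
        using l by (simp add: lambda_Kn_def l_def[symmetric] powr_minus_divide powr_half_sqrt)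
      define \<zeta> where "\<zeta> = enn2real (zeta_Kn \<X> b D (K n) n)"
      have "zeta_Kn \<X> b D (K n) n \<noteq> \<infinity>"
      proof
        assume "zeta_Kn \<X> b D (K n) n = \<infinity>"
        then show False using elim(1) l s by (simp add: lam s_def[symmetric] ennreal_top_mult)
      qed
      then have zeta: "zeta_Kn \<X> b D (K n) n = ennreal \<zeta>" by (simp add: \<zeta>_def less_top)
      have \<zeta>0: "0 \<le> \<zeta>" by (simp add: \<zeta>_def)
      have "ennreal (\<zeta> * (1 / sqrt l * s)) < ennreal (1 / 12)"
        using elim(1) \<zeta>0 unfolding zeta lam s_def[symmetric] by (subst ennreal_mult') auto
      then have lt: "\<zeta> * (1 / sqrt l * s) < 1 / 12" by (simp add: ennreal_less_iff \<zeta>0 l s less_imp_le)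
      have "(\<zeta> * (1 / sqrt l * s))\<^sup>2 \<le> (1 / 12)\<^sup>2"
        using lt \<zeta>0 l s by (intro power_mono) auto
      also have "(\<zeta> * (1 / sqrt l * s))\<^sup>2 = \<zeta>\<^sup>2 / l * ln (real (K n)) / real n"
        using l lnK by (simp add: power_mult_distrib power_divide s_def)
      finally have "144 * (\<zeta>\<^sup>2 / l) * ln (real (K n)) \<le> real n" using n l by (simp add: field_simps power2_eq_square)
      moreover have "0 \<le> (\<zeta>\<^sup>2 / l) * ln (real (K n))" using l lnK by simp
      ultimately have small: "128 * (\<zeta>\<^sup>2 / l) * ln (real (K n)) \<le> real n" by simp
      have L: "g n x \<bullet> g n x \<le> \<zeta>\<^sup>2 / l" if "x \<in> space N" for x
      proof -
        have "ennreal (eucl_norm (f n x)) \<le> ennreal \<zeta>"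
          unfolding zeta[symmetric] zeta_Kn_def f_def using that spaceN by (intro SUP_upper) auto
        then have "eucl_norm (f n x) \<le> \<zeta>" using \<zeta>0 by (simp add: ennreal_le_iff)
        then have "f n x \<bullet> f n x \<le> \<zeta>\<^sup>2"
          unfolding eucl_norm_def by (metis real_sqrt_le_iff real_sqrt_unique \<zeta>0 real_sqrt_abs abs_of_nonneg)
        moreover have "g n x \<bullet> g n x \<le> (f n x \<bullet> f n x) / l"
          unfolding f_def g_def l_def by (rule white(6)[OF n _ Kn n])
        ultimately show ?thesis using l by (meson divide_right_mono less_imp_le order_trans)
      qed
      obtain B where B: "B \<in> events" "prob B \<le> 1 / real (K n)"
        "\<forall>\<omega>\<in>space M - B. lower_isometry (K n) n (g n) (\<lambda>i. X i \<omega>)"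
      proof -
        have "indep_vars (\<lambda>_. N) X {1..int n}" using iid(1) n by (auto simp: iid_vars_def)
        then have "\<exists>B\<in>events. prob B \<le> 1 / real (K n) \<and>
            (\<forall>\<omega>\<in>space M - B. lower_isometry (K n) n (g n) (\<lambda>i. X i \<omega>))"
        proof (rule iid_lower_isometry[where N = N and L = "\<zeta>\<^sup>2 / l"])
          show "distr M N (X i) = distr M N (X 1)" for i
            by (rule strictly_stationary_distr[OF stationary])
        qed (use elim(2) n small L white(1,2,4)[OF n _ Kn n] in \<open>auto simp: g_def\<close>)
        then show ?thesis using that by blast
      qed
      have "1 / \<eta> < real (K n)" using elim(3) by linarith
      then have "1 / real (K n) < \<eta>" using \<eta> Kn by (simp add: field_simps)
      then show ?case using B by (intro bexI[of _ B]) auto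
    qed
  next
    case small: 2
    show ?case
      using smallo_p_cover[OF small, of "1 / 2" \<eta>, OF _ \<eta>, unfolded Let_def, simplified] K_ge[of 1] eventually_ge_at_top[of 1]
    proof eventually_elim
      case (elim n)
      then have n: "n \<ge> 1" and Kn: "K n \<ge> 1" by auto
      define S where "S = (\<lambda>\<omega>. spectral_norm ((1 / real n) \<cdot>\<^sub>m
        (transpose_mat (design_mat (K n) n (g n) (\<lambda>i. X i \<omega>)) * design_mat (K n) n (g n) (\<lambda>i. X i \<omega>)) - 1\<^sub>m (K n)))"
      obtain B where B: "B \<in> events" "prob B < \<eta>" "\<And>\<omega>. \<omega> \<in> space M - B \<Longrightarrow> \<bar>S \<omega>\<bar> \<le> 1 / 2"
        using elim(1) unfolding S_def g_def by auto
      have "lower_isometry (K n) n (g n) (\<lambda>i. X i \<omega>)" if \<omega>: "\<omega> \<in> space M - B" for \<omega>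
        unfolding lower_isometry_def
      proof
        fix w :: "real Matrix.vec" assume w: "w \<in> carrier_vec (K n)"
        have "1 / 32 * real n * (w \<bullet> w) \<le> (1 - S \<omega>) * real n * (w \<bullet> w)"
          using B(3)[OF \<omega>] by (intro mult_right_mono scalar_prod_self_nonneg) auto
        also have "\<dots> \<le> (\<Sum>i<n. (g n (X (int i + 1) \<omega>) \<bullet> w)\<^sup>2)"
          unfolding S_def using n w white(1)[OF n _ Kn n] by (intro spectral_norm_near_identity) (auto simp: g_def)
        finally show "1 / 32 * real n * (w \<bullet> w) \<le> (\<Sum>i<n. (g n (X (int i + 1) \<omega>) \<bullet> w)\<^sup>2)" .
      qed
      then show ?case using B by blast
    qed
  qed
  interpret W: whitened_sieve M N X K f g
  proof
    show "1 \<le> K n \<Longrightarrow> 1 \<le> n \<Longrightarrow> g n x \<in> carrier_vec (K n)" for n x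
      unfolding g_def by (rule white(1))
  qed (use stationary K_ge[of 1] f_carr isometry white in \<open>auto simp: f_def g_def\<close>)
  have WP: "W.P = P\<^sub>X" by (simp add: W.P_def PX)
  obtain C where C: "\<And>i. i \<ge> 1 \<Longrightarrow> AE \<omega> in M.
      nn_cond_exp M (\<F> (i - 1)) (\<lambda>\<omega>. ennreal ((\<epsilon> i \<omega>)\<^sup>2)) \<omega> \<le> ennreal C"
    using eps_var by blast
  have C': "AE \<omega> in M. nn_cond_exp M (past_algebra M N X \<epsilon> (i - 1)) (\<lambda>\<omega>. ennreal ((\<epsilon> i \<omega>)\<^sup>2)) \<omega> \<le> ennreal (max C 0)"
    if "i \<ge> 1" for i
    using C[OF that] unfolding F by eventually_elim (auto intro: order_trans[OF _ ennreal_leI])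
  have "bigO_p M (\<lambda>n \<omega>. L2_norm P\<^sub>X (\<lambda>x. h_hat n \<omega> x - h_tilde n \<omega> x)) (\<lambda>n. sqrt (real (K n) / real n))"
    using W.series_ls_noise_rate[OF eps_mds[unfolded F] C' _ model] by (simp add: WP h_hat h_tilde f_def)
  moreover have "bigO_p M (\<lambda>n \<omega>. L2_norm P\<^sub>X (\<lambda>x. h_tilde n \<omega> x - h0 x)) (\<lambda>n. L2_norm P\<^sub>X (\<lambda>x. h0 x - h0K n x))"
  proof -
    have "\<exists>c\<in>carrier_vec (K n). \<forall>x. h0K n x = f n x \<bullet> c" if n: "n \<ge> 1" for n
    proof -
      obtain c where c: "c \<in> carrier_vec (K n)" "h0K n = (\<lambda>x. c \<bullet> sieve_vec b D (K n) n x)"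
        using h0K[OF n] by (auto simp: is_L2_projection_def sieve_space_def)
      then show ?thesis using comm_scalar_prod[OF c(1) f_carr] by (auto simp: f_def)
    qed
    then show ?thesis
      using W.series_ls_approximation_rate[of h0K h0] h0_meas h0_L2 by (simp add: WP h_tilde f_def)
  qed
  ultimately show ?thesis ..
qed

end
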